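(* Let $N\ge2$, $B_1\subset\mathbb{R}^N$ the open unit ball, $u_0\in H^1(B_1)\cap C^0(\overline{B_1})$, $\lambda_+,\lambda_->0$, and $q\in(0,1)$. Let $\mathcal K:=\{u\in H^1(B_1):u-u_0\in H^1_0(B_1)\}$ and $$J(u):=\int_{B_1}\left(\frac12|\nabla u|^2-\frac{\lambda_+}q(u^+)^q-\frac{\lambda_-}q(u^-)^q\right)dx .$$ Let $\bar u$ be a minimizer of $J$ on $\mathcal K$. Then $\bar u$ is a good solution in $B_1$ of $-\Delta u=\lambda_+(u^+)^{q-1}-\lambda_-(u^-)^{q-1}$.
   Context: $u^+=\max\{u,0\}$, $u^-=\max\{-u,0\}$. Good solution: let $\Omega\subset\mathbb{R}^N$ be open. A function $u\in H^1_{\mathrm{loc}}(\Omega)$ is a good solution of the equation in $\Omega$ if there exist a sequence $0<\varepsilon_n\to0^+$ and sequences $\{u_n\}\subset H^1_{\mathrm{loc}}(\Omega)\cap C^0(\overline\Omega)$, $\{f_n\}\subset L^\infty(\Omega)$ such that: (i) for every compact $K\subset\Omega$, $u_n\rightharpoonup u$ weakly in $H^1(K)$; $f_n\to0$ almost everywhere; $\{f_n\}$ is uniformly bounded in $L^\infty(\Omega)$; (ii) $u_n$ weakly solves $$-\Delta u_n+f_n=\lambda_+\frac{u_n^+}{(\varepsilon_n^2+u_n^2)^{\frac{2-q}2}}-\lambda_-\frac{u_n^-}{(\varepsilon_n^2+u_n^2)^{\frac{2-q}2}}\quad\text{in }\Omega.$$ *)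

theory Defs
  imports "HOL-Analysis.Analysis"
begin

(* Elements of L^2, H^1, ... are represented by functions on the whole space, of which only
   the values in Om matter.  Membership in the spaces below does not change when a function is
   modified on a null set. *)

section \<open>Test functions\<close>

primrec C_k :: "nat \<Rightarrow> ('a::euclidean_space \<Rightarrow> real) \<Rightarrow> bool" where
  "C_k 0 f \<longleftrightarrow> continuous_on UNIV f"
| "C_k (Suc k) f \<longleftrightarrow> (\<exists>g. (\<forall>x. GDERIV f x :> g x) \<and> (\<forall>i\<in>Basis. C_k k (\<lambda>x. g x \<bullet> i)))"

definition grad :: "('a::euclidean_space \<Rightarrow> real) \<Rightarrow> 'a \<Rightarrow> 'a" where
  "grad f x = (THE D. GDERIV f x :> D)"

(* C_c^infinity(Om), extended by zero to the whole space. *)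
definition test_functions :: "'a::euclidean_space set \<Rightarrow> ('a \<Rightarrow> real) set" where
  "test_functions Om =
     {\<phi>. (\<forall>k. C_k k \<phi>) \<and> compact (closure {x. \<phi> x \<noteq> 0}) \<and> closure {x. \<phi> x \<noteq> 0} \<subseteq> Om}"

section \<open>Lebesgue and Sobolev spaces\<close>

definition L2 :: "'a::euclidean_space set \<Rightarrow> ('a \<Rightarrow> 'b::euclidean_space) set" where
  "L2 Om = {f. f \<in> borel_measurable (lebesgue_on Om) \<and>
               integrable (lebesgue_on Om) (\<lambda>x. (norm (f x))\<^sup>2)}"

definition L2_loc :: "'a::euclidean_space set \<Rightarrow> ('a \<Rightarrow> 'b::euclidean_space) set" where
  "L2_loc Om = {f. \<forall>K. compact K \<and> K \<subseteq> Om \<longrightarrow> f \<in> L2 K}"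

definition L1_loc :: "'a::euclidean_space set \<Rightarrow> ('a \<Rightarrow> 'b::euclidean_space) set" where
  "L1_loc Om = {f. \<forall>K. compact K \<and> K \<subseteq> Om \<longrightarrow> integrable (lebesgue_on K) f}"

definition Linf :: "'a::euclidean_space set \<Rightarrow> ('a \<Rightarrow> real) set" where
  "Linf Om = {f. f \<in> borel_measurable (lebesgue_on Om) \<and>
                 (\<exists>M. AE x in lebesgue_on Om. \<bar>f x\<bar> \<le> M)}"

definition weak_gradient ::
  "'a::euclidean_space set \<Rightarrow> ('a \<Rightarrow> real) \<Rightarrow> ('a \<Rightarrow> 'a) \<Rightarrow> bool" where
  "weak_gradient Om u g \<longleftrightarrow> u \<in> L1_loc Om \<and> g \<in> L1_loc Om \<and>
     (\<forall>\<phi>\<in>test_functions Om. \<forall>i\<in>Basis.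
        (LINT x|lebesgue_on Om. u x * (grad \<phi> x \<bullet> i)) =
        - (LINT x|lebesgue_on Om. (g x \<bullet> i) * \<phi> x))"

(* A representative of the weak gradient.  The weak gradient is unique up to null sets and wgrad
   only occurs under integrals, so the choice is immaterial. *)
definition wgrad :: "'a::euclidean_space set \<Rightarrow> ('a \<Rightarrow> real) \<Rightarrow> 'a \<Rightarrow> 'a" where
  "wgrad Om u = (SOME g. weak_gradient Om u g)"

definition H1 :: "'a::euclidean_space set \<Rightarrow> ('a \<Rightarrow> real) set" where
  "H1 Om = {u. u \<in> L2 Om \<and> (\<exists>g. weak_gradient Om u g \<and> g \<in> L2 Om)}"

definition H1_loc :: "'a::euclidean_space set \<Rightarrow> ('a \<Rightarrow> real) set" where
  "H1_loc Om = {u. u \<in> L2_loc Om \<and> (\<exists>g. weak_gradient Om u g \<and> g \<in> L2_loc Om)}"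

definition H1_norm :: "'a::euclidean_space set \<Rightarrow> ('a \<Rightarrow> real) \<Rightarrow> real" where
  "H1_norm Om u =
     sqrt ((LINT x|lebesgue_on Om. (u x)\<^sup>2) + (LINT x|lebesgue_on Om. (norm (wgrad Om u x))\<^sup>2))"

definition H1_0 :: "'a::euclidean_space set \<Rightarrow> ('a \<Rightarrow> real) set" where
  "H1_0 Om = {u \<in> H1 Om. \<exists>\<phi>. (\<forall>n. \<phi> n \<in> test_functions Om) \<and>
                 (\<lambda>n::nat. H1_norm Om (\<lambda>x. u x - \<phi> n x)) \<longlonglongrightarrow> 0}"

section \<open>Weak convergence in \<open>H\<^sup>1\<close>\<close>

(* Bounded linear functionals on H1 Om.  Boundedness and linearity force L to agree on functions
   that are equal almost everywhere in Om; values of L outside H1 Om are irrelevant. *)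
definition H1_dual :: "'a::euclidean_space set \<Rightarrow> (('a \<Rightarrow> real) \<Rightarrow> real) set" where
  "H1_dual Om = {L.
     (\<forall>u\<in>H1 Om. \<forall>v\<in>H1 Om. L (\<lambda>x. u x + v x) = L u + L v) \<and>
     (\<forall>c. \<forall>u\<in>H1 Om. L (\<lambda>x. c * u x) = c * L u) \<and>
     (\<exists>C. \<forall>u\<in>H1 Om. \<bar>L u\<bar> \<le> C * H1_norm Om u)}"

definition weakly_converges_H1 ::
  "'a::euclidean_space set \<Rightarrow> (nat \<Rightarrow> 'a \<Rightarrow> real) \<Rightarrow> ('a \<Rightarrow> real) \<Rightarrow> bool" where
  "weakly_converges_H1 Om un u \<longleftrightarrow> (\<forall>n. un n \<in> H1 Om) \<and> u \<in> H1 Om \<and>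
     (\<forall>L\<in>H1_dual Om. (\<lambda>n. L (un n)) \<longlonglongrightarrow> L u)"

section \<open>The equation\<close>

definition pos :: "real \<Rightarrow> real" where "pos t = max t 0"
definition neg :: "real \<Rightarrow> real" where "neg t = max (- t) 0"

(* u weakly solves  - Laplace u + f = h  in Om. *)
definition weak_solution ::
  "'a::euclidean_space set \<Rightarrow> ('a \<Rightarrow> real) \<Rightarrow> ('a \<Rightarrow> real) \<Rightarrow> ('a \<Rightarrow> real) \<Rightarrow> bool" where
  "weak_solution Om f h u \<longleftrightarrow> (\<forall>\<phi>\<in>test_functions Om.
     (LINT x|lebesgue_on Om. wgrad Om u x \<bullet> grad \<phi> x) + (LINT x|lebesgue_on Om. f x * \<phi> x) =
     (LINT x|lebesgue_on Om. h x * \<phi> x))"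

(* For compact K, H^1(K) is read as H^1 of the interior of K. *)
definition good_solution ::
  "'a::euclidean_space set \<Rightarrow> real \<Rightarrow> real \<Rightarrow> real \<Rightarrow> ('a \<Rightarrow> real) \<Rightarrow> bool" where
  "good_solution Om lp lm q u \<longleftrightarrow> u \<in> H1_loc Om \<and>
     (\<exists>(\<epsilon> :: nat \<Rightarrow> real) (un :: nat \<Rightarrow> 'a \<Rightarrow> real) (fn :: nat \<Rightarrow> 'a \<Rightarrow> real).
        (\<forall>n. 0 < \<epsilon> n) \<and> \<epsilon> \<longlonglongrightarrow> 0 \<and>
        (\<forall>n. un n \<in> H1_loc Om \<and> continuous_on (closure Om) (un n)) \<and>
        (\<forall>n. fn n \<in> Linf Om) \<and>
        (\<forall>K. compact K \<and> K \<subseteq> Om \<longrightarrow> weakly_converges_H1 (interior K) un u) \<and>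
        (AE x in lebesgue_on Om. (\<lambda>n. fn n x) \<longlonglongrightarrow> 0) \<and>
        (\<exists>M. \<forall>n. AE x in lebesgue_on Om. \<bar>fn n x\<bar> \<le> M) \<and>
        (\<forall>n. weak_solution Om (fn n)
               (\<lambda>x. lp * pos (un n x) / ((\<epsilon> n)\<^sup>2 + (un n x)\<^sup>2) powr ((2 - q) / 2)
                  - lm * neg (un n x) / ((\<epsilon> n)\<^sup>2 + (un n x)\<^sup>2) powr ((2 - q) / 2))
               (un n)))"

section \<open>The variational problem\<close>

definition admissible ::
  "'a::euclidean_space set \<Rightarrow> ('a \<Rightarrow> real) \<Rightarrow> ('a \<Rightarrow> real) set" where
  "admissible Om u0 = {u \<in> H1 Om. (\<lambda>x. u x - u0 x) \<in> H1_0 Om}"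

definition J ::
  "'a::euclidean_space set \<Rightarrow> real \<Rightarrow> real \<Rightarrow> real \<Rightarrow> ('a \<Rightarrow> real) \<Rightarrow> real" where
  "J Om lp lm q u = (LINT x|lebesgue_on Om.
     (norm (wgrad Om u x))\<^sup>2 / 2 - lp / q * pos (u x) powr q - lm / q * neg (u x) powr q)"

definition minimizer :: "(('a \<Rightarrow> real) \<Rightarrow> real) \<Rightarrow> ('a \<Rightarrow> real) set \<Rightarrow> ('a \<Rightarrow> real) \<Rightarrow> bool" where
  "minimizer F A u \<longleftrightarrow> u \<in> A \<and> (\<forall>v\<in>A. F u \<le> F v)"

end

theory Submission
  imports Defs
begin

text \<open>
  The regularized primitives \<open>G_reg\<close> of the nonlinearity differ from the singular one by at most
  a multiple of \<open>\<epsilon> powr q\<close>, uniformly.  Hence the minimizer \<open>ubar\<close> of \<open>J\<close> minimizes the regularized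
  energy up to an arbitrarily small error.  An almost minimizer is close to an exact minimizer of a
  slightly perturbed functional: the smooth variational principle of Borwein and Preiss adds
  a small sum of smoothed distances \<open>pen\<close> to previously chosen points.  The Euler--Lagrange equation
  of the perturbed functional is the regularized equation with a right-hand side \<open>f\<close>, the derivative
  of the perturbation, which is uniformly small (\<open>almost_minimizer_near_solution\<close>).  The
  limit in the variational principle is a limit in $L^1$ along which the Dirichlet energy is bounded, and
  \<open>L1_cauchy_energy_limit\<close> gives lower semicontinuity there by convexity.

  These solutions converge strongly in $H^1$, since the midpoint of such a solution and \<open>ubar\<close> is
  admissible and so has energy at least \<open>J ubar\<close>; the parallelogram identity for the Dirichlet energy,
  the continuity of the lower order term in $L^1$ and the Poincare inequality do the rest
  (\<open>minimizer_approximation\<close>).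

  For fixed \<open>\<epsilon>\<close> the Laplacian of a solution is bounded, and then averages over shrinking balls are
  uniformly Cauchy, so the solution has a representative that is continuous in the open ball
  (\<open>interior_continuity\<close>).  A good solution needs approximations that are continuous up to the boundary, with
  boundary values of any kind.  The equation is invariant under
  $u(x) \mapsto c\, u(r x)$ with $c = r^{-2/(2-q)}$ and \<open>\<epsilon>\<close> replaced by \<open>c * \<epsilon>\<close> (\<open>g_reg_scaling\<close>);
  for \<open>r < 1\<close> the dilated function is continuous on the closed ball.  Letting \<open>r\<close> tend to 1 does not
  destroy the strong convergence, since dilations act continuously on $L^2$.
\<close>

section \<open>Smooth functions\<close>

abbreviation smooth :: "('a::euclidean_space \<Rightarrow> real) \<Rightarrow> bool" where
  "smooth f \<equiv> (\<forall>k. C_k k f)"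

lemma GDERIV_unique:
  assumes "GDERIV f x :> a" "GDERIV f x :> b"
  shows "a = b"
proof -
  have "(\<lambda>h. h \<bullet> a) = (\<lambda>h. h \<bullet> b)"
    using assms unfolding gderiv_def by (rule has_derivative_unique)
  then have "h \<bullet> a = h \<bullet> b" for h by (rule fun_cong)
  from this[of "a - b"] have "(a - b) \<bullet> (a - b) = 0" by (simp add: inner_diff_right)
  then show ?thesis by simp
qed

lemma grad_eq: "GDERIV f x :> D \<Longrightarrow> grad f x = D"
  unfolding grad_def by (rule the_equality) (auto intro: GDERIV_unique)

lemma GDERIV_continuous_on:
  assumes "\<And>x. GDERIV f x :> g x" shows "continuous_on A f"
  using assms unfolding gderiv_def
  by (intro continuous_at_imp_continuous_on ballI) (rule has_derivative_continuous)

lemma C_k_SucD: "C_k (Suc k) f \<Longrightarrow> C_k k f"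
proof (induction k arbitrary: f)
  case 0
  then show ?case using GDERIV_continuous_on by auto
next
  case (Suc k)
  from Suc.prems obtain g where g: "\<forall>x. GDERIV f x :> g x" "\<forall>i\<in>Basis. C_k (Suc k) (\<lambda>x. g x \<bullet> i)"
    unfolding C_k.simps(2)[of "Suc k"] by blast
  show ?case
    unfolding C_k.simps(2)[of k] using g(1) Suc.IH g(2) by blast
qed

text \<open>The definition of \<open>C_k\<close> allows a different gradient for every order; as gradients are unique,
  all orders share the gradient \<open>grad f\<close>.\<close>

lemma smooth_iff:
  "smooth f \<longleftrightarrow> (\<forall>x. GDERIV f x :> grad f x) \<and> (\<forall>i\<in>Basis. smooth (\<lambda>x. grad f x \<bullet> i))"
proof
  assume f: "smooth f"
  have "\<exists>g. (\<forall>x. GDERIV f x :> g x) \<and> (\<forall>i\<in>Basis. C_k k (\<lambda>x. g x \<bullet> i))" for k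
    using f C_k.simps(2)[of k f] by blast
  then obtain G where G: "\<And>k x. GDERIV f x :> G k x" "\<And>k i. i \<in> Basis \<Longrightarrow> C_k k (\<lambda>x. G k x \<bullet> i)"
    by metis
  have "grad f = G k" for k using grad_eq G(1) by blast
  then show "(\<forall>x. GDERIV f x :> grad f x) \<and> (\<forall>i\<in>Basis. smooth (\<lambda>x. grad f x \<bullet> i))"
    using G by metis
next
  assume r: "(\<forall>x. GDERIV f x :> grad f x) \<and> (\<forall>i\<in>Basis. smooth (\<lambda>x. grad f x \<bullet> i))"
  have "C_k (Suc k) f" for k unfolding C_k.simps(2) using r by blast
  then show "smooth f" using C_k_SucD by blast
qed

lemma smooth_GDERIV: "smooth f \<Longrightarrow> GDERIV f x :> grad f x"
  using smooth_iff by blast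

lemma smooth_grad: "smooth f \<Longrightarrow> i \<in> Basis \<Longrightarrow> smooth (\<lambda>x. grad f x \<bullet> i)"
  using smooth_iff by blast

lemma smooth_continuous_on: "smooth f \<Longrightarrow> continuous_on A f"
  using C_k.simps(1) continuous_on_subset by blast

lemma smooth_continuous_grad:
  assumes "smooth f" shows "continuous_on A (grad f)"
  by (subst continuous_on_componentwise) (use smooth_grad[OF assms] smooth_continuous_on in blast)

lemma smooth_const [intro]: "smooth (\<lambda>x. c)"
proof
  fix k
  show "C_k k (\<lambda>x::'a. c)"
    by (induction k arbitrary: c) (auto intro!: exI[of _ "\<lambda>_. 0"] GDERIV_const)
qed

lemma C_k_add: "C_k k f \<Longrightarrow> C_k k g \<Longrightarrow> C_k k (\<lambda>x. f x + g x)"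
proof (induction k arbitrary: f g)
  case 0
  then show ?case by (auto intro: continuous_intros)
next
  case (Suc k)
  from Suc.prems obtain a b where "\<forall>x. GDERIV f x :> a x" "\<forall>i\<in>Basis. C_k k (\<lambda>x. a x \<bullet> i)"
    "\<forall>x. GDERIV g x :> b x" "\<forall>i\<in>Basis. C_k k (\<lambda>x. b x \<bullet> i)" by auto
  then show ?case using Suc.IH
    by (auto intro!: exI[of _ "\<lambda>x. a x + b x"] GDERIV_add simp: inner_add_left)
qed

lemma C_k_mult: "C_k k f \<Longrightarrow> C_k k g \<Longrightarrow> C_k k (\<lambda>x. f x * g x)"
proof (induction k arbitrary: f g)
  case 0
  then show ?case by (auto intro: continuous_intros)
next
  case (Suc k)
  from Suc.prems obtain a b where "\<forall>x. GDERIV f x :> a x" "\<forall>i\<in>Basis. C_k k (\<lambda>x. a x \<bullet> i)"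
    "\<forall>x. GDERIV g x :> b x" "\<forall>i\<in>Basis. C_k k (\<lambda>x. b x \<bullet> i)" by auto
  moreover have "C_k k f" "C_k k g" using Suc.prems C_k_SucD by blast+
  ultimately show ?case using Suc.IH
    by (auto intro!: exI[of _ "\<lambda>x. f x *\<^sub>R b x + g x *\<^sub>R a x"] GDERIV_mult C_k_add
        simp: inner_add_left)
qed

lemma smooth_add [intro]: "smooth f \<Longrightarrow> smooth g \<Longrightarrow> smooth (\<lambda>x. f x + g x)"
  using C_k_add by blast

lemma smooth_mult [intro]: "smooth f \<Longrightarrow> smooth g \<Longrightarrow> smooth (\<lambda>x. f x * g x)"
  using C_k_mult by blast

lemma smooth_cmult [intro]: "smooth f \<Longrightarrow> smooth (\<lambda>x. c * f x)"
  by (intro smooth_mult smooth_const)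

lemma smooth_diff [intro]: "smooth f \<Longrightarrow> smooth g \<Longrightarrow> smooth (\<lambda>x. f x - g x)"
  using smooth_add[of f "\<lambda>x. (-1) * g x"] smooth_cmult[of g "-1"] by simp

lemma smooth_sum [intro]: "(\<And>i. i \<in> I \<Longrightarrow> smooth (f i)) \<Longrightarrow> smooth (\<lambda>x. \<Sum>i\<in>I. f i x)"
  by (induction I rule: infinite_finite_induct) (simp_all add: smooth_const smooth_add)

lemma smooth_prod [intro]: "(\<And>i. i \<in> I \<Longrightarrow> smooth (f i)) \<Longrightarrow> smooth (\<lambda>x. \<Prod>i\<in>I. f i x)"
  by (induction I rule: infinite_finite_induct) (simp_all add: smooth_const smooth_mult)

lemma smooth_inner [intro]: "smooth (\<lambda>x::'a::euclidean_space. x \<bullet> v)"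
proof -
  have D: "GDERIV (\<lambda>x::'a. x \<bullet> v) x :> v" for x
    unfolding gderiv_def by (auto intro!: derivative_eq_intros)
  then have "grad (\<lambda>x::'a. x \<bullet> v) = (\<lambda>_. v)" using grad_eq by blast
  then show ?thesis by (subst smooth_iff) (use D smooth_const in auto)
qed

lemma GDERIV_affine:
  assumes "GDERIV f (c *\<^sub>R x + a) :> D"
  shows "GDERIV (\<lambda>x. f (c *\<^sub>R x + a)) x :> c *\<^sub>R D"
proof -
  have "((\<lambda>x. c *\<^sub>R x + a) has_derivative (\<lambda>h. c *\<^sub>R h)) (at x)"
    by (auto intro!: derivative_eq_intros)
  from diff_chain_at[OF this assms[unfolded gderiv_def]] show ?thesis
    by (simp add: gderiv_def o_def)
qed

lemma C_k_affine: "C_k k f \<Longrightarrow> C_k k (\<lambda>x. f (c *\<^sub>R x + a))"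
proof (induction k arbitrary: f)
  case 0
  then show ?case by (auto intro!: continuous_intros continuous_on_compose2[of UNIV f])
next
  case (Suc k)
  from Suc.prems obtain g where g: "\<forall>x. GDERIV f x :> g x" "\<forall>i\<in>Basis. C_k k (\<lambda>x. g x \<bullet> i)"
    by auto
  show ?case unfolding C_k.simps
  proof (intro exI conjI allI ballI)
    show "GDERIV (\<lambda>x. f (c *\<^sub>R x + a)) x :> c *\<^sub>R g (c *\<^sub>R x + a)" for x
      using g(1) by (intro GDERIV_affine) auto
    fix i :: 'a assume i: "i \<in> Basis"
    show "C_k k (\<lambda>x. c *\<^sub>R g (c *\<^sub>R x + a) \<bullet> i)"
      using C_k_mult[of k "\<lambda>_. c" "\<lambda>x. g (c *\<^sub>R x + a) \<bullet> i"] smooth_const[of c]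
        Suc.IH[of "\<lambda>x. g x \<bullet> i"] g(2) i by auto
  qed
qed

lemma smooth_affine [intro]: "smooth f \<Longrightarrow> smooth (\<lambda>x. f (c *\<^sub>R x + a))"
  using C_k_affine by blast

lemma grad_affine: "smooth f \<Longrightarrow> grad (\<lambda>x. f (c *\<^sub>R x + a)) x = c *\<^sub>R grad f (c *\<^sub>R x + a)"
  by (intro grad_eq GDERIV_affine smooth_GDERIV)

lemma grad_mult: "smooth f \<Longrightarrow> smooth g \<Longrightarrow>
    grad (\<lambda>x. f x * g x) x = f x *\<^sub>R grad g x + g x *\<^sub>R grad f x"
  by (intro grad_eq GDERIV_mult smooth_GDERIV)

lemma grad_cmult: "smooth f \<Longrightarrow> grad (\<lambda>x. c * f x) x = c *\<^sub>R grad f x"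
  using grad_mult[of "\<lambda>_. c" f x] grad_eq[OF GDERIV_const[of c x]] by (simp add: smooth_const)

section \<open>A bump function\<close>

text \<open>The span of the functions $t^{-m} e^{-1/t}$, extended by zero to the negative half-line, is closed
  under differentiation.  Hence smoothness of all of them follows by one induction on the order.\<close>

definition flat :: "nat \<Rightarrow> real \<Rightarrow> real" where
  "flat m t = (if t > 0 then exp (- 1 / t) / t ^ m else 0)"

lemma flat_pos: "t > 0 \<Longrightarrow> flat m t > 0" by (simp add: flat_def)
lemma flat_nonneg: "flat m t \<ge> 0" by (simp add: flat_def)
lemma flat_nonpos: "t \<le> 0 \<Longrightarrow> flat m t = 0" by (simp add: flat_def)

lemma flat_bound:
  assumes "t > 0" shows "flat m t \<le> fact (m + 2) * t ^ 2"
proof -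
  have "(\<Sum>k\<in>{m + 2}. (1 / t) ^ k /\<^sub>R fact k) \<le> (\<Sum>k. (1 / t) ^ k /\<^sub>R fact k)"
    using assms by (intro sum_le_suminf summable_exp_generic) auto
  also have "\<dots> = exp (1 / t)" by (simp add: exp_def)
  finally have "(1 / t) ^ (m + 2) / fact (m + 2) \<le> exp (1 / t)"
    by (simp add: field_simps del: fact_Suc)
  then have "1 \<le> exp (1 / t) * (fact (m + 2) * (t ^ 2 * t ^ m))"
    using assms by (simp add: field_simps power_add power2_eq_square del: fact_Suc)
  then show ?thesis
    using assms by (simp add: flat_def exp_minus field_simps power2_eq_square del: fact_Suc)
qed

lemma DERIV_flat: "DERIV (flat m) t :> flat (m + 2) t - real m * flat (m + 1) t"
proof -
  consider "t > 0" | "t < 0" | "t = 0" by linarith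
  then show ?thesis
  proof cases
    case 1
    have "((\<lambda>t. exp (- 1 / t) / t ^ m) has_real_derivative
        flat (m + 2) t - real m * flat (m + 1) t) (at t)"
    proof (cases m)
      case 0
      then show ?thesis using 1
        by (auto intro!: derivative_eq_intros simp: flat_def power2_eq_square divide_simps)
    next
      case (Suc k)
      then show ?thesis using 1
        apply (auto intro!: derivative_eq_intros simp: flat_def power2_eq_square)
        apply (simp add: divide_simps)
        apply (cases k; simp add: algebra_simps)
        done
    qed
    then show ?thesis
      by (rule has_field_derivative_transform_within_open[of _ _ _ "{0<..}"])
        (use 1 in \<open>auto simp: flat_def\<close>)
  next
    case 2
    have "((\<lambda>t. 0) has_real_derivative 0) (at t)" by simp
    then have "(flat m has_real_derivative 0) (at t)"
      by (rule has_field_derivative_transform_within_open[of _ _ _ "{..<0}"])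
        (use 2 in \<open>auto simp: flat_def\<close>)
    then show ?thesis using 2 by (simp add: flat_def)
  next
    case 3
    have "((\<lambda>h. (flat m h - flat m 0) / (h - 0)) \<longlongrightarrow> 0) (at 0)"
    proof (rule Lim_null_comparison)
      show "((\<lambda>h::real. fact (m + 2) * \<bar>h\<bar>) \<longlongrightarrow> 0) (at 0)"
        by (auto intro!: tendsto_eq_intros)
      show "\<forall>\<^sub>F h in at 0. norm ((flat m h - flat m 0) / (h - 0)) \<le> fact (m + 2) * \<bar>h\<bar>"
      proof (rule eventuallyI)
        fix h :: real
        show "norm ((flat m h - flat m 0) / (h - 0)) \<le> fact (m + 2) * \<bar>h\<bar>"
        proof (cases "h > 0")
          case True
          then show ?thesis using flat_bound[OF True, of m] flat_nonneg[of m h]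
            by (simp add: flat_nonpos field_simps power2_eq_square)
        qed (use mult_nonneg_nonpos[of "fact (m + 2)" h] in \<open>simp add: flat_nonpos del: fact_Suc\<close>)
      qed
    qed
    then show ?thesis using 3 by (simp add: has_field_derivative_iff flat_nonpos)
  qed
qed

text \<open>The induction on the order runs over all \<open>m\<close> at once, because the derivative of \<open>flat m\<close> involves
  the next two functions of the family.\<close>

lemma smooth_flat_compose:
  fixes s :: "'a::euclidean_space \<Rightarrow> real"
  assumes "smooth s"
  shows "smooth (\<lambda>x. flat m (s x))"
proof
  fix k
  show "C_k k (\<lambda>x. flat m (s x))"
  proof (induction k arbitrary: m)
    case 0
    have "continuous_on UNIV (flat m)"
      by (intro continuous_at_imp_continuous_on) (use DERIV_flat DERIV_isCont in blast)
    then show ?case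
      using continuous_on_compose2[of UNIV "flat m" UNIV s] smooth_continuous_on[OF assms]
      by auto
  next
    case (Suc k)
    let ?d = "\<lambda>x. flat (m + 2) (s x) - real m * flat (m + 1) (s x)"
    show ?case unfolding C_k.simps
    proof (intro exI conjI allI ballI)
      show "GDERIV (\<lambda>x. flat m (s x)) x :> ?d x *\<^sub>R grad s x" for x
        by (intro GDERIV_DERIV_compose smooth_GDERIV assms DERIV_flat)
      fix i :: 'a assume i: "i \<in> Basis"
      have "C_k k (\<lambda>x. (flat (m + 2) (s x) + (- real m) * flat (m + 1) (s x)) * (grad s x \<bullet> i))"
        using Suc.IH smooth_const smooth_grad[OF assms i] by (intro C_k_mult C_k_add) auto
      then show "C_k k (\<lambda>x. ?d x *\<^sub>R grad s x \<bullet> i)" by simp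
    qed
  qed
qed

lemma grad_flat_compose:
  assumes "smooth s"
  shows "grad (\<lambda>x. flat m (s x)) x
      = (flat (m + 2) (s x) - real m * flat (m + 1) (s x)) *\<^sub>R grad s x"
  by (intro grad_eq GDERIV_DERIV_compose smooth_GDERIV assms DERIV_flat)

section \<open>Test functions\<close>

lemma test_smooth: "\<phi> \<in> test_functions Om \<Longrightarrow> smooth \<phi>"
  by (simp add: test_functions_def)

lemma test_functionsI:
  assumes "smooth \<phi>" "compact K" "K \<subseteq> Om" "\<And>x. x \<notin> K \<Longrightarrow> \<phi> x = 0"
  shows "\<phi> \<in> test_functions Om"
proof -
  have K: "closure {x. \<phi> x \<noteq> 0} \<subseteq> K"
    using assms by (intro closure_minimal compact_imp_closed) auto
  have "compact (K \<inter> closure {x. \<phi> x \<noteq> 0})"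
    using assms(2) by (intro compact_Int_closed) auto
  then have "compact (closure {x. \<phi> x \<noteq> 0})" using K by (simp add: Int_absorb1)
  then show ?thesis
    using assms K unfolding test_functions_def by auto
qed

lemma test_functionsE:
  assumes "\<phi> \<in> test_functions Om"
  obtains K where "compact K" "K \<subseteq> Om" "smooth \<phi>" "\<And>x. x \<notin> K \<Longrightarrow> \<phi> x = 0"
    "\<And>x. x \<notin> K \<Longrightarrow> grad \<phi> x = 0"
proof
  let ?K = "closure {x. \<phi> x \<noteq> 0}"
  show "compact ?K" "?K \<subseteq> Om" "smooth \<phi>" using assms by (auto simp: test_functions_def)
  show z: "\<phi> x = 0" if "x \<notin> ?K" for x
    using that closure_subset[of "{x. \<phi> x \<noteq> 0}"] by auto
  show "grad \<phi> x = 0" if "x \<notin> ?K" for x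
  proof (rule grad_eq)
    have "((\<lambda>_. 0) has_derivative (\<lambda>h. 0)) (at x)" by simp
    moreover have "open (- ?K)" "x \<in> - ?K" using that by auto
    moreover have "0 = \<phi> y" if "y \<in> - ?K" for y using z that by (metis ComplD)
    ultimately have "(\<phi> has_derivative (\<lambda>h. 0)) (at x)"
      by (rule has_derivative_transform_within_open)
    then show "GDERIV \<phi> x :> 0" unfolding gderiv_def inner_zero_right .
  qed
qed

lemma test_mono: "Om \<subseteq> Om' \<Longrightarrow> \<phi> \<in> test_functions Om \<Longrightarrow> \<phi> \<in> test_functions Om'"
  unfolding test_functions_def by blast

lemma test_cmult: "\<phi> \<in> test_functions Om \<Longrightarrow> (\<lambda>x. c * \<phi> x) \<in> test_functions Om"
  by (erule test_functionsE) (rule test_functionsI, auto simp: smooth_cmult)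

lemma test_add:
  assumes "\<phi> \<in> test_functions Om" "\<psi> \<in> test_functions Om"
  shows "(\<lambda>x. \<phi> x + \<psi> x) \<in> test_functions Om"
proof -
  obtain K where K: "compact K" "K \<subseteq> Om" "smooth \<phi>" "\<And>x. x \<notin> K \<Longrightarrow> \<phi> x = 0"
    using assms(1) by (rule test_functionsE) blast
  obtain L where L: "compact L" "L \<subseteq> Om" "smooth \<psi>" "\<And>x. x \<notin> L \<Longrightarrow> \<psi> x = 0"
    using assms(2) by (rule test_functionsE) blast
  show ?thesis
    by (rule test_functionsI[of _ "K \<union> L"]) (use K L in \<open>auto simp: smooth_add\<close>)
qed

lemma test_smult:
  assumes "smooth f" "\<phi> \<in> test_functions Om"
  shows "(\<lambda>x. f x * \<phi> x) \<in> test_functions Om"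
  using assms(2) by (rule test_functionsE) (rule test_functionsI, use assms(1) in \<open>auto intro: C_k_mult\<close>)

lemma test_grad:
  assumes "\<phi> \<in> test_functions Om" "i \<in> Basis"
  shows "(\<lambda>x. grad \<phi> x \<bullet> i) \<in> test_functions Om"
  using assms(1) by (rule test_functionsE) (rule test_functionsI, auto simp: smooth_grad assms(2))

section \<open>Integration tools\<close>

text \<open>The mean value theorem turns the bound on the derivative into a bound on the difference quotients, to
  which dominated convergence applies.\<close>

lemma DERIV_under_integral:
  fixes f f' :: "real \<Rightarrow> 'a \<Rightarrow> real"
  assumes t0: "a < t0" "t0 < b"
    and int: "\<And>t. a < t \<Longrightarrow> t < b \<Longrightarrow> integrable M (f t)"
    and der: "\<And>t x. a < t \<Longrightarrow> t < b \<Longrightarrow> x \<in> space M \<Longrightarrow> ((\<lambda>t. f t x) has_real_derivative f' t x) (at t)"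
    and bnd: "\<And>t x. a < t \<Longrightarrow> t < b \<Longrightarrow> x \<in> space M \<Longrightarrow> \<bar>f' t x\<bar> \<le> w x"
    and w: "integrable M w"
  shows "((\<lambda>t. LINT x|M. f t x) has_real_derivative (LINT x|M. f' t0 x)) (at t0)"
proof -
  have lip: "\<bar>f t x - f t0 x\<bar> \<le> w x * \<bar>t - t0\<bar>" if t: "a < t" "t < b" and x: "x \<in> space M" for t x
  proof -
    have "norm (f t x - f t0 x) \<le> w x * norm (t - t0)"
    proof (rule field_differentiable_bound[of "{a<..<b}" "\<lambda>t. f t x" "\<lambda>t. f' t x"])
      show "((\<lambda>t. f t x) has_field_derivative f' z x) (at z within {a<..<b})" if "z \<in> {a<..<b}" for z
        using that x by (intro has_field_derivative_at_within[OF der]) auto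
    qed (use t t0 bnd x in auto)
    then show ?thesis by simp
  qed
  have main: "(\<lambda>n. ((LINT x|M. f (X n) x) - (LINT x|M. f t0 x)) / (X n - t0)) \<longlonglongrightarrow> (LINT x|M. f' t0 x)"
    if X: "\<And>n. a < X n \<and> X n < b \<and> X n \<noteq> t0" "X \<longlonglongrightarrow> t0" for X
  proof -
    let ?q = "\<lambda>n x. (f (X n) x - f t0 x) / (X n - t0)"
    have lim: "(\<lambda>n. ?q n x) \<longlonglongrightarrow> f' t0 x" if x: "x \<in> space M" for x
    proof -
      have "((\<lambda>t. (f t x - f t0 x) / (t - t0)) \<longlongrightarrow> f' t0 x) (at t0)"
        using der[OF t0 x] by (simp add: has_field_derivative_iff)
      then show ?thesis
        using X unfolding tendsto_at_iff_sequentially by (auto simp: o_def)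
    qed
    have meas: "?q n \<in> borel_measurable M" for n
      by (intro borel_measurable_divide borel_measurable_diff borel_measurable_integrable[OF int]
          borel_measurable_const) (use X t0 in auto)
    have meas': "f' t0 \<in> borel_measurable M"
      by (rule borel_measurable_LIMSEQ_metric[OF meas lim])
    have bd: "AE x in M. norm (?q n x) \<le> w x" for n
      using lip[of "X n"] X(1)[of n] by (intro AE_I2) (auto simp: divide_simps)
    have 1: "(\<lambda>n. LINT x|M. ?q n x) \<longlonglongrightarrow> (LINT x|M. f' t0 x)"
      by (rule integral_dominated_convergence[OF meas' meas w AE_I2[OF lim] bd])
    have 2: "(LINT x|M. ?q n x) = ((LINT x|M. f (X n) x) - (LINT x|M. f t0 x)) / (X n - t0)" for n
      using int X(1)[of n] t0 by simp
    show ?thesis using 1 unfolding 2 .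
  qed
  show "((\<lambda>t. LINT x|M. f t x) has_real_derivative (LINT x|M. f' t0 x)) (at t0)"
    unfolding has_field_derivative_iff tendsto_at_iff_sequentially o_def
  proof safe
    fix X assume X: "\<forall>i. X i \<in> UNIV - {t0}" "X \<longlonglongrightarrow> t0"
    have "\<forall>\<^sub>F n in sequentially. a < X n \<and> X n < b"
      using order_tendstoD[OF X(2)] t0 by (auto intro: eventually_conj)
    then obtain N where N: "\<And>n. n \<ge> N \<Longrightarrow> a < X n \<and> X n < b"
      by (auto simp: eventually_sequentially)
    have "(\<lambda>n. X (n + N)) \<longlonglongrightarrow> t0" using X(2) by (rule LIMSEQ_ignore_initial_segment)
    from main[OF _ this] N X(1)
    have "(\<lambda>n. ((LINT x|M. f (X (n + N)) x) - (LINT x|M. f t0 x)) / (X (n + N) - t0))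
        \<longlonglongrightarrow> (LINT x|M. f' t0 x)" by auto
    then show "(\<lambda>n. ((LINT x|M. f (X n) x) - (LINT x|M. f t0 x)) / (X n - t0))
        \<longlonglongrightarrow> (LINT x|M. f' t0 x)"
      by (rule LIMSEQ_offset)
  qed
qed

lemma lebesgue_on_extend:
  fixes f :: "'a::euclidean_space \<Rightarrow> 'b::euclidean_space"
  assumes "S \<in> sets lebesgue" "\<And>x. x \<notin> S \<Longrightarrow> f x = 0"
  shows "(LINT x|lebesgue_on S. f x) = (LINT x|lebesgue. f x)"
    and "integrable (lebesgue_on S) f \<longleftrightarrow> integrable lebesgue f"
proof -
  have "(\<lambda>x. indicator S x *\<^sub>R f x) = f" using assms(2) by (auto simp: indicator_def)
  then show "(LINT x|lebesgue_on S. f x) = (LINT x|lebesgue. f x)"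
    "integrable (lebesgue_on S) f \<longleftrightarrow> integrable lebesgue f"
    using assms(1) by (simp_all add: integral_restrict_space integrable_restrict_space)
qed

lemma lebesgue_on_shrink:
  fixes f :: "'a::euclidean_space \<Rightarrow> 'b::euclidean_space"
  assumes "S \<in> sets lebesgue" "T \<in> sets lebesgue" "T \<subseteq> S" "\<And>x. x \<in> S \<Longrightarrow> x \<notin> T \<Longrightarrow> f x = 0"
  shows "(LINT x|lebesgue_on S. f x) = (LINT x|lebesgue_on T. f x)"
    and "integrable (lebesgue_on S) f \<longleftrightarrow> integrable (lebesgue_on T) f"
proof -
  have "(\<lambda>x. indicator S x *\<^sub>R f x) = (\<lambda>x. indicator T x *\<^sub>R f x)"
    using assms by (auto simp: indicator_def fun_eq_iff)
  then show "(LINT x|lebesgue_on S. f x) = (LINT x|lebesgue_on T. f x)"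
    "integrable (lebesgue_on S) f \<longleftrightarrow> integrable (lebesgue_on T) f"
    using assms(1,2) by (simp_all add: integral_restrict_space integrable_restrict_space)
qed

lemma AE_lebesgue_on_subset:
  assumes "S \<in> sets lebesgue" "T \<in> sets lebesgue" "T \<subseteq> S" "AE x in lebesgue_on S. P x"
  shows "AE x in lebesgue_on T. P x"
  using assms by (auto simp: AE_restrict_space_iff)

lemma integrable_lebesgue_on_subset:
  fixes f :: "'a::euclidean_space \<Rightarrow> 'b::euclidean_space"
  assumes "integrable (lebesgue_on S) f" "S \<in> sets lebesgue" "T \<in> sets lebesgue" "T \<subseteq> S"
  shows "integrable (lebesgue_on T) f"
proof -
  have "integrable lebesgue (\<lambda>x. indicator S x *\<^sub>R f x)"
    using assms by (simp add: integrable_restrict_space)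
  with assms(3) have "integrable lebesgue (\<lambda>x. indicator T x *\<^sub>R (indicator S x *\<^sub>R f x))"
    by (rule integrable_mult_indicator)
  moreover have "(\<lambda>x. indicator T x *\<^sub>R (indicator S x *\<^sub>R f x)) = (\<lambda>x. indicator T x *\<^sub>R f x)"
    using assms(4) by (auto simp: indicator_def fun_eq_iff)
  ultimately show ?thesis using assms by (simp add: integrable_restrict_space)
qed

lemma borel_measurable_lebesgue_onI:
  "f \<in> borel_measurable borel \<Longrightarrow> f \<in> borel_measurable (lebesgue_on S)"
  by (intro measurable_restrict_space1 measurable_completion) simp

lemma integrable_compact_support:
  fixes f :: "'a::euclidean_space \<Rightarrow> 'b::euclidean_space"
  assumes "continuous_on UNIV f" "compact K" "\<And>x. x \<notin> K \<Longrightarrow> f x = 0"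
  shows "integrable lborel f"
proof -
  have "(\<lambda>x. indicator K x *\<^sub>R f x) = f" using assms(3) by (auto simp: indicator_def)
  then show ?thesis
    using borel_integrable_compact[OF assms(2) continuous_on_subset[OF assms(1)]] by simp
qed

lemma compact_support_bounded:
  fixes f :: "'a::euclidean_space \<Rightarrow> 'b::euclidean_space"
  assumes "continuous_on UNIV f" "compact K" "\<And>x. x \<notin> K \<Longrightarrow> f x = 0"
  obtains C where "C > 0" "\<And>x. norm (f x) \<le> C"
proof -
  have "bounded (f ` K)"
    using assms by (intro compact_imp_bounded compact_continuous_image continuous_on_subset[OF assms(1)]) auto
  then obtain C where "C > 0" "\<And>y. y \<in> f ` K \<Longrightarrow> norm y \<le> C" unfolding bounded_pos by blast
  then show ?thesis using that[of C] assms(3) by (metis imageI less_imp_le norm_zero)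
qed

text \<open>The integral of $\phi(x + t e_i)$ over the whole space does not depend on $t$;
  differentiating in $t$ gives the divergence theorem without boundary term.\<close>

lemma integral_partial_zero:
  assumes "\<phi> \<in> test_functions Om" and i: "i \<in> Basis"
  shows "(LINT x|lborel. grad \<phi> x \<bullet> i) = 0"
proof -
  obtain K where K: "compact K" "smooth \<phi>" "\<And>x. x \<notin> K \<Longrightarrow> \<phi> x = 0" "\<And>x. x \<notin> K \<Longrightarrow> grad \<phi> x = 0"
    using assms(1) by (rule test_functionsE) blast
  obtain C where C: "C > 0" "\<And>x. norm (grad \<phi> x) \<le> C"
    using compact_support_bounded[OF smooth_continuous_grad[OF K(2)] K(1,4)] by blast
  obtain R where R: "\<And>x. x \<in> K \<Longrightarrow> norm x \<le> R"
    using compact_imp_bounded[OF K(1)] unfolding bounded_iff by blast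
  define f where "f = (\<lambda>t x. \<phi> (x + t *\<^sub>R i))"
  have const: "(LINT x|lborel. f t x) = (LINT x|lborel. \<phi> x)" for t
  proof -
    have "(LINT x|lborel. \<phi> x) = (LINT x|distr lborel borel ((+) (t *\<^sub>R i)). \<phi> x)"
      by (simp add: lborel_distr_plus)
    also have "\<dots> = (LINT x|lborel. \<phi> (t *\<^sub>R i + x))"
      by (intro integral_distr) (auto intro!: borel_measurable_continuous_onI smooth_continuous_on K)
    finally show ?thesis by (simp add: f_def add.commute)
  qed
  have "((\<lambda>t. LINT x|lborel. f t x) has_real_derivative (LINT x|lborel. grad \<phi> (x + 0 *\<^sub>R i) \<bullet> i)) (at 0)"
  proof (rule DERIV_under_integral[of "-1" 0 1])
    fix t :: real assume t: "-1 < t" "t < 1"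
    have cont: "continuous_on UNIV (f t)"
      unfolding f_def
      by (intro continuous_on_compose2[OF smooth_continuous_on[OF K(2), of UNIV]] continuous_intros) auto
    show "integrable lborel (f t)"
    proof (rule integrable_compact_support[OF cont])
      show "compact ((\<lambda>x. x - t *\<^sub>R i) ` K)"
        using K(1) by (intro compact_continuous_image continuous_intros)
      show "f t x = 0" if "x \<notin> (\<lambda>x. x - t *\<^sub>R i) ` K" for x
        using that K(3)[of "x + t *\<^sub>R i"] unfolding f_def
        by (metis add_diff_cancel_right' image_eqI)
    qed
    fix x :: 'a
    have "((\<lambda>t. x + t *\<^sub>R i) has_derivative (\<lambda>h. h *\<^sub>R i)) (at t)"
      by (auto intro!: derivative_eq_intros)
    from diff_chain_at[OF this smooth_GDERIV[OF K(2), unfolded gderiv_def]]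
    show "((\<lambda>t. f t x) has_real_derivative grad \<phi> (x + t *\<^sub>R i) \<bullet> i) (at t)"
      unfolding f_def has_field_derivative_def o_def
      by (rule has_derivative_eq_rhs) (auto simp: inner_commute mult.commute)
    show "\<bar>grad \<phi> (x + t *\<^sub>R i) \<bullet> i\<bar> \<le> C * indicator (cball 0 (R + 1)) x"
    proof (cases "x + t *\<^sub>R i \<in> K")
      case True
      have "norm x \<le> norm (x + t *\<^sub>R i) + norm (t *\<^sub>R i)"
        by (metis add_diff_cancel_right' norm_triangle_ineq4)
      also have "\<dots> \<le> R + 1" using R[OF True] t i by simp
      finally show ?thesis
        using C Basis_le_norm[OF i, of "grad \<phi> (x + t *\<^sub>R i)"]
        by (auto simp: indicator_def intro: order_trans)
    next
      case False
      then show ?thesis using C(1) K(4) by (auto simp: indicator_def)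
    qed
  next
    show "integrable lborel (\<lambda>x::'a. C * indicator (cball 0 (R + 1)) x)"
      by (intro integrable_mult_right integrable_real_indicator) (use emeasure_lborel_cball_finite in auto)
  qed auto
  moreover have "((\<lambda>t. LINT x|lborel. f t x) has_real_derivative 0) (at 0)"
    unfolding const by simp
  ultimately show ?thesis using DERIV_unique[of _ _ 0] by force
qed

lemma L1_loc_mult_integrable:
  fixes u :: "'a::euclidean_space \<Rightarrow> 'b::euclidean_space" and f :: "'a \<Rightarrow> real"
  assumes u: "u \<in> L1_loc Om" and Om: "open Om"
    and f: "continuous_on UNIV f" and K: "compact K" "K \<subseteq> Om" "\<And>x. x \<notin> K \<Longrightarrow> f x = 0"
  shows "integrable (lebesgue_on Om) (\<lambda>x. f x *\<^sub>R u x)"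
proof -
  obtain C where C: "C > 0" "\<And>x. norm (f x) \<le> C" using compact_support_bounded[OF f K(1,3)] by blast
  have KL: "K \<in> sets lebesgue" using K(1) by (simp add: lmeasurable_compact fmeasurableD)
  have "integrable (lebesgue_on K) u" using u K by (auto simp: L1_loc_def)
  then have I: "integrable (lebesgue_on K) (\<lambda>x. C * norm (u x))" by auto
  have "integrable (lebesgue_on K) (\<lambda>x. f x *\<^sub>R u x)"
  proof (rule Bochner_Integration.integrable_bound[OF I])
    show "(\<lambda>x. f x *\<^sub>R u x) \<in> borel_measurable (lebesgue_on K)"
      by (rule borel_measurable_scaleR[OF borel_measurable_lebesgue_onI borel_measurable_integrable])
        (use f \<open>integrable (lebesgue_on K) u\<close> in \<open>auto intro: borel_measurable_continuous_onI\<close>)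
    show "AE x in lebesgue_on K. norm (f x *\<^sub>R u x) \<le> norm (C * norm (u x))"
      using C by (intro AE_I2) (auto intro!: mult_right_mono simp: abs_mult)
  qed
  then show ?thesis
    using K KL Om by (subst lebesgue_on_shrink(2)[of Om K]) auto
qed

section \<open>The fundamental lemma of the calculus of variations\<close>

text \<open>Since $e^{-1/(n t)}$ tends to 1 for every positive \<open>t\<close>, the bump of a box can be sharpened to its
  indicator without leaving the smooth functions.\<close>

lemma box_test_function:
  fixes a b :: "'a::euclidean_space"
  assumes "cbox a b \<subseteq> Om"
  obtains \<phi> :: "nat \<Rightarrow> 'a \<Rightarrow> real" where "\<And>n. \<phi> n \<in> test_functions Om" "\<And>n x. \<bar>\<phi> n x\<bar> \<le> 1"
    "\<And>x. (\<lambda>n. \<phi> n x) \<longlonglongrightarrow> indicator (box a b) x" "\<And>n x. x \<notin> box a b \<Longrightarrow> \<phi> n x = 0"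
proof
  define \<phi> where "\<phi> = (\<lambda>n (x::'a). \<Prod>i\<in>Basis. flat 0 (real (Suc n) * ((x - a) \<bullet> i)) * flat 0 (real (Suc n) * ((b - x) \<bullet> i)))"
  have flat_le: "flat 0 t \<le> 1" for t by (simp add: flat_def)
  have sm: "smooth (\<lambda>x::'a. c * ((x - a) \<bullet> i))" "smooth (\<lambda>x::'a. c * ((b - x) \<bullet> i))" for c i
    unfolding inner_diff_left by (intro smooth_cmult smooth_diff smooth_inner smooth_const)+
  show z: "\<phi> n x = 0" if "x \<notin> box a b" for n x
  proof -
    have "\<not> (\<forall>i\<in>Basis. a \<bullet> i < x \<bullet> i \<and> x \<bullet> i < b \<bullet> i)"
      using that unfolding mem_box(1) .
    then obtain i where "i \<in> Basis" "\<not> (a \<bullet> i < x \<bullet> i \<and> x \<bullet> i < b \<bullet> i)" by blast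
    then have i: "i \<in> Basis" "x \<bullet> i \<le> a \<bullet> i \<or> b \<bullet> i \<le> x \<bullet> i" by auto
    then have "flat 0 (real (Suc n) * ((x - a) \<bullet> i)) * flat 0 (real (Suc n) * ((b - x) \<bullet> i)) = 0"
      by (auto simp: flat_nonpos inner_diff_left mult_le_0_iff)
    then show ?thesis unfolding \<phi>_def using i(1) by (intro prod_zero) auto
  qed
  have "smooth (\<phi> n)" for n
    unfolding \<phi>_def by (intro smooth_prod smooth_mult smooth_flat_compose sm)
  then show "\<phi> n \<in> test_functions Om" for n
    by (rule test_functionsI[of _ "cbox a b"]) (use assms(1) z box_subset_cbox[of a b] in auto)
  show "\<bar>\<phi> n x\<bar> \<le> 1" for n x
    unfolding \<phi>_def abs_prod by (intro prod_le_1) (auto simp: abs_mult flat_nonneg flat_le mult_le_one)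
  show "(\<lambda>n. \<phi> n x) \<longlonglongrightarrow> indicator (box a b) x" for x
  proof (cases "x \<in> box a b")
    case False
    then show ?thesis using z by simp
  next
    case True
    have lim: "(\<lambda>n. flat 0 (real (Suc n) * t)) \<longlonglongrightarrow> 1" if "t > 0" for t
    proof -
      have "(\<lambda>n. exp (- ((1 / t) / real (Suc n)))) \<longlonglongrightarrow> exp (- 0)"
        by (intro tendsto_intros LIMSEQ_Suc[OF lim_const_over_n])
      moreover have "exp (- ((1 / t) / real (Suc n))) = flat 0 (real (Suc n) * t)" for n
        using that by (simp add: flat_def mult.commute)
      ultimately show ?thesis by simp
    qed
    have "(\<lambda>n. \<phi> n x) \<longlonglongrightarrow> (\<Prod>i\<in>(Basis::'a set). 1 * 1)"
      unfolding \<phi>_def using True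
      by (intro tendsto_intros lim) (auto simp: mem_box inner_diff_left)
    then show ?thesis using True by simp
  qed
qed

text \<open>Testing with functions that approximate indicators shows that the integral of \<open>g\<close> over every box
  vanishes; by Lebesgue's differentiation theorem for cubes \<open>g\<close> vanishes almost everywhere.\<close>

lemma fundamental_lemma:
  fixes g :: "'a::euclidean_space \<Rightarrow> real"
  assumes Om: "open Om" and g: "g \<in> L1_loc Om"
    and z: "\<And>\<phi>. \<phi> \<in> test_functions Om \<Longrightarrow> (LINT x|lebesgue_on Om. g x * \<phi> x) = 0"
  shows "AE x in lebesgue_on Om. g x = 0"
proof -
  have box0: "(LINT x|lebesgue_on (cbox a b). g x) = 0" if ab: "cbox a b \<subseteq> Om" for a b
  proof -
    obtain \<phi> where \<phi>: "\<And>n. \<phi> n \<in> test_functions Om" "\<And>n x. \<bar>\<phi> n x\<bar> \<le> 1"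
      "\<And>x. (\<lambda>n. \<phi> n x) \<longlonglongrightarrow> indicator (box a b) x" "\<And>n x. x \<notin> box a b \<Longrightarrow> \<phi> n x = 0"
      using box_test_function[OF ab] by blast
    have gi: "integrable (lebesgue_on (cbox a b)) g" using g ab by (auto simp: L1_loc_def)
    have "(\<lambda>n. LINT x|lebesgue_on (cbox a b). g x * \<phi> n x) \<longlonglongrightarrow>
        (LINT x|lebesgue_on (cbox a b). g x * indicator (box a b) x)"
    proof (rule integral_dominated_convergence)
      show "integrable (lebesgue_on (cbox a b)) (\<lambda>x. norm (g x))" using gi by simp
      show "(\<lambda>x. g x * indicator (box a b) x) \<in> borel_measurable (lebesgue_on (cbox a b))"
        by (rule borel_measurable_times[OF borel_measurable_integrable[OF gi] borel_measurable_lebesgue_onI]) auto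
      show "(\<lambda>x. g x * \<phi> n x) \<in> borel_measurable (lebesgue_on (cbox a b))" for n
        by (rule borel_measurable_times[OF borel_measurable_integrable[OF gi]
              borel_measurable_lebesgue_onI[OF borel_measurable_continuous_onI]])
          (rule smooth_continuous_on[OF test_smooth[OF \<phi>(1)]])
      show "AE x in lebesgue_on (cbox a b). (\<lambda>n. g x * \<phi> n x) \<longlonglongrightarrow> g x * indicator (box a b) x"
        by (intro AE_I2 tendsto_intros \<phi>(3))
      show "AE x in lebesgue_on (cbox a b). norm (g x * \<phi> n x) \<le> norm (g x)" for n
        using \<phi>(2) by (intro AE_I2) (auto simp: abs_mult mult_left_le)
    qed
    moreover have "(LINT x|lebesgue_on (cbox a b). g x * \<phi> n x) = 0" for n
    proof -
      have "(LINT x|lebesgue_on Om. g x * \<phi> n x) = (LINT x|lebesgue_on (cbox a b). g x * \<phi> n x)"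
        using Om ab \<phi>(4) box_subset_cbox[of a b] by (intro lebesgue_on_shrink(1)) auto
      then show ?thesis using z[OF \<phi>(1)] by simp
    qed
    ultimately have 0: "(LINT x|lebesgue_on (cbox a b). g x * indicator (box a b) x) = 0"
      by (simp add: LIMSEQ_const_iff)
    have "negligible (cbox a b - box a b)" by (simp add: negligible_frontier_interval)
    then have "AE x in lebesgue. x \<notin> cbox a b - box a b"
      by (intro AE_not_in) (simp add: negligible_iff_null_sets)
    then have "AE x in lebesgue_on (cbox a b). g x = g x * indicator (box a b) x"
      by (simp add: AE_restrict_space_iff) (auto elim!: eventually_mono simp: indicator_def)
    then have "(LINT x|lebesgue_on (cbox a b). g x) = (LINT x|lebesgue_on (cbox a b). g x * indicator (box a b) x)"
      by (intro integral_cong_AE borel_measurable_integrable[OF gi]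
          borel_measurable_times[OF borel_measurable_integrable[OF gi] borel_measurable_lebesgue_onI]) auto
    then show ?thesis using 0 by simp
  qed
  have AEbox: "AE x in lebesgue. x \<in> cbox a b \<longrightarrow> g x = 0" if ab: "cbox a b \<subseteq> Om" for a b
  proof -
    define h where "h = (\<lambda>x. if x \<in> cbox a b then g x else 0)"
    have gi: "integrable (lebesgue_on (cbox a b)) g" using g ab by (auto simp: L1_loc_def)
    then have "integrable (lebesgue_on (cbox a b)) h"
      by (rule Bochner_Integration.integrable_cong[THEN iffD1, rotated 2]) (auto simp: h_def)
    then have hi: "integrable lebesgue h"
      by (subst (asm) lebesgue_on_extend(2)) (auto simp: h_def)
    have "h integrable_on cbox c d" for c d
    proof -
      have "integrable (lebesgue_on (cbox c d)) h"
        using integrable_lebesgue_on_subset[of UNIV h "cbox c d"] hi by (simp add: lebesgue_on_UNIV_eq)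
      then show ?thesis by (rule integrable_on_lebesgue_on) auto
    qed
    from integrable_ccontinuous_explicit[OF this] obtain N where N: "negligible N"
      "\<And>x e. x \<notin> N \<Longrightarrow> 0 < e \<Longrightarrow> \<exists>d>0. \<forall>s. 0 < s \<and> s < d \<longrightarrow>
         norm (integral (cbox x (x + s *\<^sub>R One)) h /\<^sub>R s ^ DIM('a) - h x) < e" by metis
    have "g x = 0" if x: "x \<in> box a b" "x \<notin> N" for x
    proof (rule ccontr)
      assume "g x \<noteq> 0"
      then obtain d where d: "d > 0" "\<And>s. 0 < s \<Longrightarrow> s < d \<Longrightarrow>
         norm (integral (cbox x (x + s *\<^sub>R One)) h /\<^sub>R s ^ DIM('a) - h x) < \<bar>g x\<bar>"
        using N(2)[OF x(2), of "\<bar>g x\<bar>"] by auto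
      have "\<forall>\<^sub>F s in at_right 0. x + s *\<^sub>R One \<in> box a b"
      proof (rule topological_tendstoD)
        have "((\<lambda>s. x + s *\<^sub>R One) \<longlongrightarrow> x + 0 *\<^sub>R One) (at_right 0)" by (intro tendsto_intros)
        then show "((\<lambda>s. x + s *\<^sub>R One) \<longlongrightarrow> x) (at_right 0)" by simp
      qed (use x in auto)
      moreover have "\<forall>\<^sub>F s in at_right 0. 0 < s \<and> s < d"
        using d(1) unfolding eventually_at_right_field by (auto intro!: exI[of _ d])
      ultimately have "\<forall>\<^sub>F s in at_right 0. 0 < s \<and> s < d \<and> x + s *\<^sub>R One \<in> box a b"
        by eventually_elim auto
      then obtain s where s: "0 < s" "s < d" "x + s *\<^sub>R One \<in> box a b"
        using eventually_happens trivial_limit_at_right_real by blast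
      have sub: "cbox x (x + s *\<^sub>R One) \<subseteq> cbox a b"
        using x(1) s(3) by (intro subset_box(1)[THEN iffD2]) (auto simp: mem_box less_imp_le)
      have gi': "integrable (lebesgue_on (cbox x (x + s *\<^sub>R One))) g"
        by (rule integrable_lebesgue_on_subset[OF gi _ _ sub]) auto
      have "integral (cbox x (x + s *\<^sub>R One)) h = integral (cbox x (x + s *\<^sub>R One)) g"
        using sub by (intro integral_cong) (auto simp: h_def)
      also have "\<dots> = 0"
        using lebesgue_integral_eq_integral[OF gi'] box0[of x "x + s *\<^sub>R One"] sub ab by auto
      finally have "norm (h x) < \<bar>g x\<bar>" using d(2)[OF s(1,2)] by simp
      moreover have "h x = g x" using x(1) box_subset_cbox by (auto simp: h_def)
      ultimately show False by simp
    qed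
    have "AE x in lebesgue. x \<notin> N \<union> (cbox a b - box a b)"
      using N(1) negligible_frontier_interval[of a b]
      by (intro AE_not_in) (simp add: negligible_iff_null_sets[symmetric])
    then show ?thesis by (rule eventually_mono) (use \<open>\<And>x. x \<in> box a b \<Longrightarrow> x \<notin> N \<Longrightarrow> g x = 0\<close> in blast)
  qed
  obtain D where D: "countable D" "D \<subseteq> Pow Om" "\<And>X. X \<in> D \<Longrightarrow> \<exists>a b. X = cbox a b" "\<Union>D = Om"
    using open_countable_Union_open_cbox[OF Om] by metis
  have "AE x in lebesgue. x \<in> X \<longrightarrow> g x = 0" if X: "X \<in> D" for X
  proof -
    obtain a b where "X = cbox a b" using D(3)[OF X] by blast
    then show ?thesis using AEbox[of a b] D(2) X by auto
  qed
  then have "AE x in lebesgue. \<forall>X\<in>D. x \<in> X \<longrightarrow> g x = 0"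
    by (intro AE_ball_countable[OF D(1), THEN iffD2] ballI)
  then have "AE x in lebesgue. x \<in> Om \<longrightarrow> g x = 0"
    by (rule eventually_mono) (use D(4) in blast)
  then show ?thesis using Om by (simp add: AE_restrict_space_iff)
qed

section \<open>Weak gradients\<close>

lemma test_outside:
  assumes "\<phi> \<in> test_functions Om" "x \<notin> Om"
  shows "\<phi> x = 0" "grad \<phi> x = 0"
proof -
  obtain K where "K \<subseteq> Om" "\<And>x. x \<notin> K \<Longrightarrow> \<phi> x = 0" "\<And>x. x \<notin> K \<Longrightarrow> grad \<phi> x = 0"
    using assms(1) by (rule test_functionsE) blast
  then show "\<phi> x = 0" "grad \<phi> x = 0" using assms(2) by blast+
qed

lemma L1_loc_add: "f \<in> L1_loc Om \<Longrightarrow> g \<in> L1_loc Om \<Longrightarrow> (\<lambda>x. f x + g x) \<in> L1_loc Om"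
  by (auto simp: L1_loc_def)

lemma L1_loc_scaleR: "f \<in> L1_loc Om \<Longrightarrow> (\<lambda>x. c *\<^sub>R f x) \<in> L1_loc Om"
  by (auto simp: L1_loc_def)

lemma L1_loc_inner: "f \<in> L1_loc Om \<Longrightarrow> (\<lambda>x. f x \<bullet> i) \<in> L1_loc Om"
  by (auto simp: L1_loc_def)

lemma L1_loc_mono: "f \<in> L1_loc Om \<Longrightarrow> Om' \<subseteq> Om \<Longrightarrow> f \<in> L1_loc Om'"
  by (auto simp: L1_loc_def)

lemma L1_loc_test_integrable:
  fixes u :: "'a::euclidean_space \<Rightarrow> real"
  assumes "u \<in> L1_loc Om" "open Om" "\<phi> \<in> test_functions Om"
  shows "integrable (lebesgue_on Om) (\<lambda>x. u x * \<phi> x)"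
proof -
  obtain K where K: "compact K" "K \<subseteq> Om" "smooth \<phi>" "\<And>x. x \<notin> K \<Longrightarrow> \<phi> x = 0"
    using assms(3) by (rule test_functionsE) blast
  from L1_loc_mult_integrable[OF assms(1,2) smooth_continuous_on[OF K(3)] K(1,2,4)]
  show ?thesis by (simp add: mult.commute)
qed

lemma continuous_L1_loc: "continuous_on UNIV f \<Longrightarrow> f \<in> L1_loc Om"
  unfolding L1_loc_def
proof safe
  fix K :: "'a set" assume f: "continuous_on UNIV f" and K: "compact K"
  have "integrable lborel (\<lambda>x. indicator K x *\<^sub>R f x)"
    by (rule borel_integrable_compact[OF K continuous_on_subset[OF f]]) simp
  then have "integrable lebesgue (\<lambda>x. indicator K x *\<^sub>R f x)"
    using borel_measurable_integrable integrable_completion by blast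
  then show "integrable (lebesgue_on K) f"
    using K by (simp add: integrable_restrict_space lmeasurable_compact fmeasurableD)
qed

lemma weak_gradient_add:
  assumes "weak_gradient Om u g" "weak_gradient Om v h" "open Om"
  shows "weak_gradient Om (\<lambda>x. u x + v x) (\<lambda>x. g x + h x)"
  unfolding weak_gradient_def
proof (intro conjI ballI)
  fix \<phi> and i :: 'a assume \<phi>: "\<phi> \<in> test_functions Om" and i: "i \<in> Basis"
  have "integrable (lebesgue_on Om) (\<lambda>x. u x * (grad \<phi> x \<bullet> i))"
    "integrable (lebesgue_on Om) (\<lambda>x. v x * (grad \<phi> x \<bullet> i))"
    "integrable (lebesgue_on Om) (\<lambda>x. (g x \<bullet> i) * \<phi> x)"
    "integrable (lebesgue_on Om) (\<lambda>x. (h x \<bullet> i) * \<phi> x)"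
    using assms \<phi> i unfolding weak_gradient_def
    by (auto intro!: L1_loc_test_integrable L1_loc_inner test_grad)
  then show "(LINT x|lebesgue_on Om. (u x + v x) * (grad \<phi> x \<bullet> i)) =
      - (LINT x|lebesgue_on Om. ((g x + h x) \<bullet> i) * \<phi> x)"
    using assms \<phi> i unfolding weak_gradient_def by (simp add: distrib_right inner_add_left)
qed (use assms in \<open>auto simp: weak_gradient_def L1_loc_add\<close>)

lemma weak_gradient_cmult:
  assumes "weak_gradient Om u g"
  shows "weak_gradient Om (\<lambda>x. c * u x) (\<lambda>x. c *\<^sub>R g x)"
  using assms L1_loc_scaleR[of u Om c] L1_loc_scaleR[of g Om c] unfolding weak_gradient_def
  by (simp add: mult.assoc)

lemma weak_gradient_diff:
  assumes "weak_gradient Om u g" "weak_gradient Om v h" "open Om"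
  shows "weak_gradient Om (\<lambda>x. u x - v x) (\<lambda>x. g x - h x)"
  using weak_gradient_add[OF assms(1) weak_gradient_cmult[OF assms(2), of "-1"] assms(3)] by simp

lemma weak_gradient_mono:
  assumes "weak_gradient Om u g" "Om' \<subseteq> Om" "open Om" "open Om'"
  shows "weak_gradient Om' u g"
  unfolding weak_gradient_def
proof (intro conjI ballI)
  fix \<phi> and i :: 'a assume \<phi>: "\<phi> \<in> test_functions Om'" and i: "i \<in> Basis"
  have "(LINT x|lebesgue_on Om. u x * (grad \<phi> x \<bullet> i)) = (LINT x|lebesgue_on Om'. u x * (grad \<phi> x \<bullet> i))"
    "(LINT x|lebesgue_on Om. (g x \<bullet> i) * \<phi> x) = (LINT x|lebesgue_on Om'. (g x \<bullet> i) * \<phi> x)"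
    using assms test_outside[OF \<phi>] by (auto intro!: lebesgue_on_shrink(1))
  then show "(LINT x|lebesgue_on Om'. u x * (grad \<phi> x \<bullet> i)) =
      - (LINT x|lebesgue_on Om'. (g x \<bullet> i) * \<phi> x)"
    using assms(1) test_mono[OF assms(2) \<phi>] i unfolding weak_gradient_def by simp
qed (use assms in \<open>auto simp: weak_gradient_def intro: L1_loc_mono\<close>)

lemma weak_gradient_unique:
  assumes g: "weak_gradient Om u g" and h: "weak_gradient Om u h" and Om: "open Om"
  shows "AE x in lebesgue_on Om. g x = h x"
proof -
  have "AE x in lebesgue_on Om. (g x - h x) \<bullet> i = 0" if i: "i \<in> Basis" for i
  proof (rule fundamental_lemma[OF Om])
    have "(\<lambda>x. g x - h x) \<in> L1_loc Om"
      using g h by (auto simp: weak_gradient_def L1_loc_def)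
    then show "(\<lambda>x. (g x - h x) \<bullet> i) \<in> L1_loc Om" by (rule L1_loc_inner)
    fix \<phi> assume \<phi>: "\<phi> \<in> test_functions Om"
    have "integrable (lebesgue_on Om) (\<lambda>x. (g x \<bullet> i) * \<phi> x)"
      "integrable (lebesgue_on Om) (\<lambda>x. (h x \<bullet> i) * \<phi> x)"
      using g h \<phi> Om unfolding weak_gradient_def
      by (auto intro!: L1_loc_test_integrable L1_loc_inner)
    then show "(LINT x|lebesgue_on Om. (g x - h x) \<bullet> i * \<phi> x) = 0"
      using g h \<phi> i unfolding weak_gradient_def by (simp add: inner_diff_left left_diff_distrib)
  qed
  then have "AE x in lebesgue_on Om. \<forall>i\<in>Basis. (g x - h x) \<bullet> i = 0"
    by (intro AE_finite_allI) auto
  then show ?thesis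
  proof (rule eventually_mono)
    fix x assume "\<forall>i\<in>Basis. (g x - h x) \<bullet> i = 0"
    then have "g x - h x = 0" using euclidean_all_zero_iff by blast
    then show "g x = h x" by simp
  qed
qed

lemma weak_gradient_wgrad: "weak_gradient Om u g \<Longrightarrow> weak_gradient Om u (wgrad Om u)"
  unfolding wgrad_def by (rule someI[of "weak_gradient Om u"])

text \<open>This makes the arbitrary choice in \<open>wgrad\<close> harmless: integrals of \<open>wgrad\<close> can be computed from any
  weak gradient.\<close>

lemma wgrad_AE:
  assumes "weak_gradient Om u g" "open Om"
  shows "AE x in lebesgue_on Om. wgrad Om u x = g x"
  using weak_gradient_unique[OF weak_gradient_wgrad[OF assms(1)] assms] .

lemma weak_gradient_test:
  assumes Om: "open Om" and \<phi>: "\<phi> \<in> test_functions Om"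
  shows "weak_gradient Om \<phi> (grad \<phi>)"
  unfolding weak_gradient_def
proof (intro conjI ballI)
  have sm: "smooth \<phi>" using \<phi> by (rule test_smooth)
  show "\<phi> \<in> L1_loc Om" "grad \<phi> \<in> L1_loc Om"
    using sm by (auto intro!: continuous_L1_loc smooth_continuous_on smooth_continuous_grad)
  fix \<psi> and i :: 'a assume \<psi>: "\<psi> \<in> test_functions Om" and i: "i \<in> Basis"
  have sm': "smooth \<psi>" using \<psi> by (rule test_smooth)
  obtain K where K: "compact K" "K \<subseteq> Om" "\<And>x. x \<notin> K \<Longrightarrow> \<psi> x = 0" "\<And>x. x \<notin> K \<Longrightarrow> grad \<psi> x = 0"
    using \<psi> by (rule test_functionsE) blast
  let ?a = "\<lambda>x. \<phi> x * (grad \<psi> x \<bullet> i)" and ?b = "\<lambda>x. (grad \<phi> x \<bullet> i) * \<psi> x"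
  have ca: "continuous_on UNIV ?a" "continuous_on UNIV ?b"
    by (intro continuous_on_mult smooth_continuous_on sm sm' smooth_grad i)+
  have ia: "integrable lborel ?a" "integrable lborel ?b"
    using ca K by (auto intro!: integrable_compact_support[OF _ K(1)])
  have "0 = (LINT x|lborel. grad (\<lambda>x. \<phi> x * \<psi> x) x \<bullet> i)"
    using integral_partial_zero[OF test_smult[OF sm \<psi>] i] by simp
  also have "\<dots> = (LINT x|lborel. ?a x + ?b x)"
    by (simp add: grad_mult[OF sm sm'] inner_add_left mult.commute)
  also have "\<dots> = (LINT x|lborel. ?a x) + (LINT x|lborel. ?b x)"
    using ia by simp
  finally have 1: "(LINT x|lborel. ?a x) = - (LINT x|lborel. ?b x)" by simp
  have "(LINT x|lebesgue_on Om. ?a x) = (LINT x|lebesgue. ?a x)"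
    "(LINT x|lebesgue_on Om. ?b x) = (LINT x|lebesgue. ?b x)"
    using test_outside[OF \<psi>] Om by (auto intro!: lebesgue_on_extend(1))
  moreover have "(LINT x|lebesgue. ?a x) = (LINT x|lborel. ?a x)"
    "(LINT x|lebesgue. ?b x) = (LINT x|lborel. ?b x)"
    using ca by (auto intro!: integral_completion borel_measurable_continuous_onI)
  ultimately show "(LINT x|lebesgue_on Om. ?a x) = - (LINT x|lebesgue_on Om. ?b x)" using 1 by simp
qed

lemma weak_gradient_cong_AE:
  assumes "AE x in lebesgue_on Om. u x = v x" "open Om" "weak_gradient Om u g"
    "v \<in> borel_measurable (lebesgue_on Om)"
  shows "weak_gradient Om v g"
  unfolding weak_gradient_def
proof (intro conjI ballI)
  have m: "v \<in> borel_measurable (lebesgue_on K)" if "compact K" "K \<subseteq> Om" for K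
    using measurable_restrict_mono[OF assms(4)] that by blast
  have sets: "K \<in> sets lebesgue" if "compact K" for K using that by (simp add: lmeasurable_compact fmeasurableD)
  show vL: "v \<in> L1_loc Om"
    unfolding L1_loc_def
  proof safe
    fix K assume K: "compact K" "K \<subseteq> Om"
    have "AE x in lebesgue_on K. u x = v x"
      using AE_lebesgue_on_subset[OF _ sets[OF K(1)] K(2) assms(1)] assms(2) by auto
    moreover have "integrable (lebesgue_on K) u"
      using assms(3) K by (auto simp: weak_gradient_def L1_loc_def)
    ultimately show "integrable (lebesgue_on K) v"
      by (intro integrable_cong_AE_imp[OF _ m[OF K]]) auto
  qed
  fix \<phi> and i :: 'a assume \<phi>: "\<phi> \<in> test_functions Om" and i: "i \<in> Basis"
  have "(LINT x|lebesgue_on Om. v x * (grad \<phi> x \<bullet> i)) = (LINT x|lebesgue_on Om. u x * (grad \<phi> x \<bullet> i))"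
  proof (rule integral_cong_AE)
    show "(\<lambda>x. v x * (grad \<phi> x \<bullet> i)) \<in> borel_measurable (lebesgue_on Om)"
      "(\<lambda>x. u x * (grad \<phi> x \<bullet> i)) \<in> borel_measurable (lebesgue_on Om)"
      using assms(3)
      by (auto intro!: borel_measurable_integrable[OF L1_loc_test_integrable] vL test_grad \<phi> i assms(2)
          simp: weak_gradient_def)
  qed (use assms(1) in \<open>auto elim!: eventually_mono\<close>)
  then show "(LINT x|lebesgue_on Om. v x * (grad \<phi> x \<bullet> i)) = - (LINT x|lebesgue_on Om. (g x \<bullet> i) * \<phi> x)"
    using assms(3) \<phi> i by (simp add: weak_gradient_def)
qed (use assms in \<open>auto simp: weak_gradient_def\<close>)

section \<open>Square integrable functions\<close>

text \<open>All $L^2$ estimates are stated for squared norms, with the inequality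
  $(a + b)^2 \le (1 + s) a^2 + (1 + 1/s) b^2$ in place of the triangle inequality.\<close>

definition sqint :: "'a measure \<Rightarrow> ('a \<Rightarrow> 'b::euclidean_space) \<Rightarrow> bool" where
  "sqint M f \<longleftrightarrow> f \<in> borel_measurable M \<and> integrable M (\<lambda>x. (norm (f x))\<^sup>2)"

definition sqn :: "'a measure \<Rightarrow> ('a \<Rightarrow> 'b::euclidean_space) \<Rightarrow> real" where
  "sqn M f = (LINT x|M. (norm (f x))\<^sup>2)"

lemma L2_sqint: "f \<in> L2 Om \<longleftrightarrow> sqint (lebesgue_on Om) f"
  by (simp add: L2_def sqint_def)

lemma sqintD: "sqint M f \<Longrightarrow> f \<in> borel_measurable M" "sqint M f \<Longrightarrow> integrable M (\<lambda>x. (norm (f x))\<^sup>2)"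
  by (auto simp: sqint_def)

lemma sqn_nonneg: "sqn M f \<ge> 0"
  unfolding sqn_def by (rule integral_nonneg_AE) simp

lemma norm_add_sq_le: "(norm (a + b))\<^sup>2 \<le> (1 + s) * (norm a)\<^sup>2 + (1 + 1 / s) * (norm (b::'b::real_inner))\<^sup>2" if "s > 0"
proof -
  have "0 \<le> (norm (sqrt s *\<^sub>R a - (1 / sqrt s) *\<^sub>R b))\<^sup>2" by simp
  also have "\<dots> = s * (norm a)\<^sup>2 - 2 * (a \<bullet> b) + (norm b)\<^sup>2 / s"
    using that by (simp add: power2_norm_eq_inner inner_diff_left inner_diff_right inner_commute
        field_simps flip: power2_eq_square)
  finally show ?thesis
    by (simp add: power2_norm_eq_inner inner_add_left inner_add_right inner_commute algebra_simps)
qed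

lemma sqint_bound:
  assumes "g \<in> borel_measurable M" "integrable M w" "\<And>x. x \<in> space M \<Longrightarrow> (norm (g x))\<^sup>2 \<le> w x"
  shows "sqint M g"
  unfolding sqint_def
proof
  show "integrable M (\<lambda>x. (norm (g x))\<^sup>2)"
    by (rule Bochner_Integration.integrable_bound[OF assms(2)])
      (use assms in \<open>auto intro!: AE_I2 order_trans[OF assms(3) abs_ge_self]\<close>)
qed (rule assms)

lemma sqint_add:
  assumes "sqint M f" "sqint M g"
  shows "sqint M (\<lambda>x. f x + g x)"
  by (rule sqint_bound[where w="\<lambda>x. (1 + 1) * (norm (f x))\<^sup>2 + (1 + 1 / 1) * (norm (g x))\<^sup>2"])
    (use assms norm_add_sq_le[of 1] in \<open>auto simp: sqint_def\<close>)

lemma sqint_scaleR: "sqint M f \<Longrightarrow> sqint M (\<lambda>x. c *\<^sub>R f x)"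
  by (auto simp: sqint_def power_mult_distrib)

lemma sqint_cmult: "sqint M f \<Longrightarrow> sqint M (\<lambda>x. c * f x :: real)"
  using sqint_scaleR[of M f c] by simp

lemma sqint_diff: "sqint M f \<Longrightarrow> sqint M g \<Longrightarrow> sqint M (\<lambda>x. f x - g x)"
  using sqint_add[of M f "\<lambda>x. (-1) *\<^sub>R g x"] sqint_scaleR[of M g "-1"] by simp

lemma sqn_scaleR: "sqn M (\<lambda>x. c *\<^sub>R f x) = c\<^sup>2 * sqn M f"
  by (simp add: sqn_def power_mult_distrib)

lemma sqn_cmult: "sqn M (\<lambda>x. c * f x :: real) = c\<^sup>2 * sqn M f"
  using sqn_scaleR[of M c f] by simp

lemma sqn_minus_commute: "sqn M (\<lambda>x. f x - g x) = sqn M (\<lambda>x. g x - f x)"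
  by (simp add: sqn_def norm_minus_commute)

lemma sqn_cong_AE:
  assumes "AE x in M. f x = g x" "f \<in> borel_measurable M" "g \<in> borel_measurable M"
  shows "sqn M f = sqn M g"
  unfolding sqn_def by (rule integral_cong_AE) (use assms in \<open>auto elim!: eventually_mono\<close>)

lemma sqn_add_le:
  assumes "sqint M f" "sqint M g" "s > 0"
  shows "sqn M (\<lambda>x. f x + g x) \<le> (1 + s) * sqn M f + (1 + 1 / s) * sqn M g"
proof -
  have "sqn M (\<lambda>x. f x + g x) \<le> (LINT x|M. (1 + s) * (norm (f x))\<^sup>2 + (1 + 1 / s) * (norm (g x))\<^sup>2)"
    unfolding sqn_def using assms sqint_add[OF assms(1,2)] norm_add_sq_le[OF assms(3)]
    by (intro integral_mono) (auto simp: sqint_def)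
  then show ?thesis using assms by (simp add: sqn_def sqint_def)
qed

lemma sqn_add_le2:
  assumes "sqint M f" "sqint M g"
  shows "sqn M (\<lambda>x. f x + g x) \<le> 2 * sqn M f + 2 * sqn M g"
  using sqn_add_le[OF assms, of 1] by simp

lemma sqn_diff_le2:
  assumes "sqint M f" "sqint M g"
  shows "sqn M (\<lambda>x. f x - g x) \<le> 2 * sqn M f + 2 * sqn M g"
  using sqn_add_le2[OF assms(1) sqint_scaleR[OF assms(2), of "-1"]] sqn_scaleR[of M "-1" g] by simp

lemma sqn_triangle:
  assumes "sqint M f" "sqint M g" "sqint M h"
  shows "sqn M (\<lambda>x. f x - h x) \<le> 2 * sqn M (\<lambda>x. f x - g x) + 2 * sqn M (\<lambda>x. g x - h x)"
  using sqn_add_le2[OF sqint_diff[OF assms(1,2)] sqint_diff[OF assms(2,3)]] by simp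

lemma sqn_parallelogram:
  assumes "sqint M f" "sqint M g"
  shows "sqn M (\<lambda>x. f x - g x) = 2 * sqn M f + 2 * sqn M g - sqn M (\<lambda>x. f x + g x)"
proof -
  have "sqn M (\<lambda>x. f x - g x) = (LINT x|M. 2 * (norm (f x))\<^sup>2 + 2 * (norm (g x))\<^sup>2 - (norm (f x + g x))\<^sup>2)"
    unfolding sqn_def
    by (intro Bochner_Integration.integral_cong refl)
      (simp add: power2_norm_eq_inner inner_add_left inner_add_right inner_diff_left inner_diff_right
        inner_commute)
  then show ?thesis using assms sqint_add[OF assms] by (simp add: sqn_def sqint_def)
qed

lemma sqint_inner_integrable:
  assumes "sqint M f" "sqint M g"
  shows "integrable M (\<lambda>x. f x \<bullet> g x)"
proof -
  have "(\<lambda>x. f x \<bullet> g x) = (\<lambda>x. ((norm (f x + g x))\<^sup>2 - (norm (f x))\<^sup>2 - (norm (g x))\<^sup>2) / 2)"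
    by (simp add: power2_norm_eq_inner inner_add_left inner_add_right inner_commute)
  then show ?thesis using assms sqint_add[OF assms] by (simp add: sqint_def)
qed

lemma sqn_add:
  assumes "sqint M f" "sqint M g"
  shows "sqn M (\<lambda>x. f x + g x) = sqn M f + 2 * (LINT x|M. f x \<bullet> g x) + sqn M g"
proof -
  have "sqn M (\<lambda>x. f x + g x) = (LINT x|M. (norm (f x))\<^sup>2 + 2 * (f x \<bullet> g x) + (norm (g x))\<^sup>2)"
    unfolding sqn_def
    by (intro Bochner_Integration.integral_cong refl)
      (simp add: power2_norm_eq_inner inner_add_left inner_add_right inner_commute)
  then show ?thesis using assms sqint_inner_integrable[OF assms] by (simp add: sqn_def sqint_def)
qed

lemma norm_le_sq: "(s::real) > 0 \<Longrightarrow> norm a \<le> s + (norm a)\<^sup>2 / s"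
proof (cases "norm a \<le> s")
  case False
  assume "s > 0"
  then have "norm a * s \<le> norm a * norm a" using False by (intro mult_left_mono) auto
  then show ?thesis using \<open>s > 0\<close> by (simp add: field_simps power2_eq_square add_increasing)
qed (simp add: add_increasing2)

context finite_measure begin

lemma sqint_integrable:
  assumes "sqint M f" shows "integrable M f"
  by (rule Bochner_Integration.integrable_bound[where f="\<lambda>x. 1 + (norm (f x))\<^sup>2 / 1"])
    (use assms norm_le_sq[of 1] in \<open>auto simp: sqint_def intro!: AE_I2\<close>)

lemma integral_norm_le_sqn:
  assumes "sqint M f" "s > 0"
  shows "(LINT x|M. norm (f x)) \<le> s * measure M (space M) + sqn M f / s"
proof -
  have "(LINT x|M. norm (f x)) \<le> (LINT x|M. s + (norm (f x))\<^sup>2 / s)"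
    using assms sqint_integrable[OF assms(1)] norm_le_sq[OF assms(2)]
    by (intro integral_mono) (auto simp: sqint_def)
  then show ?thesis using assms by (simp add: sqn_def sqint_def mult.commute)
qed

lemma L1_le_of_sqn_le:
  assumes "e > 0"
  obtains d where "d > 0" "\<And>f. sqint M f \<Longrightarrow> sqn M f \<le> d \<Longrightarrow> (LINT x|M. norm (f x)) < e"
proof
  define V where "V = measure M (space M)"
  define s where "s = e / (2 * (V + 1))"
  have V: "V \<ge> 0" by (simp add: V_def)
  then have s: "s > 0" using assms by (simp add: s_def)
  show "s * (e / 4) > 0" using s assms by simp
  fix f :: "'a \<Rightarrow> 'b" assume f: "sqint M f" "sqn M f \<le> s * (e / 4)"
  have "(LINT x|M. norm (f x)) \<le> s * V + sqn M f / s"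
    using integral_norm_le_sqn[OF f(1) s] by (simp add: V_def)
  also have "sqn M f / s \<le> e / 4" using f(2) s by (simp add: field_simps)
  also have "s * V \<le> s * (V + 1)" using s by simp
  also have "s * (V + 1) = e / 2" using V by (simp add: s_def field_simps)
  finally show "(LINT x|M. norm (f x)) < e" using assms by simp
qed

lemma L1_tendsto_of_sqn:
  assumes "\<And>n. sqint M (f n)" "(\<lambda>n. sqn M (f n)) \<longlonglongrightarrow> 0"
  shows "(\<lambda>n. LINT x|M. norm (f n x)) \<longlonglongrightarrow> 0"
proof (rule LIMSEQ_I)
  fix e :: real assume "e > 0"
  then obtain d where d: "d > 0" "\<And>f :: 'a \<Rightarrow> 'b. sqint M f \<Longrightarrow> sqn M f \<le> d \<Longrightarrow> (LINT x|M. norm (f x)) < e"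
    using L1_le_of_sqn_le by metis
  obtain N where "\<And>n. n \<ge> N \<Longrightarrow> norm (sqn M (f n) - 0) < d" using LIMSEQ_D[OF assms(2) d(1)] by blast
  then have "norm ((LINT x|M. norm (f n x)) - 0) < e" if "n \<ge> N" for n
    using d(2)[OF assms(1), of n] that by (auto simp: abs_less_iff less_imp_le)
  then show "\<exists>N. \<forall>n\<ge>N. norm ((LINT x|M. norm (f n x)) - 0) < e" by blast
qed

text \<open>Riesz--Fischer: a Cauchy sequence in $L^2$ is Cauchy in $L^1$, hence converges almost
  everywhere along a subsequence, and Fatou's lemma identifies the limit in $L^2$.\<close>

lemma sqint_complete:
  fixes f :: "nat \<Rightarrow> 'a \<Rightarrow> 'b::euclidean_space"
  assumes f: "\<And>n. sqint M (f n)"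
    and C: "\<And>e. e > 0 \<Longrightarrow> \<exists>N. \<forall>m\<ge>N. \<forall>n\<ge>N. sqn M (\<lambda>x. f m x - f n x) \<le> e"
  obtains g where "sqint M g" "(\<lambda>n. sqn M (\<lambda>x. f n x - g x)) \<longlonglongrightarrow> 0"
proof -
  have "\<exists>N. \<forall>i\<ge>N. \<forall>j\<ge>N. LINT x|M. norm (f i x - f j x) < e" if e: "e > 0" for e
  proof -
    obtain d where d: "d > 0" "\<And>f :: 'a \<Rightarrow> 'b. sqint M f \<Longrightarrow> sqn M f \<le> d \<Longrightarrow> (LINT x|M. norm (f x)) < e"
      using L1_le_of_sqn_le[OF e] by metis
    show ?thesis using C[OF d(1)] d(2)[OF sqint_diff[OF f f]] by metis
  qed
  from cauchy_L1_AE_cauchy_subseq[OF sqint_integrable[OF f] this]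
  obtain r where r: "strict_mono r" "AE x in M. Cauchy (\<lambda>i. f (r i) x)" by blast
  define g where "g = (\<lambda>x. lim (\<lambda>i. f (r i) x))"
  have gm: "g \<in> borel_measurable M"
    unfolding g_def by (intro borel_measurable_lim_metric sqintD f)
  have lim: "AE x in M. (\<lambda>i. f (r i) x) \<longlonglongrightarrow> g x"
    using r(2) by (rule eventually_mono) (simp add: g_def Cauchy_convergent_iff convergent_LIMSEQ_iff)
  have key: "integrable M (\<lambda>x. (norm (f n x - g x))\<^sup>2) \<and> sqn M (\<lambda>x. f n x - g x) \<le> e"
    if e: "e > 0" and n: "\<And>k. k \<ge> N \<Longrightarrow> sqn M (\<lambda>x. f n x - f k x) \<le> e" for n N e
  proof -
    have "(\<integral>\<^sup>+x. ennreal ((norm (f n x - g x))\<^sup>2) \<partial>M)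
        = (\<integral>\<^sup>+x. liminf (\<lambda>i. ennreal ((norm (f n x - f (r i) x))\<^sup>2)) \<partial>M)"
    proof (rule nn_integral_cong_AE, use lim in \<open>rule eventually_mono\<close>)
      fix x assume "(\<lambda>i. f (r i) x) \<longlonglongrightarrow> g x"
      then have "(\<lambda>i. ennreal ((norm (f n x - f (r i) x))\<^sup>2)) \<longlonglongrightarrow> ennreal ((norm (f n x - g x))\<^sup>2)"
        by (intro tendsto_intros)
      then show "ennreal ((norm (f n x - g x))\<^sup>2) = liminf (\<lambda>i. ennreal ((norm (f n x - f (r i) x))\<^sup>2))"
        by (rule lim_imp_Liminf[OF trivial_limit_sequentially, symmetric])
    qed
    also have "\<dots> \<le> liminf (\<lambda>i. \<integral>\<^sup>+x. ennreal ((norm (f n x - f (r i) x))\<^sup>2) \<partial>M)"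
      using f[THEN sqintD(1)] by (intro nn_integral_liminf) auto
    also have "\<dots> \<le> ennreal e"
    proof (rule Liminf_le)
      have "(\<integral>\<^sup>+x. ennreal ((norm (f n x - f (r i) x))\<^sup>2) \<partial>M) \<le> ennreal e" if "i \<ge> N" for i
      proof -
        have "(\<integral>\<^sup>+x. ennreal ((norm (f n x - f (r i) x))\<^sup>2) \<partial>M) = ennreal (sqn M (\<lambda>x. f n x - f (r i) x))"
          unfolding sqn_def using sqint_diff[OF f f] by (intro nn_integral_eq_integral) (auto simp: sqint_def)
        moreover have "r i \<ge> N" using seq_suble[OF r(1), of i] that by simp
        ultimately show ?thesis using n by (simp add: ennreal_leI)
      qed
      then show "\<forall>\<^sub>F i in sequentially. (\<integral>\<^sup>+x. ennreal ((norm (f n x - f (r i) x))\<^sup>2) \<partial>M) \<le> ennreal e"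
        by (auto simp: eventually_sequentially)
    qed simp
    finally have le: "(\<integral>\<^sup>+x. ennreal ((norm (f n x - g x))\<^sup>2) \<partial>M) \<le> ennreal e" .
    have int: "integrable M (\<lambda>x. (norm (f n x - g x))\<^sup>2)"
      using le f[THEN sqintD(1)] gm by (intro integrableI_bounded) (auto intro: le_less_trans)
    have "ennreal (sqn M (\<lambda>x. f n x - g x)) \<le> ennreal e"
      using le nn_integral_eq_integral[OF int] by (simp add: sqn_def)
    then show ?thesis using int e by simp
  qed
  have small: "\<exists>N. \<forall>n\<ge>N. sqint M (\<lambda>x. f n x - g x) \<and> sqn M (\<lambda>x. f n x - g x) \<le> e" if e: "e > 0" for e
  proof -
    obtain N where "\<forall>m\<ge>N. \<forall>n\<ge>N. sqn M (\<lambda>x. f m x - f n x) \<le> e" using C[OF e] by blast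
    then have "integrable M (\<lambda>x. (norm (f n x - g x))\<^sup>2) \<and> sqn M (\<lambda>x. f n x - g x) \<le> e" if "n \<ge> N" for n
      using key[OF e, of N n] that by blast
    then show ?thesis using f[THEN sqintD(1)] gm by (auto simp: sqint_def)
  qed
  show thesis
  proof
    obtain n where "sqint M (\<lambda>x. f n x - g x)" using small[of 1] by auto
    from sqint_diff[OF f[of n] this] show "sqint M g" by simp
    show "(\<lambda>n. sqn M (\<lambda>x. f n x - g x)) \<longlonglongrightarrow> 0"
    proof (rule LIMSEQ_I)
      fix e :: real assume "e > 0"
      then obtain N where N: "\<forall>n\<ge>N. sqn M (\<lambda>x. f n x - g x) \<le> e / 2" using small[of "e / 2"] by auto
      have "norm (sqn M (\<lambda>x. f n x - g x) - 0) < e" if "n \<ge> N" for n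
      proof -
        have "sqn M (\<lambda>x. f n x - g x) \<le> e / 2" using N that by blast
        then show ?thesis using sqn_nonneg[of M "\<lambda>x. f n x - g x"] \<open>e > 0\<close> by simp
      qed
      then show "\<exists>N. \<forall>n\<ge>N. norm (sqn M (\<lambda>x. f n x - g x) - 0) < e" by blast
    qed
  qed
qed

end

section \<open>The Dirichlet energy on a bounded open set\<close>

definition dirichlet :: "'a::euclidean_space set \<Rightarrow> ('a \<Rightarrow> real) \<Rightarrow> real" where
  "dirichlet Om u = sqn (lebesgue_on Om) (wgrad Om u)"

locale bounded_open =
  fixes Om :: "'a::euclidean_space set"
  assumes op: "open Om" and bd: "bounded Om"
begin

abbreviation "M \<equiv> lebesgue_on Om"

lemma Om_sets [simp, measurable]: "Om \<in> sets lebesgue" using op by simp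

sublocale finite_measure M
  by (rule finite_measure_lebesgue_on) (use op bd in \<open>auto intro: lmeasurable_open\<close>)

lemma sqint_sub: "sqint M f \<Longrightarrow> K \<subseteq> Om \<Longrightarrow> K \<in> sets lebesgue \<Longrightarrow> sqint (lebesgue_on K) f"
  unfolding sqint_def
  using measurable_restrict_mono integrable_lebesgue_on_subset[of Om "\<lambda>x. (norm (f x))\<^sup>2" K] by auto

lemma sqn_subset:
  assumes f: "sqint M f" and T: "T \<in> sets lebesgue" "T \<subseteq> Om"
  shows "sqn (lebesgue_on T) f \<le> sqn M f"
proof -
  have "sqint (lebesgue_on T) f" by (rule sqint_sub[OF f T(2,1)])
  then have "(LINT x|lebesgue. indicator T x *\<^sub>R (norm (f x))\<^sup>2) \<le> (LINT x|lebesgue. indicator Om x *\<^sub>R (norm (f x))\<^sup>2)"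
    using f T by (intro integral_mono) (auto simp: sqint_def integrable_restrict_space indicator_def)
  then show ?thesis using T by (simp add: sqn_def integral_restrict_space)
qed

lemma sqint_L1_loc: "sqint M f \<Longrightarrow> f \<in> L1_loc Om"
  unfolding L1_loc_def
  by (auto intro!: integrable_lebesgue_on_subset[OF sqint_integrable] simp: lmeasurable_compact fmeasurableD)

lemma H1_I: "sqint M u \<Longrightarrow> weak_gradient Om u g \<Longrightarrow> sqint M g \<Longrightarrow> u \<in> H1 Om"
  by (auto simp: H1_def L2_sqint)

lemma measurable_AE_cong:
  fixes f g :: "'a \<Rightarrow> 'b::euclidean_space"
  assumes f: "f \<in> borel_measurable M" and fg: "AE x in M. f x = g x"
  shows "g \<in> borel_measurable M"
proof -
  have "(\<lambda>x. if x \<in> Om then f x else 0) \<in> borel_measurable lebesgue"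
    using borel_measurable_if_lebesgue_on[of Om UNIV f] f by (simp add: lebesgue_on_UNIV_eq)
  moreover have "AE x in lebesgue. (if x \<in> Om then f x else 0) = (if x \<in> Om then g x else 0)"
    using fg by (auto simp: AE_restrict_space_iff)
  ultimately have "(\<lambda>x. if x \<in> Om then g x else 0) \<in> borel_measurable lebesgue"
    by (rule borel_measurable_AE)
  then show ?thesis
    using borel_measurable_if_lebesgue_on[of Om UNIV g] by (simp add: lebesgue_on_UNIV_eq)
qed

lemma sqint_AE_cong:
  assumes "sqint M f" "AE x in M. f x = g x"
  shows "sqint M g" "sqn M g = sqn M f"
proof -
  have g: "g \<in> borel_measurable M" using measurable_AE_cong assms by (auto simp: sqint_def)
  show "sqn M g = sqn M f"
    using sqn_cong_AE[OF assms(2) _ g] assms(1) by (simp add: sqint_def)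
  have "integrable M (\<lambda>x. (norm (g x))\<^sup>2)"
    by (rule integrable_cong_AE_imp[OF sqintD(2)[OF assms(1)]])
      (use g assms(2) in \<open>auto elim!: eventually_mono\<close>)
  then show "sqint M g" using g by (simp add: sqint_def)
qed

lemma H1D:
  assumes "u \<in> H1 Om"
  shows "sqint M u" "weak_gradient Om u (wgrad Om u)" "sqint M (wgrad Om u)"
proof -
  obtain g where g: "weak_gradient Om u g" "sqint M g" and u: "sqint M u"
    using assms by (auto simp: H1_def L2_sqint)
  show "sqint M u" by (rule u)
  show w: "weak_gradient Om u (wgrad Om u)" using g(1) by (rule weak_gradient_wgrad)
  have "AE x in M. g x = wgrad Om u x"
    using wgrad_AE[OF g(1) op] by (rule eventually_mono) (rule sym)
  then show "sqint M (wgrad Om u)" by (rule sqint_AE_cong(1)[OF g(2)])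
qed

lemma sqn_wgrad:
  assumes "weak_gradient Om u g" "sqint M g"
  shows "dirichlet Om u = sqn M g"
  unfolding dirichlet_def
proof (rule sqint_AE_cong(2)[OF assms(2)])
  show "AE x in M. g x = wgrad Om u x"
    using wgrad_AE[OF assms(1) op] by (rule eventually_mono) (rule sym)
qed

lemma H1_add:
  assumes u: "u \<in> H1 Om" and v: "v \<in> H1 Om" shows "(\<lambda>x. u x + v x) \<in> H1 Om"
  using H1_I[OF sqint_add[OF H1D(1)[OF u] H1D(1)[OF v]]
      weak_gradient_add[OF H1D(2)[OF u] H1D(2)[OF v] op] sqint_add[OF H1D(3)[OF u] H1D(3)[OF v]]] .

lemma H1_cmult:
  assumes u: "u \<in> H1 Om" shows "(\<lambda>x. c * u x) \<in> H1 Om"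
  using H1_I[OF sqint_cmult[OF H1D(1)[OF u]] weak_gradient_cmult[OF H1D(2)[OF u]]
      sqint_scaleR[OF H1D(3)[OF u]]] .

lemma H1_diff:
  assumes u: "u \<in> H1 Om" and v: "v \<in> H1 Om" shows "(\<lambda>x. u x - v x) \<in> H1 Om"
  using H1_I[OF sqint_diff[OF H1D(1)[OF u] H1D(1)[OF v]]
      weak_gradient_diff[OF H1D(2)[OF u] H1D(2)[OF v] op] sqint_diff[OF H1D(3)[OF u] H1D(3)[OF v]]] .

lemma dirichlet_add: "u \<in> H1 Om \<Longrightarrow> v \<in> H1 Om \<Longrightarrow>
    dirichlet Om (\<lambda>x. u x + v x) = sqn M (\<lambda>x. wgrad Om u x + wgrad Om v x)"
  by (intro sqn_wgrad weak_gradient_add sqint_add H1D op)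

lemma dirichlet_diff: "u \<in> H1 Om \<Longrightarrow> v \<in> H1 Om \<Longrightarrow>
    dirichlet Om (\<lambda>x. u x - v x) = sqn M (\<lambda>x. wgrad Om u x - wgrad Om v x)"
  by (intro sqn_wgrad weak_gradient_diff sqint_diff H1D op)

lemma dirichlet_cmult: "u \<in> H1 Om \<Longrightarrow> dirichlet Om (\<lambda>x. c * u x) = c\<^sup>2 * dirichlet Om u"
  unfolding dirichlet_def[of Om u] sqn_scaleR[symmetric]
  by (intro sqn_wgrad weak_gradient_cmult sqint_scaleR H1D)

lemma dirichlet_nonneg: "dirichlet Om u \<ge> 0"
  by (simp add: dirichlet_def sqn_nonneg)

lemma dirichlet_parallelogram:
  assumes "u \<in> H1 Om" "v \<in> H1 Om"
  shows "dirichlet Om (\<lambda>x. u x - v x)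
      = 2 * dirichlet Om u + 2 * dirichlet Om v - 4 * dirichlet Om (\<lambda>x. (u x + v x) / 2)"
proof -
  have "4 * dirichlet Om (\<lambda>x. (u x + v x) / 2) = dirichlet Om (\<lambda>x. u x + v x)"
    using dirichlet_cmult[OF H1_add[OF assms], of "1/2"] by (simp add: power2_eq_square)
  then show ?thesis
    using sqn_parallelogram[OF H1D(3)[OF assms(1)] H1D(3)[OF assms(2)]]
    by (simp add: dirichlet_diff[OF assms] dirichlet_add[OF assms] dirichlet_def[of Om u] dirichlet_def[of Om v])
qed

lemma test_sqint:
  assumes "\<phi> \<in> test_functions Om"
  shows "sqint M \<phi>" "sqint M (grad \<phi>)"
proof -
  obtain K where K: "compact K" "smooth \<phi>" "\<And>x. x \<notin> K \<Longrightarrow> \<phi> x = 0" "\<And>x. x \<notin> K \<Longrightarrow> grad \<phi> x = 0"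
    using assms by (rule test_functionsE) blast
  have *: "sqint M f" if f: "continuous_on UNIV f" and z: "\<And>x. x \<notin> K \<Longrightarrow> f x = 0"
    for f :: "'a \<Rightarrow> 'b::euclidean_space"
  proof -
    obtain C where "C > 0" "\<And>x. norm (f x) \<le> C" using compact_support_bounded[OF f K(1) z] by blast
    then show ?thesis
      by (intro sqint_bound[where w="\<lambda>_. C\<^sup>2"] borel_measurable_lebesgue_onI
          borel_measurable_continuous_onI f) (auto intro: power_mono)
  qed
  show "sqint M \<phi>" "sqint M (grad \<phi>)"
    using K by (auto intro!: * smooth_continuous_on smooth_continuous_grad)
qed

lemma test_H1: "\<phi> \<in> test_functions Om \<Longrightarrow> \<phi> \<in> H1 Om"
  by (rule H1_I[OF test_sqint(1) weak_gradient_test[OF op] test_sqint(2)])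

lemma dirichlet_test: "\<phi> \<in> test_functions Om \<Longrightarrow> dirichlet Om \<phi> = sqn M (grad \<phi>)"
  by (intro sqn_wgrad weak_gradient_test test_sqint op)

lemma H1_norm_sq: "(H1_norm Om u)\<^sup>2 = sqn M u + dirichlet Om u"
  unfolding H1_norm_def dirichlet_def sqn_def
  by (subst real_sqrt_pow2) (auto intro!: add_nonneg_nonneg integral_nonneg_AE)

lemma H1_norm_tendsto:
  "(\<lambda>n. H1_norm Om (u n)) \<longlonglongrightarrow> 0 \<longleftrightarrow>
     (\<lambda>n. sqn M (u n)) \<longlonglongrightarrow> 0 \<and> (\<lambda>n. dirichlet Om (u n)) \<longlonglongrightarrow> 0"
proof
  assume "(\<lambda>n. H1_norm Om (u n)) \<longlonglongrightarrow> 0"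
  then have "(\<lambda>n. (H1_norm Om (u n))\<^sup>2) \<longlonglongrightarrow> 0\<^sup>2" by (intro tendsto_power)
  then have l: "(\<lambda>n. sqn M (u n) + dirichlet Om (u n)) \<longlonglongrightarrow> 0" by (simp add: H1_norm_sq)
  show "(\<lambda>n. sqn M (u n)) \<longlonglongrightarrow> 0 \<and> (\<lambda>n. dirichlet Om (u n)) \<longlonglongrightarrow> 0"
    by (intro conjI; rule tendsto_sandwich[OF _ _ tendsto_const l])
      (auto simp: sqn_nonneg dirichlet_nonneg)
next
  assume "(\<lambda>n. sqn M (u n)) \<longlonglongrightarrow> 0 \<and> (\<lambda>n. dirichlet Om (u n)) \<longlonglongrightarrow> 0"
  then have "(\<lambda>n. sqrt (sqn M (u n) + dirichlet Om (u n))) \<longlonglongrightarrow> sqrt (0 + 0)"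
    by (intro tendsto_intros) auto
  moreover have "sqrt (sqn M (u n) + dirichlet Om (u n)) = H1_norm Om (u n)" for n
    unfolding H1_norm_sq[symmetric] by (simp add: H1_norm_def)
  ultimately show "(\<lambda>n. H1_norm Om (u n)) \<longlonglongrightarrow> 0" by simp
qed

lemma H1_0_iff:
  "u \<in> H1_0 Om \<longleftrightarrow> u \<in> H1 Om \<and> (\<exists>\<phi>. (\<forall>n. \<phi> n \<in> test_functions Om) \<and>
     (\<lambda>n. sqn M (\<lambda>x. u x - \<phi> n x)) \<longlonglongrightarrow> 0 \<and> (\<lambda>n. dirichlet Om (\<lambda>x. u x - \<phi> n x)) \<longlonglongrightarrow> 0)"
  unfolding H1_0_def H1_norm_tendsto by blast

lemma H1_0_approx:
  assumes "u \<in> H1_0 Om" "e > 0"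
  obtains \<phi> where "\<phi> \<in> test_functions Om" "sqn M (\<lambda>x. u x - \<phi> x) < e" "dirichlet Om (\<lambda>x. u x - \<phi> x) < e"
proof -
  obtain \<phi> where \<phi>: "\<And>n. \<phi> n \<in> test_functions Om"
     "(\<lambda>n. sqn M (\<lambda>x. u x - \<phi> n x)) \<longlonglongrightarrow> 0" "(\<lambda>n. dirichlet Om (\<lambda>x. u x - \<phi> n x)) \<longlonglongrightarrow> 0"
    using assms(1) unfolding H1_0_iff by blast
  have "\<forall>\<^sub>F n in sequentially. sqn M (\<lambda>x. u x - \<phi> n x) < e \<and> dirichlet Om (\<lambda>x. u x - \<phi> n x) < e"
    using order_tendstoD(2)[OF \<phi>(2) assms(2)] order_tendstoD(2)[OF \<phi>(3) assms(2)]
    by (rule eventually_conj)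
  then obtain n where "sqn M (\<lambda>x. u x - \<phi> n x) < e \<and> dirichlet Om (\<lambda>x. u x - \<phi> n x) < e"
    using eventually_happens trivial_limit_sequentially by blast
  then show ?thesis using that \<phi>(1) by blast
qed

lemma H1_0_I:
  assumes "u \<in> H1 Om"
    and "\<And>e. e > 0 \<Longrightarrow> \<exists>\<phi>\<in>test_functions Om. sqn M (\<lambda>x. u x - \<phi> x) \<le> e \<and> dirichlet Om (\<lambda>x. u x - \<phi> x) \<le> e"
  shows "u \<in> H1_0 Om"
proof -
  obtain \<phi> where \<phi>: "\<And>n. \<phi> n \<in> test_functions Om"
    "\<And>n. sqn M (\<lambda>x. u x - \<phi> n x) \<le> 1 / real (Suc n)" "\<And>n. dirichlet Om (\<lambda>x. u x - \<phi> n x) \<le> 1 / real (Suc n)"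
    using assms(2)[of "1 / real (Suc n)" for n] by simp metis
  have "(\<lambda>n. 1 / real (Suc n)) \<longlonglongrightarrow> 0" by (rule LIMSEQ_Suc[OF lim_const_over_n])
  from tendsto_sandwich[OF _ _ tendsto_const this] \<phi>
  show ?thesis
    unfolding H1_0_iff using assms(1)
    by (intro conjI exI[of _ \<phi>]) (auto simp: sqn_nonneg dirichlet_nonneg)
qed

lemma sqn_perturb:
  assumes "u \<in> H1 Om" "v \<in> H1 Om" "a \<in> H1 Om" "b \<in> H1 Om"
  shows "sqn M (\<lambda>x. (u x + c * v x) - (a x + c * b x))
      \<le> 2 * sqn M (\<lambda>x. u x - a x) + 2 * c\<^sup>2 * sqn M (\<lambda>x. v x - b x)"
    "dirichlet Om (\<lambda>x. (u x + c * v x) - (a x + c * b x))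
      \<le> 2 * dirichlet Om (\<lambda>x. u x - a x) + 2 * c\<^sup>2 * dirichlet Om (\<lambda>x. v x - b x)"
proof -
  have eq: "(\<lambda>x. (u x + c * v x) - (a x + c * b x)) = (\<lambda>x. (u x - a x) + c * (v x - b x))"
    by (simp add: algebra_simps)
  have h: "(\<lambda>x. u x - a x) \<in> H1 Om" "(\<lambda>x. v x - b x) \<in> H1 Om" using assms by (auto intro: H1_diff)
  show "sqn M (\<lambda>x. (u x + c * v x) - (a x + c * b x))
      \<le> 2 * sqn M (\<lambda>x. u x - a x) + 2 * c\<^sup>2 * sqn M (\<lambda>x. v x - b x)"
    using sqn_add_le2[OF H1D(1)[OF h(1)] sqint_cmult[OF H1D(1)[OF h(2)], of c]]
    unfolding eq by (simp add: sqn_cmult)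
  show "dirichlet Om (\<lambda>x. (u x + c * v x) - (a x + c * b x))
      \<le> 2 * dirichlet Om (\<lambda>x. u x - a x) + 2 * c\<^sup>2 * dirichlet Om (\<lambda>x. v x - b x)"
    using sqn_add_le2[OF H1D(3)[OF h(1)] H1D(3)[OF H1_cmult[OF h(2), of c]]]
    unfolding eq
    by (simp add: dirichlet_add[OF h(1) H1_cmult[OF h(2)]] dirichlet_def[symmetric] dirichlet_cmult[OF h(2)])
qed

lemma test_H1_0:
  assumes "\<phi> \<in> test_functions Om" shows "\<phi> \<in> H1_0 Om"
proof (rule H1_0_I[OF test_H1[OF assms]])
  fix e :: real assume "e > 0"
  then show "\<exists>\<psi>\<in>test_functions Om. sqn M (\<lambda>x. \<phi> x - \<psi> x) \<le> e \<and> dirichlet Om (\<lambda>x. \<phi> x - \<psi> x) \<le> e"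
    using assms dirichlet_cmult[OF test_H1[OF assms], of 0] by (intro bexI[of _ \<phi>]) (auto simp: sqn_def)
qed

lemma H1_0_H1: "u \<in> H1_0 Om \<Longrightarrow> u \<in> H1 Om" by (simp add: H1_0_def)

lemma H1_0_add_cmult:
  assumes "u \<in> H1_0 Om" "v \<in> H1_0 Om"
  shows "(\<lambda>x. u x + c * v x) \<in> H1_0 Om"
proof (rule H1_0_I)
  show "(\<lambda>x. u x + c * v x) \<in> H1 Om" using assms by (intro H1_add H1_cmult H1_0_H1)
  fix e :: real assume e: "e > 0"
  define d where "d = e / (2 + 2 * c\<^sup>2)"
  have p: "2 + 2 * c\<^sup>2 > 0" by (simp add: add_pos_nonneg)
  then have d: "d > 0" using e by (simp add: d_def)
  obtain \<phi> where \<phi>: "\<phi> \<in> test_functions Om" "sqn M (\<lambda>x. u x - \<phi> x) < d" "dirichlet Om (\<lambda>x. u x - \<phi> x) < d"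
    using H1_0_approx[OF assms(1) d] .
  obtain \<psi> where \<psi>: "\<psi> \<in> test_functions Om" "sqn M (\<lambda>x. v x - \<psi> x) < d" "dirichlet Om (\<lambda>x. v x - \<psi> x) < d"
    using H1_0_approx[OF assms(2) d] .
  have "(2 + 2 * c\<^sup>2) * d = e" using p by (simp add: d_def)
  then have e': "2 * d + 2 * c\<^sup>2 * d = e" by (simp add: distrib_right)
  have b: "2 * a + 2 * c\<^sup>2 * b \<le> e" if "a < d" "b < d" for a b
    unfolding e'[symmetric] using that by (intro add_mono mult_left_mono) auto
  show "\<exists>\<phi>\<in>test_functions Om. sqn M (\<lambda>x. u x + c * v x - \<phi> x) \<le> e \<and> dirichlet Om (\<lambda>x. u x + c * v x - \<phi> x) \<le> e"
    using sqn_perturb[OF H1_0_H1[OF assms(1)] H1_0_H1[OF assms(2)] test_H1[OF \<phi>(1)] test_H1[OF \<psi>(1)], of c]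
      b[OF \<phi>(2) \<psi>(2)] b[OF \<phi>(3) \<psi>(3)]
    by (intro bexI[OF _ test_add[OF \<phi>(1) test_cmult[OF \<psi>(1), of c]]]) auto
qed

lemma H1_0_diff: "u \<in> H1_0 Om \<Longrightarrow> v \<in> H1_0 Om \<Longrightarrow> (\<lambda>x. u x - v x) \<in> H1_0 Om"
  using H1_0_add_cmult[of u v "-1"] by simp

lemma H1_0_closed:
  assumes w: "\<And>k. w k \<in> H1_0 Om" and u: "u \<in> H1 Om"
    and 1: "(\<lambda>k. sqn M (\<lambda>x. u x - w k x)) \<longlonglongrightarrow> 0" and 2: "(\<lambda>k. dirichlet Om (\<lambda>x. u x - w k x)) \<longlonglongrightarrow> 0"
  shows "u \<in> H1_0 Om"
proof (rule H1_0_I[OF u])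
  fix e :: real assume "e > 0"
  then have e: "e / 4 > 0" by simp
  have "\<forall>\<^sub>F n in sequentially. sqn M (\<lambda>x. u x - w n x) < e / 4 \<and> dirichlet Om (\<lambda>x. u x - w n x) < e / 4"
    using order_tendstoD(2)[OF 1 e] order_tendstoD(2)[OF 2 e] by (rule eventually_conj)
  then obtain n where n: "sqn M (\<lambda>x. u x - w n x) < e / 4" "dirichlet Om (\<lambda>x. u x - w n x) < e / 4"
    using eventually_happens trivial_limit_sequentially by blast
  obtain \<phi> where \<phi>: "\<phi> \<in> test_functions Om" "sqn M (\<lambda>x. w n x - \<phi> x) < e / 4" "dirichlet Om (\<lambda>x. w n x - \<phi> x) < e / 4"
    using H1_0_approx[OF w e] .
  have h: "w n \<in> H1 Om" "\<phi> \<in> H1 Om" using w \<phi>(1) by (auto intro: H1_0_H1 test_H1)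
  have "sqn M (\<lambda>x. u x - \<phi> x) \<le> e"
    using sqn_triangle[OF u[THEN H1D(1)] h(1)[THEN H1D(1)] h(2)[THEN H1D(1)]] n \<phi> by simp
  moreover have "dirichlet Om (\<lambda>x. u x - \<phi> x) \<le> e"
    using sqn_triangle[OF u[THEN H1D(3)] h(1)[THEN H1D(3)] h(2)[THEN H1D(3)]] n \<phi>
    by (simp add: dirichlet_diff u h)
  ultimately show "\<exists>\<phi>\<in>test_functions Om. sqn M (\<lambda>x. u x - \<phi> x) \<le> e \<and> dirichlet Om (\<lambda>x. u x - \<phi> x) \<le> e"
    using \<phi>(1) by blast
qed

text \<open>Both sides of the integration by parts formula are continuous in $L^1$, because test functions and
  their gradients are bounded.\<close>

lemma weak_gradient_limit:
  assumes wg: "\<And>k. weak_gradient Om (u k) (g k)" and s: "\<And>k. sqint M (u k)" "\<And>k. sqint M (g k)"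
    and v: "sqint M v" "sqint M h"
    and 1: "(\<lambda>k. sqn M (\<lambda>x. u k x - v x)) \<longlonglongrightarrow> 0" and 2: "(\<lambda>k. sqn M (\<lambda>x. g k x - h x)) \<longlonglongrightarrow> 0"
  shows "weak_gradient Om v h"
  unfolding weak_gradient_def
proof (intro conjI ballI)
  show vL: "v \<in> L1_loc Om" and hL: "h \<in> L1_loc Om" using v by (auto intro: sqint_L1_loc)
  fix \<phi> and i :: 'a assume \<phi>: "\<phi> \<in> test_functions Om" and i: "i \<in> Basis"
  have lim: "(\<lambda>k. LINT x|M. a k x * \<psi> x) \<longlonglongrightarrow> (LINT x|M. b x * \<psi> x)"
    if \<psi>: "\<psi> \<in> test_functions Om" and a: "\<And>k. sqint M (a k)" and b: "sqint M b"
      and l: "(\<lambda>k. sqn M (\<lambda>x. a k x - b x)) \<longlonglongrightarrow> 0" for a :: "nat \<Rightarrow> 'a \<Rightarrow> real" and b \<psi>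
  proof -
    obtain K where K: "compact K" "smooth \<psi>" "\<And>x. x \<notin> K \<Longrightarrow> \<psi> x = 0"
      using \<psi> by (rule test_functionsE) blast
    obtain C where C: "C > 0" "\<And>x. norm (\<psi> x) \<le> C"
      using compact_support_bounded[OF smooth_continuous_on[OF K(2)] K(1,3)] by blast
    have int: "integrable M (\<lambda>x. f x * \<psi> x)" if "sqint M f" for f
      using that by (intro L1_loc_test_integrable sqint_L1_loc \<psi> op)
    have z: "(\<lambda>k. C * (LINT x|M. norm (a k x - b x))) \<longlonglongrightarrow> C * 0"
      by (intro tendsto_intros L1_tendsto_of_sqn sqint_diff a b l)
    have "(\<lambda>k. (LINT x|M. a k x * \<psi> x) - (LINT x|M. b x * \<psi> x)) \<longlonglongrightarrow> 0"
    proof (rule Lim_null_comparison)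
      show "(\<lambda>k. C * (LINT x|M. norm (a k x - b x))) \<longlonglongrightarrow> 0" using z by simp
      have "norm ((LINT x|M. a k x * \<psi> x) - (LINT x|M. b x * \<psi> x)) \<le> C * (LINT x|M. norm (a k x - b x))" for k
      proof -
        have "(LINT x|M. a k x * \<psi> x) - (LINT x|M. b x * \<psi> x) = (LINT x|M. (a k x - b x) * \<psi> x)"
          using int a b by (simp add: left_diff_distrib)
        also have "norm \<dots> \<le> (LINT x|M. norm ((a k x - b x) * \<psi> x))" by (rule integral_norm_bound)
        also have "\<dots> \<le> (LINT x|M. C * norm (a k x - b x))"
          using int[OF sqint_diff[OF a b]] sqint_integrable[OF sqint_diff[OF a b]] C
          by (intro integral_mono integrable_norm integrable_mult_right)
            (auto simp: abs_mult mult.commute intro!: mult_right_mono)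
        finally show ?thesis by simp
      qed
      then show "\<forall>\<^sub>F k in sequentially. norm ((LINT x|M. a k x * \<psi> x) - (LINT x|M. b x * \<psi> x))
          \<le> C * (LINT x|M. norm (a k x - b x))" by simp
    qed
    then show ?thesis by (simp add: LIM_zero_cancel)
  qed
  have ni: "(norm (a \<bullet> i))\<^sup>2 \<le> (norm a)\<^sup>2" for a :: 'a
    using power_mono[OF Basis_le_norm[OF i, of a] abs_ge_zero, of 2] by simp
  have gi: "sqint M (\<lambda>x. f x \<bullet> i)" if f: "sqint M f" for f :: "'a \<Rightarrow> 'a"
  proof (rule sqint_bound[OF _ sqintD(2)[OF f]])
    show "(\<lambda>x. f x \<bullet> i) \<in> borel_measurable M"
      by (intro borel_measurable_inner sqintD(1)[OF f] borel_measurable_const)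
  qed (rule ni)
  have "(\<lambda>k. sqn M (\<lambda>x. g k x \<bullet> i - h x \<bullet> i)) \<longlonglongrightarrow> 0"
  proof (rule tendsto_sandwich[OF _ _ tendsto_const 2])
    show "\<forall>\<^sub>F k in sequentially. sqn M (\<lambda>x. g k x \<bullet> i - h x \<bullet> i) \<le> sqn M (\<lambda>x. g k x - h x)"
      unfolding sqn_def inner_diff_left[symmetric]
      by (intro always_eventually allI integral_mono ni sqintD(2) gi sqint_diff s v)
  qed (simp add: sqn_nonneg)
  from lim[OF \<phi> gi[OF s(2)] gi[OF v(2)] this]
  have "(\<lambda>k. - (LINT x|M. (g k x \<bullet> i) * \<phi> x)) \<longlonglongrightarrow> - (LINT x|M. (h x \<bullet> i) * \<phi> x)"
    by (rule tendsto_minus)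
  moreover have "(LINT x|M. u k x * (grad \<phi> x \<bullet> i)) = - (LINT x|M. (g k x \<bullet> i) * \<phi> x)" for k
    using wg \<phi> i by (auto simp: weak_gradient_def)
  ultimately have "(\<lambda>k. LINT x|M. u k x * (grad \<phi> x \<bullet> i)) \<longlonglongrightarrow> - (LINT x|M. (h x \<bullet> i) * \<phi> x)"
    by simp
  with lim[OF test_grad[OF \<phi> i] s(1) v(1) 1]
  show "(LINT x|M. v x * (grad \<phi> x \<bullet> i)) = - (LINT x|M. (h x \<bullet> i) * \<phi> x)"
    by (rule LIMSEQ_unique)
qed

lemma H1_complete:
  assumes u: "\<And>k. u k \<in> H1 Om"
    and C: "\<And>e. e > 0 \<Longrightarrow> \<exists>N. \<forall>m\<ge>N. \<forall>n\<ge>N. sqn M (\<lambda>x. u m x - u n x) \<le> e \<and> dirichlet Om (\<lambda>x. u m x - u n x) \<le> e"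
  obtains w where "w \<in> H1 Om" "(\<lambda>k. sqn M (\<lambda>x. w x - u k x)) \<longlonglongrightarrow> 0" "(\<lambda>k. dirichlet Om (\<lambda>x. w x - u k x)) \<longlonglongrightarrow> 0"
proof -
  obtain w where w: "sqint M w" "(\<lambda>k. sqn M (\<lambda>x. u k x - w x)) \<longlonglongrightarrow> 0"
  proof (rule sqint_complete[OF H1D(1)[OF u]])
    show "\<exists>N. \<forall>m\<ge>N. \<forall>n\<ge>N. sqn M (\<lambda>x. u m x - u n x) \<le> e" if "e > 0" for e
      using C[OF that] by blast
  qed
  obtain h where h: "sqint M h" "(\<lambda>k. sqn M (\<lambda>x. wgrad Om (u k) x - h x)) \<longlonglongrightarrow> 0"
  proof (rule sqint_complete[OF H1D(3)[OF u]])
    show "\<exists>N. \<forall>m\<ge>N. \<forall>n\<ge>N. sqn M (\<lambda>x. wgrad Om (u m) x - wgrad Om (u n) x) \<le> e" if "e > 0" for e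
      using C[OF that] unfolding dirichlet_diff[OF u u] by blast
  qed
  have wg: "weak_gradient Om w h"
    by (rule weak_gradient_limit[OF H1D(2)[OF u] H1D(1)[OF u] H1D(3)[OF u] w(1) h(1) w(2) h(2)])
  have "dirichlet Om (\<lambda>x. w x - u k x) = sqn M (\<lambda>x. h x - wgrad Om (u k) x)" for k
    by (intro sqn_wgrad weak_gradient_diff sqint_diff wg h H1D u op)
  then show ?thesis
    using that[OF H1_I[OF w(1) wg h(1)]] w(2) h(2) by (simp add: sqn_minus_commute)
qed

end

section \<open>Poincare inequality and weak lower semicontinuity\<close>

context bounded_open begin

text \<open>Integrating the divergence of $x_i \phi^2 e_i$ gives $\int \phi^2 = - 2 \int x_i \phi\, \partial_i \phi$.\<close>

lemma poincare_test:
  assumes R: "\<And>x. x \<in> Om \<Longrightarrow> norm x \<le> R" and \<phi>: "\<phi> \<in> test_functions Om"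
  shows "sqn M \<phi> \<le> 4 * R\<^sup>2 * dirichlet Om \<phi>"
proof -
  obtain i :: 'a where i: "i \<in> Basis" using nonempty_Basis by blast
  have sm: "smooth \<phi>" "smooth (\<lambda>x::'a. x \<bullet> i)"
    using test_smooth[OF \<phi>] smooth_inner by blast+
  have gi: "grad (\<lambda>x::'a. x \<bullet> i) = (\<lambda>x. i)"
    by (rule ext, rule grad_eq) (auto simp: gderiv_def intro!: derivative_eq_intros)
  have \<psi>: "(\<lambda>x. (x \<bullet> i) * \<phi> x) \<in> test_functions Om" by (rule test_smult[OF sm(2) \<phi>])
  have wg: "weak_gradient Om \<phi> (grad \<phi>)" by (rule weak_gradient_test[OF op \<phi>])
  let ?a = "\<lambda>x. (x \<bullet> i) * (\<phi> x * (grad \<phi> x \<bullet> i))"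
  have s: "sqint M (\<lambda>x. grad \<phi> x \<bullet> i)" by (rule test_sqint(1)[OF test_grad[OF \<phi> i]])
  have int2: "integrable M (\<lambda>x. \<phi> x * \<phi> x)"
    using sqint_inner_integrable[OF test_sqint(1)[OF \<phi>] test_sqint(1)[OF \<phi>]] by simp
  have inta: "integrable M ?a"
    using sqint_inner_integrable[OF test_sqint(1)[OF \<psi>] s] by (simp add: mult.assoc)
  have "(LINT x|M. \<phi> x * (grad (\<lambda>x. (x \<bullet> i) * \<phi> x) x \<bullet> i)) = - (LINT x|M. (grad \<phi> x \<bullet> i) * ((x \<bullet> i) * \<phi> x))"
    using wg \<psi> i by (auto simp: weak_gradient_def)
  also have "(LINT x|M. (grad \<phi> x \<bullet> i) * ((x \<bullet> i) * \<phi> x)) = (LINT x|M. ?a x)"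
    by (simp add: mult_ac)
  also have "(LINT x|M. \<phi> x * (grad (\<lambda>x. (x \<bullet> i) * \<phi> x) x \<bullet> i)) = (LINT x|M. ?a x + \<phi> x * \<phi> x)"
    unfolding grad_mult[OF sm(2,1)] gi using i by (simp add: inner_add_left algebra_simps)
  also have "\<dots> = (LINT x|M. ?a x) + (LINT x|M. \<phi> x * \<phi> x)" using inta int2 by simp
  finally have "(LINT x|M. \<phi> x * \<phi> x) = (LINT x|M. - 2 * ?a x)" by simp
  also have "\<dots> \<le> (LINT x|M. \<phi> x * \<phi> x / 2 + 2 * R\<^sup>2 * (norm (grad \<phi> x))\<^sup>2)"
  proof (rule integral_mono)
    show "integrable M (\<lambda>x. - 2 * ?a x)" using inta by (rule integrable_mult_right)
    show "integrable M (\<lambda>x. \<phi> x * \<phi> x / 2 + 2 * R\<^sup>2 * (norm (grad \<phi> x))\<^sup>2)"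
      using int2 test_sqint(2)[OF \<phi>] by (auto simp: sqint_def)
    fix x assume "x \<in> space M"
    then have nx: "norm x \<le> R" using R by simp
    define b where "b = (x \<bullet> i) * (grad \<phi> x \<bullet> i)"
    have "\<bar>b\<bar> \<le> R * norm (grad \<phi> x)"
      unfolding b_def abs_mult using nx Basis_le_norm[OF i, of x] Basis_le_norm[OF i, of "grad \<phi> x"]
      by (intro mult_mono) auto
    then have "b\<^sup>2 \<le> (R * norm (grad \<phi> x))\<^sup>2" by (metis abs_ge_zero power2_abs power_mono)
    moreover have "0 \<le> (\<phi> x + 2 * b)\<^sup>2" by simp
    ultimately have "- 2 * (\<phi> x * b) \<le> \<phi> x * \<phi> x / 2 + 2 * (R * norm (grad \<phi> x))\<^sup>2"
      by (simp add: power2_eq_square algebra_simps)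
    then show "- 2 * ?a x \<le> \<phi> x * \<phi> x / 2 + 2 * R\<^sup>2 * (norm (grad \<phi> x))\<^sup>2"
      by (simp add: b_def power_mult_distrib mult_ac)
  qed
  also have "\<dots> = (LINT x|M. \<phi> x * \<phi> x) / 2 + 2 * R\<^sup>2 * dirichlet Om \<phi>"
    using int2 test_sqint(2)[OF \<phi>] by (simp add: dirichlet_test[OF \<phi>] sqint_def sqn_def)
  finally show ?thesis by (simp add: sqn_def power2_eq_square)
qed

text \<open>By density of the test functions in \<open>H1_0\<close>; the factor 4 is lost by splitting squares of sums.\<close>

lemma poincare:
  assumes R: "\<And>x. x \<in> Om \<Longrightarrow> norm x \<le> R" and u: "u \<in> H1_0 Om"
  shows "sqn M u \<le> 16 * R\<^sup>2 * dirichlet Om u"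
proof (rule field_le_epsilon)
  fix e :: real assume e: "e > 0"
  define d where "d = e / (2 + 16 * R\<^sup>2)"
  have p: "2 + 16 * R\<^sup>2 > 0" by (simp add: add_pos_nonneg)
  then have d: "d > 0" using e by (simp add: d_def)
  obtain \<phi> where \<phi>: "\<phi> \<in> test_functions Om" "sqn M (\<lambda>x. u x - \<phi> x) < d" "dirichlet Om (\<lambda>x. u x - \<phi> x) < d"
    using H1_0_approx[OF u d] .
  have h: "u \<in> H1 Om" "\<phi> \<in> H1 Om" using u \<phi>(1) by (auto intro: H1_0_H1 test_H1)
  have 1: "sqn M u \<le> 2 * sqn M (\<lambda>x. u x - \<phi> x) + 2 * sqn M \<phi>"
    using sqn_add_le2[OF H1D(1)[OF H1_diff[OF h]] H1D(1)[OF h(2)]] by simp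
  have 2: "sqn M \<phi> \<le> 4 * R\<^sup>2 * dirichlet Om \<phi>" by (rule poincare_test[OF R \<phi>(1)])
  have "dirichlet Om \<phi> \<le> 2 * dirichlet Om u + 2 * dirichlet Om (\<lambda>x. u x - \<phi> x)"
    using sqn_diff_le2[OF H1D(3)[OF h(1)] H1D(3)[OF H1_diff[OF h]]]
    unfolding dirichlet_diff[OF h(1) H1_diff[OF h], symmetric] dirichlet_def[symmetric] by simp
  then have 3: "4 * R\<^sup>2 * dirichlet Om \<phi> \<le> 4 * R\<^sup>2 * (2 * dirichlet Om u + 2 * dirichlet Om (\<lambda>x. u x - \<phi> x))"
    by (intro mult_left_mono) auto
  have "sqn M u \<le> 2 * sqn M (\<lambda>x. u x - \<phi> x) + 16 * R\<^sup>2 * dirichlet Om (\<lambda>x. u x - \<phi> x) + 16 * R\<^sup>2 * dirichlet Om u"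
    using 1 2 3 by (simp add: algebra_simps)
  also have "2 * sqn M (\<lambda>x. u x - \<phi> x) + 16 * R\<^sup>2 * dirichlet Om (\<lambda>x. u x - \<phi> x) \<le> 2 * d + 16 * R\<^sup>2 * d"
    using \<phi> by (intro add_mono mult_left_mono) auto
  also have "2 * d + 16 * R\<^sup>2 * d = (2 + 16 * R\<^sup>2) * d" by (simp add: algebra_simps)
  also have "\<dots> = e" using p by (simp add: d_def)
  finally show "sqn M u \<le> 16 * R\<^sup>2 * dirichlet Om u + e" by simp
qed

lemma norm_bound_Om: obtains R where "\<And>x. x \<in> Om \<Longrightarrow> norm x \<le> R"
  using bd unfolding bounded_iff by blast

lemma admissible_H1: "u \<in> admissible Om u0 \<Longrightarrow> u \<in> H1 Om"
  by (simp add: admissible_def)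

lemma admissible_diff:
  assumes "u \<in> admissible Om u0" "v \<in> admissible Om u0" shows "(\<lambda>x. u x - v x) \<in> H1_0 Om"
  using H1_0_diff[of "\<lambda>x. u x - u0 x" "\<lambda>x. v x - u0 x"] assms by (simp add: admissible_def)

lemma admissible_add:
  assumes "u \<in> admissible Om u0" "\<phi> \<in> H1_0 Om" shows "(\<lambda>x. u x + c * \<phi> x) \<in> admissible Om u0"
proof -
  have "(\<lambda>x. u x - u0 x + c * \<phi> x) \<in> H1_0 Om"
    using H1_0_add_cmult[of "\<lambda>x. u x - u0 x" \<phi> c] assms by (simp add: admissible_def)
  moreover have "(\<lambda>x. u x + c * \<phi> x - u0 x) = (\<lambda>x. u x - u0 x + c * \<phi> x)" by auto
  moreover have "(\<lambda>x. u x + c * \<phi> x) \<in> H1 Om"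
    using H1_add[OF admissible_H1[OF assms(1)] H1_cmult[OF H1_0_H1[OF assms(2)]]] .
  ultimately show ?thesis by (simp add: admissible_def)
qed

lemma admissible_mid:
  assumes "u \<in> admissible Om u0" "v \<in> admissible Om u0"
  shows "(\<lambda>x. (u x + v x) / 2) \<in> admissible Om u0"
  using admissible_add[OF assms(1) admissible_diff[OF assms(2,1)], of "1/2"]
  by (simp add: field_simps)

lemma admissible_closed:
  assumes w: "\<And>k. w k \<in> admissible Om u0" and u: "u \<in> H1 Om"
    and 1: "(\<lambda>k. sqn M (\<lambda>x. u x - w k x)) \<longlonglongrightarrow> 0" and 2: "(\<lambda>k. dirichlet Om (\<lambda>x. u x - w k x)) \<longlonglongrightarrow> 0"
  shows "u \<in> admissible Om u0"
proof -
  have "(\<lambda>x. u x - w 0 x) \<in> H1_0 Om"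
  proof (rule H1_0_closed[of "\<lambda>k x. w k x - w 0 x"])
    show "(\<lambda>x. w k x - w 0 x) \<in> H1_0 Om" for k by (rule admissible_diff[OF w w])
    show "(\<lambda>x. u x - w 0 x) \<in> H1 Om" by (rule H1_diff[OF u admissible_H1[OF w]])
  qed (use 1 2 in simp_all)
  from admissible_add[OF w[of 0] this, of 1] show ?thesis by simp
qed

lemma dirichlet_perturb:
  assumes "u \<in> H1 Om" "v \<in> H1 Om" "s > 0"
  shows "dirichlet Om u \<le> (1 + s) * dirichlet Om v + (1 + 1 / s) * dirichlet Om (\<lambda>x. u x - v x)"
  using sqn_add_le[OF H1D(3)[OF assms(2)] H1D(3)[OF H1_diff[OF assms(1,2)]] assms(3)]
    dirichlet_add[OF assms(2) H1_diff[OF assms(1,2)]]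
  by (simp add: dirichlet_def[symmetric])

text \<open>Lower semicontinuity of the Dirichlet energy along fast $L^1$-Cauchy sequences.  The admissible
  functions at $L^1$-distance at most \<open>2 * c * (1/2) ^ k\<close> from \<open>u k\<close> form a decreasing sequence of convex
  sets \<open>C k\<close>.  By the parallelogram identity, functions that almost minimize the energy on these sets
  form a Cauchy sequence in $H^1$.  Its limit lies close to every \<open>u k\<close>, and its energy is the limit of
  the infima.\<close>

lemma L1_cauchy_energy_limit:
  assumes u: "\<And>k. u k \<in> admissible Om u0"
    and c: "\<And>k. (LINT x|M. \<bar>u (Suc k) x - u k x\<bar>) \<le> c * (1/2) ^ k"
    and E: "\<And>k. dirichlet Om (u k) \<le> E"
  obtains w e where "w \<in> admissible Om u0" "e \<longlonglongrightarrow> 0"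
    "\<And>k. (LINT x|M. \<bar>w x - u k x\<bar>) \<le> 2 * c * (1/2) ^ k" "\<And>k. dirichlet Om w \<le> dirichlet Om (u k) + e k"
proof -
  have i: "integrable M (\<lambda>x. v x - w x)" if "v \<in> admissible Om u0" "w \<in> admissible Om u0" for v w
    using that by (intro sqint_integrable sqint_diff H1D admissible_H1)
  have tri: "(LINT x|M. \<bar>v x - w x\<bar>) \<le> (LINT x|M. \<bar>v x - z x\<bar>) + (LINT x|M. \<bar>z x - w x\<bar>)"
    if "v \<in> admissible Om u0" "w \<in> admissible Om u0" "z \<in> admissible Om u0" for v w z
  proof -
    have "(LINT x|M. \<bar>v x - w x\<bar>) \<le> (LINT x|M. \<bar>v x - z x\<bar> + \<bar>z x - w x\<bar>)"
      using i that by (intro integral_mono) auto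
    then show ?thesis using i that by simp
  qed
  have c0: "c \<ge> 0"
  proof -
    have "0 \<le> (LINT x|M. \<bar>u (Suc 0) x - u 0 x\<bar>)" by (rule integral_nonneg_AE) simp
    also have "\<dots> \<le> c" using c[of 0] by simp
    finally show ?thesis .
  qed
  define C where "C = (\<lambda>k. {w \<in> admissible Om u0. (LINT x|M. \<bar>w x - u k x\<bar>) \<le> 2 * c * (1/2) ^ k})"
  have uC: "u k \<in> C k" for k using u c0 by (simp add: C_def)
  \<comment> \<open>The radii are chosen so that the triangle inequality gives exactly this inclusion.\<close>
  have sub: "C (Suc k) \<subseteq> C k" for k
  proof
    fix w assume w: "w \<in> C (Suc k)"
    then have "(LINT x|M. \<bar>w x - u k x\<bar>) \<le> (LINT x|M. \<bar>w x - u (Suc k) x\<bar>) + (LINT x|M. \<bar>u (Suc k) x - u k x\<bar>)"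
      using u by (intro tri) (auto simp: C_def)
    then show "w \<in> C k" using w c[of k] by (simp add: C_def)
  qed
  have dec: "C j \<subseteq> C k" if "k \<le> j" for j k
    using that by (induction rule: dec_induct) (use sub in blast)+
  have mid: "(\<lambda>x. (v x + w x) / 2) \<in> C k" if "v \<in> C k" "w \<in> C k" for v w k
  proof -
    have a: "v \<in> admissible Om u0" "w \<in> admissible Om u0" using that by (auto simp: C_def)
    have "(LINT x|M. \<bar>(v x + w x) / 2 - u k x\<bar>) \<le> (LINT x|M. \<bar>v x - u k x\<bar> / 2 + \<bar>w x - u k x\<bar> / 2)"
    proof (rule integral_mono)
      show "integrable M (\<lambda>x. \<bar>(v x + w x) / 2 - u k x\<bar>)"
        using i[OF admissible_mid[OF a] u[of k]] by (rule integrable_abs)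
      show "integrable M (\<lambda>x. \<bar>v x - u k x\<bar> / 2 + \<bar>w x - u k x\<bar> / 2)"
        using i[OF a(1) u[of k]] i[OF a(2) u[of k]] by simp
      show "\<bar>(v x + w x) / 2 - u k x\<bar> \<le> \<bar>v x - u k x\<bar> / 2 + \<bar>w x - u k x\<bar> / 2" for x
        using abs_triangle_ineq[of "(v x - u k x) / 2" "(w x - u k x) / 2"] by (simp add: field_simps)
    qed
    also have "\<dots> = (LINT x|M. \<bar>v x - u k x\<bar>) / 2 + (LINT x|M. \<bar>w x - u k x\<bar>) / 2"
      using i[OF a(1) u[of k]] i[OF a(2) u[of k]] by simp
    finally show ?thesis using that admissible_mid[OF a] by (simp add: C_def)
  qed
  define d where "d = (\<lambda>k. Inf (dirichlet Om ` C k))"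
  have bb: "bdd_below (dirichlet Om ` C k)" for k
    by (rule bdd_belowI[of _ 0]) (auto simp: dirichlet_nonneg)
  have dle: "d k \<le> dirichlet Om v" if "v \<in> C k" for v k
    unfolding d_def using that bb by (intro cInf_lower) auto
  have dinc: "d k \<le> d j" if "k \<le> j" for j k
    unfolding d_def using uC dec[OF that] bb by (intro cInf_superset_mono) auto
  have dE: "d k \<le> E" for k using dle[OF uC] E order_trans by blast
  obtain D where D: "d \<longlonglongrightarrow> D" "\<And>k. d k \<le> D"
    using incseq_convergent[of d E] dinc dE by (auto simp: incseq_def)
  have "\<exists>w\<in>C k. dirichlet Om w < d k + 1 / real (Suc k)" for k
  proof -
    have "\<exists>y\<in>dirichlet Om ` C k. y < d k + 1 / real (Suc k)"
      unfolding d_def using uC bb by (subst cInf_less_iff[symmetric]) auto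
    then show ?thesis by blast
  qed
  then obtain w where w: "\<And>k. w k \<in> C k" "\<And>k. dirichlet Om (w k) < d k + 1 / real (Suc k)" by metis
  have wa: "w k \<in> admissible Om u0" for k using w(1) by (auto simp: C_def)
  define s where "s = (\<lambda>k. 4 * (D - d k) + 4 / real (Suc k))"
  have s0: "s \<longlonglongrightarrow> 0"
  proof -
    have "s \<longlonglongrightarrow> 4 * (D - D) + 0"
      unfolding s_def by (intro tendsto_intros D LIMSEQ_Suc[OF lim_const_over_n])
    then show ?thesis by simp
  qed
  \<comment> \<open>The midpoint of \<open>w k\<close> and \<open>w j\<close> stays in \<open>C k\<close>, so its energy is at least \<open>d k\<close>.\<close>
  have cau: "dirichlet Om (\<lambda>x. w k x - w j x) \<le> s k" if "k \<le> j" for k j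
  proof -
    have "(\<lambda>x. (w k x + w j x) / 2) \<in> C k" using mid w(1) dec[OF that] by blast
    then have "d k \<le> dirichlet Om (\<lambda>x. (w k x + w j x) / 2)" by (rule dle)
    moreover have "1 / real (Suc j) \<le> 1 / real (Suc k)" using that by (simp add: frac_le)
    ultimately show ?thesis
      using dirichlet_parallelogram[OF admissible_H1[OF wa[of k]] admissible_H1[OF wa[of j]]] w(2)[of k] w(2)[of j]
        D(2)[of j] D(2)[of k]
      by (simp add: s_def)
  qed
  obtain R where R: "\<And>x. x \<in> Om \<Longrightarrow> norm x \<le> R" using norm_bound_Om by blast
  define A where "A = 1 + 16 * R\<^sup>2"
  have A: "A \<ge> 1" by (simp add: A_def)
  have cau2: "sqn M (\<lambda>x. w k x - w j x) \<le> A * s k \<and> dirichlet Om (\<lambda>x. w k x - w j x) \<le> A * s k" if "k \<le> j" for k j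
  proof -
    let ?D = "dirichlet Om (\<lambda>x. w k x - w j x)"
    have "sqn M (\<lambda>x. w k x - w j x) \<le> 16 * R\<^sup>2 * ?D"
      by (rule poincare[OF R admissible_diff[OF wa wa]])
    also have "\<dots> \<le> A * ?D" unfolding A_def by (intro mult_right_mono) (auto simp: dirichlet_nonneg)
    also have "\<dots> \<le> A * s k" using cau[OF that] A by (intro mult_left_mono) auto
    finally have 1: "sqn M (\<lambda>x. w k x - w j x) \<le> A * s k" .
    have "?D \<le> A * ?D" using A dirichlet_nonneg mult_right_mono[of 1 A ?D] by simp
    also have "\<dots> \<le> A * s k" using cau[OF that] A by (intro mult_left_mono) auto
    finally show ?thesis using 1 by simp
  qed
  have As: "(\<lambda>k. A * s k) \<longlonglongrightarrow> 0" using tendsto_mult_left[OF s0, of A] by simp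
  have sym: "dirichlet Om (\<lambda>x. w k x - w j x) = dirichlet Om (\<lambda>x. w j x - w k x)" for k j
    using dirichlet_cmult[OF H1_diff[OF admissible_H1[OF wa[of j]] admissible_H1[OF wa[of k]]], of "-1"] by simp
  obtain v where v: "v \<in> H1 Om" "(\<lambda>k. sqn M (\<lambda>x. v x - w k x)) \<longlonglongrightarrow> 0"
    "(\<lambda>k. dirichlet Om (\<lambda>x. v x - w k x)) \<longlonglongrightarrow> 0"
  proof (rule H1_complete[of w])
    show "w k \<in> H1 Om" for k by (rule admissible_H1[OF wa])
    fix e :: real assume "e > 0"
    then obtain N where N: "\<And>n. n \<ge> N \<Longrightarrow> A * s n < e"
      using order_tendstoD(2)[OF As] by (auto simp: eventually_sequentially)
    have "sqn M (\<lambda>x. w m x - w n x) \<le> e \<and> dirichlet Om (\<lambda>x. w m x - w n x) \<le> e" if "m \<ge> N" "n \<ge> N" for m n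
    proof (cases "m \<le> n")
      case True
      then show ?thesis using cau2[OF True] N[OF that(1)] by linarith
    next
      case False
      then have "n \<le> m" by simp
      then show ?thesis using cau2[OF \<open>n \<le> m\<close>] N[OF that(2)]
        sqn_minus_commute[of M "w n" "w m"] sym[of n m] by linarith
    qed
    then show "\<exists>N. \<forall>m\<ge>N. \<forall>n\<ge>N. sqn M (\<lambda>x. w m x - w n x) \<le> e \<and> dirichlet Om (\<lambda>x. w m x - w n x) \<le> e"
      by blast
  qed blast
  have va: "v \<in> admissible Om u0" by (rule admissible_closed[OF wa v])
  have "(LINT x|M. \<bar>v x - u k x\<bar>) \<le> 2 * c * (1/2) ^ k" for k
  proof -
    have l: "(\<lambda>j. (LINT x|M. norm (v x - w j x)) + 2 * c * (1/2) ^ k) \<longlonglongrightarrow> 0 + 2 * c * (1/2) ^ k"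
      by (intro tendsto_intros L1_tendsto_of_sqn v sqint_diff H1D admissible_H1[OF wa])
    have "(LINT x|M. \<bar>v x - u k x\<bar>) \<le> (LINT x|M. norm (v x - w j x)) + 2 * c * (1/2) ^ k" if "j \<ge> k" for j
    proof -
      have "w j \<in> C k" using w(1) dec[OF that] by blast
      then have "(LINT x|M. \<bar>w j x - u k x\<bar>) \<le> 2 * c * (1/2) ^ k" by (simp add: C_def)
      then show ?thesis using tri[OF va u[of k] wa[of j]] by simp
    qed
    then show ?thesis
      using LIMSEQ_le_const[OF l] by (metis add_0)
  qed
  moreover have "dirichlet Om v \<le> D"
  proof (rule field_le_epsilon)
    fix e :: real assume e: "e > 0"
    have "0 \<le> d 0" unfolding d_def using uC[of 0] by (intro cInf_greatest) (auto simp: dirichlet_nonneg)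
    then have D0: "D \<ge> 0" using D(2)[of 0] by linarith
    define t where "t = e / (D + 1)"
    have t: "t > 0" using e D0 by (simp add: t_def)
    have lt: "t * D \<le> e" using e D0 by (simp add: t_def field_simps)
    have "(\<lambda>k. (1 + t) * (d k + 1 / real (Suc k)) + (1 + 1 / t) * dirichlet Om (\<lambda>x. v x - w k x))
        \<longlonglongrightarrow> (1 + t) * (D + 0) + (1 + 1 / t) * 0"
      by (intro tendsto_intros D v LIMSEQ_Suc[OF lim_const_over_n])
    moreover have "dirichlet Om v \<le> (1 + t) * (d k + 1 / real (Suc k)) + (1 + 1 / t) * dirichlet Om (\<lambda>x. v x - w k x)" for k
    proof -
      have "(1 + t) * dirichlet Om (w k) \<le> (1 + t) * (d k + 1 / real (Suc k))"
        using w(2)[of k] t by (intro mult_left_mono) auto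
      then show ?thesis using dirichlet_perturb[OF v(1) admissible_H1[OF wa[of k]] t] by linarith
    qed
    ultimately have "dirichlet Om v \<le> (1 + t) * (D + 0) + (1 + 1 / t) * 0"
      by (intro LIMSEQ_le_const) auto
    then show "dirichlet Om v \<le> D + e" using lt by (simp add: algebra_simps)
  qed
  then have "dirichlet Om v \<le> dirichlet Om (u k) + (D - d k)" for k
    using dle[OF uC[of k]] by linarith
  moreover have "(\<lambda>k. D - d k) \<longlonglongrightarrow> D - D" by (intro tendsto_intros D)
  ultimately show thesis using that[OF va, of "\<lambda>k. D - d k"] by simp
qed

end

section \<open>A smooth variational principle\<close>

text \<open>The iteration behind the Borwein--Preiss variational principle.  Each point almost minimizes the
  functional perturbed by the penalties centred at all previous points, with a tolerance \<open>\<tau> ^ 3 / 8 ^ k\<close> that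
  is much smaller than the weight \<open>\<tau> / 2 ^ k\<close> of the next penalty.  As the perturbed values do not increase, the
  penalty between consecutive points is at most the quotient of the two.\<close>

lemma smooth_variational_iteration:
  fixes E :: "'x \<Rightarrow> real" and P :: "'x \<Rightarrow> 'x \<Rightarrow> real"
  assumes x0: "x0 \<in> X" and lower: "\<And>w. w \<in> X \<Longrightarrow> E x0 \<le> E w + \<tau> ^ 3" and \<tau>: "\<tau> > 0"
    and P0: "\<And>v w. v \<in> X \<Longrightarrow> w \<in> X \<Longrightarrow> P v w \<ge> 0" and Pd: "\<And>w. w \<in> X \<Longrightarrow> P w w = 0"
  obtains x where "x 0 = x0" "\<And>k. x k \<in> X" "\<And>k. P (x (Suc k)) (x k) \<le> \<tau>\<^sup>2 * (1/4) ^ k"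
    "\<And>k. E (x k) \<le> E x0"
    "\<And>k w. w \<in> X \<Longrightarrow> E (x k) + (\<Sum>j<k. \<tau> * (1/2) ^ j * P (x k) (x j))
        \<le> E w + (\<Sum>j<k. \<tau> * (1/2) ^ j * P w (x j)) + \<tau> ^ 3 * (1/8) ^ k"
proof -
  \<comment> \<open>The state of the recursion is the current functional together with the current point.\<close>
  define good where "good = (\<lambda>k (F, x). x \<in> X \<and> (\<forall>w\<in>X. F x \<le> F w + \<tau> ^ 3 * (1/8) ^ k) \<and>
     (\<forall>w\<in>X. E w \<le> F w) \<and> F x \<le> E x0 \<and> (k = 0 \<longrightarrow> x = x0 \<and> F = E))"
  define succ where "succ = (\<lambda>k (F, x :: 'x) (F', x'). F' = (\<lambda>w. F w + \<tau> * (1/2) ^ k * P w x) \<and> F' x' \<le> F x)"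
  have "\<exists>s. \<forall>k. good k (s k) \<and> succ k (s k) (s (Suc k))"
  proof (rule dependent_nat_choice)
    show "\<exists>s. good 0 s" using x0 lower by (auto simp: good_def)
    fix s k assume g: "good k s"
    obtain F x where s: "s = (F, x)" by (cases s)
    define F' where "F' = (\<lambda>w. F w + \<tau> * (1/2) ^ k * P w x)"
    have x: "x \<in> X" "\<And>w. w \<in> X \<Longrightarrow> F x \<le> F w + \<tau> ^ 3 * (1/8) ^ k" "\<And>w. w \<in> X \<Longrightarrow> E w \<le> F w" "F x \<le> E x0"
      using g by (auto simp: good_def s)
    have pp: "0 \<le> \<tau> * (1/2) ^ k * P w x" if "w \<in> X" for w
      using \<tau> P0[OF that x(1)] by simp
    have F'x: "F' x = F x" using Pd[OF x(1)] by (simp add: F'_def)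
    define I where "I = Inf (F' ` X)"
    have bb: "bdd_below (F' ` X)"
      by (rule bdd_belowI[of _ "F x - \<tau> ^ 3 * (1/8) ^ k"]) (use x(2) pp in \<open>force simp: F'_def\<close>)
    have I: "I \<le> F' w" if "w \<in> X" for w unfolding I_def using that bb by (intro cInf_lower) auto
    have "Inf (F' ` X) < I + \<tau> ^ 3 * (1/8) ^ Suc k" using \<tau> by (simp add: I_def)
    then have "\<exists>z\<in>F' ` X. z < I + \<tau> ^ 3 * (1/8) ^ Suc k"
      using x(1) bb by (subst (asm) cInf_less_iff) auto
    then obtain y where y: "y \<in> X" "F' y < I + \<tau> ^ 3 * (1/8) ^ Suc k" by blast
    define x' where "x' = (if F' y \<le> F' x then y else x)"
    have x': "x' \<in> X" "F' x' \<le> F' x" "F' x' < I + \<tau> ^ 3 * (1/8) ^ Suc k"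
      using x(1) y by (auto simp: x'_def)
    have "good (Suc k) (F', x')"
      unfolding good_def using x' x I pp F'x by (force simp: F'_def)
    moreover have "F' x' \<le> F x" using x'(2) F'x by linarith
    then have "succ k s (F', x')" using F'_def by (simp only: succ_def s prod.case)
    ultimately show "\<exists>t. good (Suc k) t \<and> succ k s t" by blast
  qed
  then obtain s where s: "\<And>k. good k (s k)" "\<And>k. succ k (s k) (s (Suc k))" by blast
  define F where "F = (\<lambda>k. fst (s k))"
  define x where "x = (\<lambda>k. snd (s k))"
  have g: "x k \<in> X" "w \<in> X \<Longrightarrow> F k (x k) \<le> F k w + \<tau> ^ 3 * (1/8) ^ k"
    "w \<in> X \<Longrightarrow> E w \<le> F k w" "F k (x k) \<le> E x0" for k w
    using s(1)[of k] by (auto simp: good_def F_def x_def split: prod.splits)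
  have z: "x 0 = x0" "F 0 = E" using s(1)[of 0] by (auto simp: good_def F_def x_def split: prod.splits)
  have st: "F (Suc k) = (\<lambda>w. F k w + \<tau> * (1/2) ^ k * P w (x k))" "F (Suc k) (x (Suc k)) \<le> F k (x k)" for k
    using s(2)[of k] by (auto simp: succ_def F_def x_def split: prod.splits)
  have FE: "F k w = E w + (\<Sum>j<k. \<tau> * (1/2) ^ j * P w (x j))" for k w
    by (induction k) (auto simp: z st)
  show thesis
  proof
    show "x 0 = x0" "\<And>k. x k \<in> X" by (rule z, rule g)
    show "E (x k) \<le> E x0" for k using g(3)[OF g(1)[of k], of k] g(4)[of k] by linarith
    show "E (x k) + (\<Sum>j<k. \<tau> * (1/2) ^ j * P (x k) (x j))
        \<le> E w + (\<Sum>j<k. \<tau> * (1/2) ^ j * P w (x j)) + \<tau> ^ 3 * (1/8) ^ k" if "w \<in> X" for k w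
      using g(2)[OF that, of k] unfolding FE .
    fix k
    have "\<tau> * (1/2) ^ k * P (x (Suc k)) (x k) \<le> \<tau> ^ 3 * (1/8) ^ k"
      using st(2)[of k] g(2)[OF g(1)[of "Suc k"], of k] by (simp add: st(1))
    also have "\<dots> = \<tau> * (1/2) ^ k * (\<tau>\<^sup>2 * (1/4) ^ k)"
      by (simp add: power_mult_distrib[symmetric] power3_eq_cube power2_eq_square)
    finally show "P (x (Suc k)) (x k) \<le> \<tau>\<^sup>2 * (1/4) ^ k" using \<tau> by simp
  qed
qed

text \<open>A convex and differentiable substitute for the absolute value: 1-Lipschitz, with derivative \<open>pen'\<close>
  bounded by 1 and second derivative at most 1.\<close>

definition pen :: "real \<Rightarrow> real" where "pen t = sqrt (1 + t\<^sup>2) - 1"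
definition pen' :: "real \<Rightarrow> real" where "pen' t = t / sqrt (1 + t\<^sup>2)"

lemma sqrt_one_plus_ge: "1 \<le> sqrt (1 + t\<^sup>2)" "\<bar>t\<bar> \<le> sqrt (1 + t\<^sup>2)"
  by (auto intro: real_le_rsqrt)

lemma sqrt_one_plus_sq: "sqrt (1 + t\<^sup>2) * sqrt (1 + t\<^sup>2) = 1 + (t::real)\<^sup>2" by simp

lemma pen_nonneg: "0 \<le> pen t" using sqrt_one_plus_ge[of t] by (simp add: pen_def)
lemma pen_0: "pen 0 = 0" by (simp add: pen_def)

lemma pen'_bound: "\<bar>pen' t\<bar> \<le> 1"
proof -
  have "\<bar>t / X\<bar> \<le> 1" if "1 \<le> X" "\<bar>t\<bar> \<le> X" for X
    using that by (simp add: abs_divide divide_le_eq_1)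
  then show ?thesis unfolding pen'_def using sqrt_one_plus_ge[of t] by blast
qed

lemma pen_taylor: "pen (a + s) \<le> pen a + pen' a * s + s\<^sup>2 / 2"
proof -
  define X where "X = sqrt (1 + a\<^sup>2)"
  define Y where "Y = sqrt (1 + (a + s)\<^sup>2)"
  have X: "X \<ge> 1" using sqrt_one_plus_ge by (simp add: X_def)
  have "Y * Y = X * X + 2 * a * s + s\<^sup>2"
    unfolding X_def Y_def sqrt_one_plus_sq by (simp add: power2_eq_square algebra_simps)
  moreover have "0 \<le> (Y - X)\<^sup>2" by simp
  ultimately have "2 * X * Y \<le> 2 * X * X + 2 * a * s + s\<^sup>2"
    by (simp add: power2_eq_square algebra_simps)
  then have "Y \<le> (2 * X * X + 2 * a * s + s\<^sup>2) / (2 * X)"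
    using X by (simp add: pos_le_divide_eq mult_ac)
  also have "\<dots> = X + a * s / X + s\<^sup>2 / (2 * X)" using X by (simp add: field_simps)
  finally have "Y \<le> X + a * s / X + s\<^sup>2 / (2 * X)" .
  moreover have "s\<^sup>2 / (2 * X) \<le> s\<^sup>2 / 2" using X by (intro divide_left_mono) auto
  ultimately show ?thesis by (simp add: pen_def pen'_def X_def Y_def)
qed

lemma pen_lipschitz: "\<bar>pen a - pen b\<bar> \<le> \<bar>a - b\<bar>"
proof -
  have "pen a - pen b \<le> \<bar>a - b\<bar>" for a b
  proof -
    have "sqrt (1 + a\<^sup>2) \<le> sqrt (1 + b\<^sup>2) + \<bar>a - b\<bar>"
    proof (rule real_le_lsqrt)
      have "b * (a - b) \<le> \<bar>b\<bar> * \<bar>a - b\<bar>" using abs_ge_self[of "b * (a - b)"] by (simp add: abs_mult)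
      also have "\<dots> \<le> sqrt (1 + b\<^sup>2) * \<bar>a - b\<bar>" by (intro mult_right_mono sqrt_one_plus_ge(2)) simp
      finally have "b * (a - b) \<le> sqrt (1 + b\<^sup>2) * \<bar>a - b\<bar>" .
      then show "1 + a\<^sup>2 \<le> (sqrt (1 + b\<^sup>2) + \<bar>a - b\<bar>)\<^sup>2"
        by (simp add: power2_sum power2_eq_square algebra_simps)
    qed (use sqrt_one_plus_ge[of b] in auto)
    then show ?thesis by (simp add: pen_def)
  qed
  from this[of a b] this[of b a] show ?thesis by (simp add: abs_le_iff abs_minus_commute)
qed

text \<open>For small \<open>t\<close> the penalty is only quadratic, so the absolute value is controlled up to an error \<open>s\<close>.\<close>

lemma abs_le_pen: assumes "s > 0" shows "\<bar>t\<bar> \<le> s + (1 + 2 / s) * pen t"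
proof (cases "\<bar>t\<bar> \<le> s")
  case True
  then show ?thesis using assms pen_nonneg[of t] by (simp add: add_increasing2)
next
  case False
  define p where "p = pen t"
  have "sqrt (1 + t\<^sup>2) \<le> 1 + \<bar>t\<bar>" by (rule real_le_lsqrt) (auto simp: power2_eq_square algebra_simps)
  then have p: "p \<le> \<bar>t\<bar>" "0 \<le> p" using pen_nonneg by (auto simp: p_def pen_def)
  have "\<bar>t\<bar> * \<bar>t\<bar> = p * (p + 2)"
    using sqrt_one_plus_sq[of t] by (simp add: p_def pen_def algebra_simps power2_eq_square)
  also have "\<dots> \<le> p * (\<bar>t\<bar> + 2)" using p by (intro mult_left_mono) auto
  finally have "\<bar>t\<bar> \<le> p * (1 + 2 / \<bar>t\<bar>)" using False assms by (simp add: field_simps)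
  also have "\<dots> \<le> p * (1 + 2 / s)" using False assms p by (intro mult_left_mono add_mono divide_left_mono) auto
  finally show ?thesis using assms by (simp add: p_def mult.commute)
qed

lemma pen_continuous: "continuous_on A pen" "continuous_on A pen'"
  unfolding pen_def pen'_def by (auto intro!: continuous_intros simp: add_nonneg_eq_0_iff)

lemma pen_measurable [measurable]: "pen \<in> borel_measurable borel" "pen' \<in> borel_measurable borel"
  by (auto intro: borel_measurable_continuous_onI pen_continuous)

context bounded_open begin

text \<open>Every almost minimizer of an energy with a Lipschitz lower order term is close to a solution of the
  Euler--Lagrange equation with a uniformly small right-hand side.  The points of the variational iteration
  are Cauchy in $L^1$ with bounded Dirichlet energy; their limit \<open>u\<close> minimizes the energy plus the sum of
  all penalties.  The penalties are smooth, so the first variation at \<open>u\<close> in the direction of a test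
  function exists, and their contribution is the integral against \<open>f\<close>.\<close>

lemma almost_minimizer_near_solution:
  fixes G g :: "real \<Rightarrow> real"
  defines "E \<equiv> \<lambda>w. dirichlet Om w / 2 - (LINT x|M. G (w x))"
  assumes G: "\<And>t. (G has_real_derivative g t) (at t)" and gL: "\<And>t. \<bar>g t\<bar> \<le> L"
    and v: "v \<in> admissible Om u0" and \<tau>: "0 < \<tau>" "\<tau> \<le> 1"
    and min: "\<And>w. w \<in> admissible Om u0 \<Longrightarrow> E v \<le> E w + \<tau> ^ 3"
  obtains u f where "u \<in> admissible Om u0" "f \<in> borel_measurable M" "\<And>x. \<bar>f x\<bar> \<le> 2 * \<tau>"
    "(LINT x|M. \<bar>u x - v x\<bar>) \<le> 2 * \<tau> * (measure M Om + 3)"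
    "E u \<le> E v + 2 * \<tau> * (LINT x|M. \<bar>u x - v x\<bar>)"
    "\<And>\<phi>. \<phi> \<in> test_functions Om \<Longrightarrow>
       (LINT x|M. wgrad Om u x \<bullet> grad \<phi> x) + (LINT x|M. f x * \<phi> x) = (LINT x|M. g (u x) * \<phi> x)"
proof -
  define K where "K = admissible Om u0"
  define V where "V = measure M Om"
  define d where "d = (\<lambda>v w. LINT x|M. \<bar>v x - w x :: real\<bar>)"
  define P where "P = (\<lambda>v w. LINT x|M. pen (v x - w x))"
  have G_lip: "\<bar>G a - G b\<bar> \<le> L * \<bar>a - b\<bar>" for a b
    using field_differentiable_bound[of UNIV G g L a b] G gL by auto
  have L0: "L \<ge> 0" using gL[of 0] by linarith
  have G_meas [measurable]: "G \<in> borel_measurable borel"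
    by (intro borel_measurable_continuous_onI continuous_at_imp_continuous_on) (use G DERIV_isCont in blast)
  have si: "integrable M w" if "w \<in> K" for w
    using that by (auto simp: K_def intro!: sqint_integrable H1D admissible_H1)
  have meas: "w \<in> borel_measurable M" if "w \<in> K" for w using si[OF that] by auto
  have di: "integrable M (\<lambda>x. \<bar>v x - w x\<bar>)" if "v \<in> K" "w \<in> K" for v w
    using si[OF that(1)] si[OF that(2)] by auto
  have Gi: "integrable M (\<lambda>x. G (w x))" if w: "integrable M w" for w
  proof (rule Bochner_Integration.integrable_bound[where f="\<lambda>x. \<bar>G 0\<bar> + L * \<bar>w x\<bar>"])
    show "integrable M (\<lambda>x. \<bar>G 0\<bar> + L * \<bar>w x\<bar>)" using w by auto
    show "(\<lambda>x. G (w x)) \<in> borel_measurable M" using w by measurable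
    have G1: "\<bar>G (w x)\<bar> \<le> \<bar>G 0\<bar> + L * \<bar>w x\<bar>" for x using G_lip[of "w x" 0] by simp
    show "AE x in M. norm (G (w x)) \<le> norm (\<bar>G 0\<bar> + L * \<bar>w x\<bar>)"
      unfolding real_norm_def by (intro AE_I2 order_trans[OF G1 abs_ge_self])
  qed
  have d0: "d v w \<ge> 0" for v w unfolding d_def by (rule integral_nonneg_AE) simp
  have d_sym: "d v w = d w v" for v w by (simp add: d_def abs_minus_commute)
  have tri: "d v w \<le> d v z + d z w" if "v \<in> K" "w \<in> K" "z \<in> K" for v w z
  proof -
    have "d v w \<le> (LINT x|M. \<bar>v x - z x\<bar> + \<bar>z x - w x\<bar>)"
      unfolding d_def using di that by (intro integral_mono) auto
    then show ?thesis using di that by (simp add: d_def)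
  qed
  have Gd: "\<bar>(LINT x|M. G (v x)) - (LINT x|M. G (w x))\<bar> \<le> L * d v w" if "v \<in> K" "w \<in> K" for v w
  proof -
    have "\<bar>(LINT x|M. G (v x)) - (LINT x|M. G (w x))\<bar> = \<bar>LINT x|M. G (v x) - G (w x)\<bar>"
      using that by (simp add: Gi si)
    also have "\<dots> \<le> (LINT x|M. \<bar>G (v x) - G (w x)\<bar>)" by (rule integral_abs_bound)
    also have "\<dots> \<le> (LINT x|M. L * \<bar>v x - w x\<bar>)"
      using Gi[OF si[OF that(1)]] Gi[OF si[OF that(2)]] di[OF that] G_lip by (intro integral_mono) auto
    finally show ?thesis by (simp add: d_def)
  qed
  have Pi: "integrable M (\<lambda>x. pen (v x - w x))" if "v \<in> K" "w \<in> K" for v w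
  proof (rule Bochner_Integration.integrable_bound[OF di[OF that]])
    show "(\<lambda>x. pen (v x - w x)) \<in> borel_measurable M" using meas[OF that(1)] meas[OF that(2)] by measurable
    show "AE x in M. norm (pen (v x - w x)) \<le> norm \<bar>v x - w x\<bar>"
      using pen_lipschitz[of _ 0] by (intro AE_I2) (simp add: pen_0)
  qed
  have Pd: "\<bar>P v z - P w z\<bar> \<le> d v w" if "v \<in> K" "w \<in> K" "z \<in> K" for v w z
  proof -
    have "\<bar>P v z - P w z\<bar> = \<bar>LINT x|M. pen (v x - z x) - pen (w x - z x)\<bar>"
      unfolding P_def using that by (simp add: Pi)
    also have "\<dots> \<le> (LINT x|M. \<bar>pen (v x - z x) - pen (w x - z x)\<bar>)" by (rule integral_abs_bound)
    also have "\<dots> \<le> (LINT x|M. \<bar>v x - w x\<bar>)"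
    proof (rule integral_mono)
      show "\<bar>pen (v x - z x) - pen (w x - z x)\<bar> \<le> \<bar>v x - w x\<bar>" for x
        using pen_lipschitz[of "v x - z x" "w x - z x"] by simp
    qed (use that Pi di in auto)
    finally show ?thesis by (simp add: d_def)
  qed
  obtain x where x: "x 0 = v" "\<And>k. x k \<in> K" "\<And>k. P (x (Suc k)) (x k) \<le> \<tau>\<^sup>2 * (1/4) ^ k"
    "\<And>k. E (x k) \<le> E v"
    "\<And>k w. w \<in> K \<Longrightarrow> E (x k) + (\<Sum>j<k. \<tau> * (1/2) ^ j * P (x k) (x j))
        \<le> E w + (\<Sum>j<k. \<tau> * (1/2) ^ j * P w (x j)) + \<tau> ^ 3 * (1/8) ^ k"
  proof (rule smooth_variational_iteration[of v K E \<tau> P])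
    show "P v w \<ge> 0" for v w unfolding P_def by (rule integral_nonneg_AE) (simp add: pen_nonneg)
    show "P w w = 0" for w by (simp add: P_def pen_0)
  qed (use v \<tau> min in \<open>auto simp: K_def\<close>)
  define c where "c = \<tau> * (V + 3)"
  have V0: "V \<ge> 0" by (simp add: V_def)
  have step: "d (x (Suc k)) (x k) \<le> c * (1/2) ^ k" for k
  proof -
    \<comment> \<open>With this \<open>s\<close> the penalty of the step is at most the square of \<open>s\<close>, which balances the two terms of \<open>abs_le_pen\<close>.\<close>
    define s where "s = \<tau> * (1/2) ^ k"
    have s: "s > 0" "s \<le> 1" using \<tau> by (auto simp: s_def intro!: mult_le_one power_le_one)
    have "d (x (Suc k)) (x k) \<le> (LINT y|M. s + (1 + 2 / s) * pen (x (Suc k) y - x k y))"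
      unfolding d_def using di[OF x(2) x(2)] Pi[OF x(2) x(2)] abs_le_pen[OF s(1)]
      by (intro integral_mono) auto
    also have "\<dots> = s * V + (1 + 2 / s) * P (x (Suc k)) (x k)"
      using Pi[OF x(2) x(2)] by (simp add: P_def V_def)
    finally have 1: "d (x (Suc k)) (x k) \<le> s * V + (1 + 2 / s) * P (x (Suc k)) (x k)" .
    have "P (x (Suc k)) (x k) \<le> s\<^sup>2"
    proof -
      have "(1/4 :: real) ^ k = (1/2) ^ k * (1/2) ^ k" by (simp add: power_mult_distrib[symmetric])
      then show ?thesis using x(3)[of k] by (simp add: s_def power2_eq_square mult_ac)
    qed
    then have "(1 + 2 / s) * P (x (Suc k)) (x k) \<le> (1 + 2 / s) * s\<^sup>2"
      using s by (intro mult_left_mono) auto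
    also have "\<dots> = s * s + 2 * s"
      using s by (simp add: power2_eq_square field_simps)
    finally have "d (x (Suc k)) (x k) \<le> s * V + s * s + 2 * s" using 1 by linarith
    also have "\<dots> \<le> s * V + s * 1 + 2 * s" using s by (intro add_mono mult_left_mono) auto
    finally show ?thesis using s by (simp add: c_def s_def algebra_simps)
  qed
  have dk: "d (x k) v \<le> 2 * c" for k
  proof -
    have "d (x k) v \<le> 2 * c - 2 * c * (1/2) ^ k"
    proof (induction k)
      case 0
      then show ?case by (simp add: x d_def)
    next
      case (Suc k)
      then show ?case
        using tri[OF x(2)[of "Suc k"] v[folded K_def] x(2)[of k]] step[of k] by simp
    qed
    moreover have "0 \<le> c" using \<tau> V0 by (simp add: c_def)
    ultimately show ?thesis by (smt (verit) mult_nonneg_nonneg zero_le_power divide_nonneg_nonneg)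
  qed
  have bound: "dirichlet Om (x k) \<le> 2 * (E v + (LINT y|M. G (v y)) + L * (2 * c))" for k
  proof -
    have "dirichlet Om (x k) = 2 * (E (x k) + (LINT y|M. G (x k y)))" by (simp add: E_def)
    moreover have "(LINT y|M. G (x k y)) \<le> (LINT y|M. G (v y)) + L * d (x k) v"
      using Gd[OF x(2)[of k] v[folded K_def]] by linarith
    moreover have "L * d (x k) v \<le> L * (2 * c)" using dk L0 by (intro mult_left_mono) auto
    moreover have "D \<le> 2 * (e' + g' + m)" if "D = 2 * (e + g)" "g \<le> g' + l" "l \<le> m" "e \<le> e'"
      for D e g g' l m e' :: real using that by (simp add: distrib_left)
    ultimately show ?thesis using x(4)[of k] by blast
  qed
  obtain u e where u: "u \<in> K" and e: "e \<longlonglongrightarrow> 0" and du: "\<And>k. d u (x k) \<le> 2 * c * (1/2) ^ k"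
    and Du: "\<And>k. dirichlet Om u \<le> dirichlet Om (x k) + e k"
    using L1_cauchy_energy_limit[OF x(2)[unfolded K_def] step[unfolded d_def] bound]
    unfolding K_def d_def by metis
  define \<mu> where "\<mu> = (\<lambda>j. \<tau> * (1/2 :: real) ^ j)"
  have \<mu>: "\<mu> j > 0" "summable \<mu>" "suminf \<mu> = 2 * \<tau>" for j
    using \<tau> by (auto simp: \<mu>_def suminf_mult suminf_geometric intro!: summable_mult summable_geometric)
  have sumP: "summable (\<lambda>j. \<mu> j * (P w (x j) - P u (x j)))" if w: "w \<in> K" for w
  proof (rule summable_comparison_test'[of "\<lambda>j. d w u * \<mu> j"])
    show "summable (\<lambda>j. d w u * \<mu> j)" using \<mu> by (intro summable_mult)
    show "norm (\<mu> j * (P w (x j) - P u (x j))) \<le> d w u * \<mu> j" for j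
      using Pd[OF w u x(2)[of j]] \<mu>(1)[of j] by (simp add: abs_mult mult.commute mult_right_mono)
  qed
  have Emin: "E u \<le> E w + (\<Sum>j. \<mu> j * (P w (x j) - P u (x j)))" if w: "w \<in> K" for w
  proof -
    let ?r = "\<lambda>k. 2 * \<tau> * (2 * c * (1/2) ^ k) + \<tau> ^ 3 * (1/8) ^ k + e k / 2 + L * (2 * c * (1/2) ^ k)"
    have "E u \<le> E w + (\<Sum>j<k. \<mu> j * (P w (x j) - P u (x j))) + ?r k" for k
    proof -
      have 1: "E u \<le> E (x k) + e k / 2 + L * (2 * c * (1/2) ^ k)"
      proof -
        have "L * d u (x k) \<le> L * (2 * c * (1/2) ^ k)" using du L0 by (intro mult_left_mono) auto
        then show ?thesis using Du[of k] Gd[OF u x(2)[of k]] unfolding E_def by linarith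
      qed
      have 2: "E (x k) + (\<Sum>j<k. \<mu> j * P (x k) (x j)) \<le> E w + (\<Sum>j<k. \<mu> j * P w (x j)) + \<tau> ^ 3 * (1/8) ^ k"
        using x(5)[OF w] by (simp add: \<mu>_def)
      have "(\<Sum>j<k. \<mu> j * P u (x j)) \<le> (\<Sum>j<k. \<mu> j * P (x k) (x j) + \<mu> j * d u (x k))"
      proof (rule sum_mono)
        fix j
        have "\<mu> j * P u (x j) \<le> \<mu> j * (P (x k) (x j) + d u (x k))"
          using Pd[OF u x(2)[of k] x(2)[of j]] \<mu>(1)[of j] by (intro mult_left_mono) auto
        then show "\<mu> j * P u (x j) \<le> \<mu> j * P (x k) (x j) + \<mu> j * d u (x k)" by (simp add: distrib_left)
      qed
      also have "\<dots> = (\<Sum>j<k. \<mu> j * P (x k) (x j)) + (\<Sum>j<k. \<mu> j) * d u (x k)"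
        by (simp add: sum.distrib sum_distrib_right)
      also have "(\<Sum>j<k. \<mu> j) * d u (x k) \<le> 2 * \<tau> * (2 * c * (1/2) ^ k)"
      proof (rule mult_mono[OF _ du])
        show "(\<Sum>j<k. \<mu> j) \<le> 2 * \<tau>"
          using sum_le_suminf[OF \<mu>(2), of "{..<k}"] \<mu>(1,3) by (auto simp: less_imp_le)
      qed (use \<tau> d0 in auto)
      finally have 3: "(\<Sum>j<k. \<mu> j * P u (x j)) \<le> (\<Sum>j<k. \<mu> j * P (x k) (x j)) + 2 * \<tau> * (2 * c * (1/2) ^ k)" by simp
      have 4: "(\<Sum>j<k. \<mu> j * (P w (x j) - P u (x j))) = (\<Sum>j<k. \<mu> j * P w (x j)) - (\<Sum>j<k. \<mu> j * P u (x j))"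
        by (simp add: right_diff_distrib sum_subtractf)
      show ?thesis using 1 2 3 unfolding 4 by linarith
    qed
    moreover have "(\<lambda>k. E w + (\<Sum>j<k. \<mu> j * (P w (x j) - P u (x j))) + ?r k) \<longlonglongrightarrow>
        E w + (\<Sum>j. \<mu> j * (P w (x j) - P u (x j))) + (2 * \<tau> * (2 * c * 0) + \<tau> ^ 3 * 0 + 0 / 2 + L * (2 * c * 0))"
      by (intro tendsto_intros e summable_LIMSEQ sumP[OF w]) auto
    ultimately show ?thesis by (intro LIMSEQ_le_const) auto
  qed
  define f where "f = (\<lambda>y. \<Sum>j. \<mu> j * pen' (u y - x j y))"
  have fs: "summable (\<lambda>j. norm (\<mu> j * pen' (u y - x j y) * r))" for y r
  proof (rule summable_comparison_test'[OF summable_mult2[OF \<mu>(2), of "\<bar>r\<bar>"]])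
    fix j
    have "\<bar>pen' (u y - x j y)\<bar> * (\<mu> j * \<bar>r\<bar>) \<le> 1 * (\<mu> j * \<bar>r\<bar>)"
      using \<mu>(1)[of j] by (intro mult_right_mono pen'_bound) auto
    then show "norm (norm (\<mu> j * pen' (u y - x j y) * r)) \<le> \<mu> j * \<bar>r\<bar>"
      using \<mu>(1)[of j] by (simp add: abs_mult mult_ac)
  qed
  have f_bound: "\<bar>f y\<bar> \<le> 2 * \<tau>" for y
  proof -
    have "norm (f y) \<le> suminf \<mu>"
      unfolding f_def
    proof (rule norm_suminf_le[OF _ \<mu>(2)])
      show "norm (\<mu> j * pen' (u y - x j y)) \<le> \<mu> j" for j
        using mult_left_mono[OF pen'_bound[of "u y - x j y"], of "\<mu> j"] \<mu>(1)[of j] by (simp add: abs_mult)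
    qed
    then show ?thesis by (simp add: \<mu>)
  qed
  have pm: "(\<lambda>y. pen' (u y - x j y)) \<in> borel_measurable M" for j
    using meas[OF u] meas[OF x(2)[of j]] by measurable
  have f_meas: "f \<in> borel_measurable M" unfolding f_def using pm by measurable
  have uv: "d u v \<le> 2 * c" using du[of 0] by (simp add: x(1))
  have Eu: "E u \<le> E v + 2 * \<tau> * d u v"
  proof -
    have "(\<Sum>j. \<mu> j * (P v (x j) - P u (x j))) \<le> (\<Sum>j. \<mu> j * d u v)"
    proof (rule suminf_le)
      show "\<mu> j * (P v (x j) - P u (x j)) \<le> \<mu> j * d u v" for j
        using Pd[OF v[folded K_def] u x(2)[of j]] d_sym[of u v] \<mu>(1)[of j] by (intro mult_left_mono) auto
    qed (use sumP v \<mu> in \<open>auto simp: K_def intro: summable_mult2\<close>)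
    also have "\<dots> = 2 * \<tau> * d u v" using \<mu> by (simp add: suminf_mult2[symmetric])
    finally show ?thesis using Emin[OF v[folded K_def]] by linarith
  qed
  have EL: "(LINT y|M. wgrad Om u y \<bullet> grad \<phi> y) + (LINT y|M. f y * \<phi> y) = (LINT y|M. g (u y) * \<phi> y)"
    if \<phi>: "\<phi> \<in> test_functions Om" for \<phi>
  proof -
    have uH: "u \<in> H1 Om" using u by (auto simp: K_def intro: admissible_H1)
    have \<phi>s: "sqint M \<phi>" "sqint M (grad \<phi>)" by (rule test_sqint[OF \<phi>])+
    have \<phi>i: "integrable M \<phi>" by (rule sqint_integrable[OF \<phi>s(1)])
    have w: "(\<lambda>y. u y + t * \<phi> y) \<in> K" for t
      using admissible_add[OF u[unfolded K_def] test_H1_0[OF \<phi>]] by (simp add: K_def)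
    have p\<phi>i: "integrable M (\<lambda>y. pen' (u y - x j y) * \<phi> y)" for j
    proof (rule Bochner_Integration.integrable_bound[OF \<phi>i])
      show "(\<lambda>y. pen' (u y - x j y) * \<phi> y) \<in> borel_measurable M"
        using pm \<phi>i by measurable
      show "AE y in M. norm (pen' (u y - x j y) * \<phi> y) \<le> norm (\<phi> y)"
        using pen'_bound by (intro AE_I2) (auto simp: abs_mult mult_left_le_one_le)
    qed
    have dom: "norm (LINT y|M. norm (\<mu> j * pen' (u y - x j y) * \<phi> y)) \<le> (LINT y|M. \<bar>\<phi> y\<bar>) * \<mu> j" for j
    proof -
      have "(LINT y|M. norm (\<mu> j * pen' (u y - x j y) * \<phi> y)) \<le> (LINT y|M. \<mu> j * \<bar>\<phi> y\<bar>)"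
      proof (rule integral_mono)
        show "integrable M (\<lambda>y. norm (\<mu> j * pen' (u y - x j y) * \<phi> y))"
          unfolding mult.assoc by (intro integrable_norm integrable_mult_right p\<phi>i)
        show "integrable M (\<lambda>y. \<mu> j * \<bar>\<phi> y\<bar>)" using \<phi>i by auto
        fix y
        have "\<bar>pen' (u y - x j y)\<bar> * (\<mu> j * \<bar>\<phi> y\<bar>) \<le> 1 * (\<mu> j * \<bar>\<phi> y\<bar>)"
          using \<mu>(1)[of j] by (intro mult_right_mono pen'_bound) auto
        then show "norm (\<mu> j * pen' (u y - x j y) * \<phi> y) \<le> \<mu> j * \<bar>\<phi> y\<bar>"
          using \<mu>(1)[of j] by (simp add: abs_mult mult_ac)
      qed
      moreover have "0 \<le> (LINT y|M. norm (\<mu> j * pen' (u y - x j y) * \<phi> y))"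
        by (rule integral_nonneg_AE) simp
      ultimately show ?thesis by (simp add: mult.commute)
    qed
    have ex: "(\<lambda>j. \<mu> j * (LINT y|M. pen' (u y - x j y) * \<phi> y)) sums (LINT y|M. f y * \<phi> y)"
    proof -
      have "(\<lambda>j. LINT y|M. \<mu> j * pen' (u y - x j y) * \<phi> y) sums (LINT y|M. (\<Sum>j. \<mu> j * pen' (u y - x j y) * \<phi> y))"
      proof (rule sums_integral)
        show "integrable M (\<lambda>y. \<mu> j * pen' (u y - x j y) * \<phi> y)" for j
          using p\<phi>i[of j] by (simp add: mult.assoc)
        show "AE y in M. summable (\<lambda>j. norm (\<mu> j * pen' (u y - x j y) * \<phi> y))" by (intro AE_I2 fs)
        show "summable (\<lambda>j. LINT y|M. norm (\<mu> j * pen' (u y - x j y) * \<phi> y))"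
          by (rule summable_comparison_test'[OF summable_mult[OF \<mu>(2), of "LINT y|M. \<bar>\<phi> y\<bar>"] dom])
      qed
      moreover have "(\<Sum>j. \<mu> j * pen' (u y - x j y) * \<phi> y) = f y * \<phi> y" for y
        unfolding f_def by (rule suminf_mult2[symmetric]) (use summable_norm_cancel[OF fs[of y 1]] in simp)
      ultimately show ?thesis by (simp add: mult.assoc)
    qed
    define A where "A = (LINT y|M. f y * \<phi> y)"
    define Q where "Q = (LINT y|M. (\<phi> y)\<^sup>2)"
    have Qi: "integrable M (\<lambda>y. (\<phi> y)\<^sup>2)" using \<phi>s(1) by (simp add: sqint_def)
    have upper: "(\<Sum>j. \<mu> j * (P (\<lambda>y. u y + t * \<phi> y) (x j) - P u (x j))) \<le> t * A + \<tau> * t\<^sup>2 * Q" for t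
    proof -
      have "\<mu> sums (2 * \<tau>)" using summable_sums[OF \<mu>(2)] by (simp only: \<mu>(3))
      then have tot: "(\<lambda>j. t * (\<mu> j * (LINT y|M. pen' (u y - x j y) * \<phi> y)) + \<mu> j * (t\<^sup>2 / 2 * Q))
          sums (t * A + 2 * \<tau> * (t\<^sup>2 / 2 * Q))"
        unfolding A_def by (intro sums_add sums_mult sums_mult2 ex)
      have "(\<Sum>j. \<mu> j * (P (\<lambda>y. u y + t * \<phi> y) (x j) - P u (x j)))
          \<le> (\<Sum>j. t * (\<mu> j * (LINT y|M. pen' (u y - x j y) * \<phi> y)) + \<mu> j * (t\<^sup>2 / 2 * Q))"
      proof (rule suminf_le)
        fix j
        have "P (\<lambda>y. u y + t * \<phi> y) (x j) - P u (x j)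
            = (LINT y|M. pen (u y + t * \<phi> y - x j y) - pen (u y - x j y))"
          unfolding P_def using Pi[OF w x(2)] Pi[OF u x(2)] by simp
        also have "\<dots> \<le> (LINT y|M. t * (pen' (u y - x j y) * \<phi> y) + t\<^sup>2 / 2 * (\<phi> y)\<^sup>2)"
        proof (rule integral_mono)
          show "pen (u y + t * \<phi> y - x j y) - pen (u y - x j y) \<le> t * (pen' (u y - x j y) * \<phi> y) + t\<^sup>2 / 2 * (\<phi> y)\<^sup>2" for y
            using pen_taylor[of "u y - x j y" "t * \<phi> y"] by (simp add: algebra_simps power_mult_distrib)
        qed (use Pi[OF w x(2)] Pi[OF u x(2)] p\<phi>i Qi in auto)
        also have "\<dots> = t * (LINT y|M. pen' (u y - x j y) * \<phi> y) + t\<^sup>2 / 2 * Q"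
          using p\<phi>i Qi by (simp add: Q_def)
        finally have "\<mu> j * (P (\<lambda>y. u y + t * \<phi> y) (x j) - P u (x j))
            \<le> \<mu> j * (t * (LINT y|M. pen' (u y - x j y) * \<phi> y) + t\<^sup>2 / 2 * Q)"
          using \<mu>(1)[of j] by (intro mult_left_mono) auto
        then show "\<mu> j * (P (\<lambda>y. u y + t * \<phi> y) (x j) - P u (x j))
            \<le> t * (\<mu> j * (LINT y|M. pen' (u y - x j y) * \<phi> y)) + \<mu> j * (t\<^sup>2 / 2 * Q)"
          by (simp add: algebra_simps)
      qed (rule sumP[OF w], rule sums_summable[OF tot])
      also have "\<dots> = t * A + 2 * \<tau> * (t\<^sup>2 / 2 * Q)"
        by (rule sums_unique[OF tot, symmetric])
      finally show ?thesis by (simp add: algebra_simps)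
    qed
    define B where "B = (LINT y|M. wgrad Om u y \<bullet> grad \<phi> y)"
    have expand: "dirichlet Om (\<lambda>y. u y + t * \<phi> y) = dirichlet Om u + 2 * t * B + t\<^sup>2 * sqn M (grad \<phi>)" for t
    proof -
      have "dirichlet Om (\<lambda>y. u y + t * \<phi> y) = sqn M (\<lambda>y. wgrad Om u y + t *\<^sub>R grad \<phi> y)"
        by (intro sqn_wgrad weak_gradient_add weak_gradient_cmult weak_gradient_test sqint_add sqint_scaleR
            H1D uH \<phi>s op \<phi>)
      also have "\<dots> = sqn M (wgrad Om u) + 2 * (LINT y|M. wgrad Om u y \<bullet> (t *\<^sub>R grad \<phi> y)) + sqn M (\<lambda>y. t *\<^sub>R grad \<phi> y)"
        by (intro sqn_add sqint_scaleR H1D uH \<phi>s)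
      finally show ?thesis by (simp add: dirichlet_def[of Om u] B_def sqn_scaleR)
    qed
    define F where "F = (\<lambda>t. dirichlet Om u / 2 + t * B + t\<^sup>2 / 2 * sqn M (grad \<phi>)
        - (LINT y|M. G (u y + t * \<phi> y)) + t * A + \<tau> * t\<^sup>2 * Q)"
    have Fmin: "F 0 \<le> F t" for t
    proof -
      have "F 0 = E u" by (simp add: F_def E_def)
      also have "\<dots> \<le> E (\<lambda>y. u y + t * \<phi> y) + (t * A + \<tau> * t\<^sup>2 * Q)"
        using Emin[OF w[of t]] upper[of t] by linarith
      also have "\<dots> = F t" by (simp add: F_def E_def expand field_simps)
      finally show ?thesis .
    qed
    have DG: "((\<lambda>t. LINT y|M. G (u y + t * \<phi> y)) has_real_derivative (LINT y|M. g (u y + 0 * \<phi> y) * \<phi> y)) (at 0)"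
    proof (rule DERIV_under_integral[of "-1" 0 1])
      fix t :: real
      show "integrable M (\<lambda>y. G (u y + t * \<phi> y))" by (rule Gi[OF si[OF w]])
      fix y
      show "((\<lambda>t. G (u y + t * \<phi> y)) has_real_derivative g (u y + t * \<phi> y) * \<phi> y) (at t)"
        by (rule DERIV_chain2[OF G]) (auto intro!: derivative_eq_intros)
      show "\<bar>g (u y + t * \<phi> y) * \<phi> y\<bar> \<le> L * \<bar>\<phi> y\<bar>"
        using gL by (simp add: abs_mult mult_right_mono)
    next
      show "integrable M (\<lambda>y. L * \<bar>\<phi> y\<bar>)" using \<phi>i by auto
    qed auto
    \<comment> \<open>\<open>F\<close> dominates the perturbed energy along the line through \<open>u\<close> and touches it at 0.\<close>
    have "(F has_real_derivative (B - (LINT y|M. g (u y) * \<phi> y) + A)) (at 0)"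
      unfolding F_def using DG by (auto intro!: derivative_eq_intros)
    then have "B - (LINT y|M. g (u y) * \<phi> y) + A = 0"
      by (rule DERIV_local_min[of _ _ _ 1]) (use Fmin in auto)
    then show ?thesis by (simp add: A_def B_def)
  qed
  show thesis
    by (rule that[OF u[unfolded K_def] f_meas f_bound _ _ EL])
      (use uv Eu in \<open>auto simp: d_def c_def V_def\<close>)
qed

end

section \<open>The singular nonlinearity and its regularization\<close>

text \<open>\<open>G_sing\<close> is the lower order part of the energy \<open>J\<close>; \<open>G_reg\<close> is the primitive of the regularized
  nonlinearity \<open>g_reg\<close> that vanishes at 0.\<close>

definition G_sing :: "real \<Rightarrow> real \<Rightarrow> real \<Rightarrow> real \<Rightarrow> real" where
  "G_sing lp lm q t = lp / q * pos t powr q + lm / q * neg t powr q"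

definition G_reg :: "real \<Rightarrow> real \<Rightarrow> real \<Rightarrow> real \<Rightarrow> real \<Rightarrow> real" where
  "G_reg lp lm q \<epsilon> t = lp / q * ((\<epsilon>\<^sup>2 + (pos t)\<^sup>2) powr (q / 2) - \<epsilon> powr q)
                    + lm / q * ((\<epsilon>\<^sup>2 + (neg t)\<^sup>2) powr (q / 2) - \<epsilon> powr q)"

definition g_reg :: "real \<Rightarrow> real \<Rightarrow> real \<Rightarrow> real \<Rightarrow> real \<Rightarrow> real" where
  "g_reg lp lm q \<epsilon> t = lp * pos t / (\<epsilon>\<^sup>2 + t\<^sup>2) powr ((2 - q) / 2)
                    - lm * neg t / (\<epsilon>\<^sup>2 + t\<^sup>2) powr ((2 - q) / 2)"

lemma neg_pos: "neg t = pos (- t)" by (simp add: neg_def pos_def)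
lemma pos_nonneg: "0 \<le> pos t" "0 \<le> neg t" by (auto simp: pos_def neg_def)
lemma pos_lip: "\<bar>pos s - pos t\<bar> \<le> \<bar>s - t\<bar>" "\<bar>neg s - neg t\<bar> \<le> \<bar>s - t\<bar>"
  by (auto simp: pos_def neg_def max_def)

lemma pos_measurable [measurable]: "pos \<in> borel_measurable borel" "neg \<in> borel_measurable borel"
  unfolding pos_def neg_def by measurable

lemma powr_subadditive:
  fixes x y p :: real
  assumes "0 \<le> x" "0 \<le> y" "0 < p" "p \<le> 1"
  shows "(x + y) powr p \<le> x powr p + y powr p"
proof (cases "x + y = 0")
  case False
  then have s: "x + y > 0" using assms by linarith
  have *: "z / (x + y) \<le> z powr p / (x + y) powr p" if "0 \<le> z" "z \<le> x + y" for z
  proof (cases "z = 0")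
    case False
    then have "z / (x + y) > 0" "z / (x + y) \<le> 1" using that s by auto
    then have "(z / (x + y)) powr 1 \<le> (z / (x + y)) powr p" using assms by (intro powr_mono') auto
    then show ?thesis using that s \<open>z / (x + y) > 0\<close> by (simp add: powr_divide)
  qed simp
  have "1 = x / (x + y) + y / (x + y)" using s by (simp add: add_divide_distrib[symmetric])
  also have "\<dots> \<le> x powr p / (x + y) powr p + y powr p / (x + y) powr p"
    using assms by (intro add_mono *) auto
  also have "\<dots> = (x powr p + y powr p) / (x + y) powr p" by (simp add: add_divide_distrib)
  finally show ?thesis using s by (simp add: field_simps)
qed (use assms in auto)

lemma powr_diff_le:
  assumes "0 \<le> a" "0 \<le> b" "0 < p" "p \<le> (1::real)"
  shows "\<bar>a powr p - b powr p\<bar> \<le> \<bar>a - b\<bar> powr p"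
proof -
  have "x powr p - y powr p \<le> \<bar>x - y\<bar> powr p" if "0 \<le> x" "0 \<le> y" for x y
  proof -
    have "x powr p \<le> (\<bar>x - y\<bar> + y) powr p" using that assms by (intro powr_mono2) auto
    also have "\<dots> \<le> \<bar>x - y\<bar> powr p + y powr p" using that assms by (intro powr_subadditive) auto
    finally show ?thesis by simp
  qed
  from this[of a b] this[of b a] assms show ?thesis by (simp add: abs_le_iff abs_minus_commute)
qed

lemma powr_le_affine:
  assumes "0 < \<sigma>" "0 \<le> r" "0 < q" "q < (1::real)"
  shows "r powr q \<le> \<sigma> powr q + \<sigma> powr (q - 1) * r"
proof (cases "r \<le> \<sigma>")
  case True
  then have "r powr q \<le> \<sigma> powr q" using assms by (intro powr_mono2) auto
  then show ?thesis using assms by (simp add: add_increasing2)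
next
  case False
  have "r powr q = r powr (q - 1) * r" using False assms powr_add[of r "q - 1" 1] by simp
  also have "\<dots> \<le> \<sigma> powr (q - 1) * r" using False assms by (intro mult_right_mono powr_mono2') auto
  finally show ?thesis by (simp add: add_increasing)
qed

locale exponents =
  fixes lp lm q :: real
  assumes lp: "lp > 0" and lm: "lm > 0" and q0: "0 < q" and q1: "q < 1"
begin

abbreviation "A \<equiv> (lp + lm) / q"

lemma A_pos: "A > 0" using lp lm q0 by simp

lemma sq_powr: "x > 0 \<Longrightarrow> (x\<^sup>2) powr (q / 2) = x powr q"
  using powr_powr[of x 2 "q / 2"] by (simp add: powr_numeral)

lemma reg_bounds:
  assumes "\<epsilon> > 0" "a \<ge> 0"
  shows "(\<epsilon>\<^sup>2 + a\<^sup>2) powr (q / 2) - \<epsilon> powr q \<le> a powr q"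
    "a powr q \<le> (\<epsilon>\<^sup>2 + a\<^sup>2) powr (q / 2)"
proof -
  have a: "(a\<^sup>2) powr (q / 2) = a powr q" using assms sq_powr[of a] by (cases "a = 0") auto
  have "(\<epsilon>\<^sup>2 + a\<^sup>2) powr (q / 2) \<le> (\<epsilon>\<^sup>2) powr (q / 2) + (a\<^sup>2) powr (q / 2)"
    using q0 q1 by (intro powr_subadditive) auto
  then show "(\<epsilon>\<^sup>2 + a\<^sup>2) powr (q / 2) - \<epsilon> powr q \<le> a powr q"
    using assms by (simp add: a sq_powr)
  have "(a\<^sup>2) powr (q / 2) \<le> (\<epsilon>\<^sup>2 + a\<^sup>2) powr (q / 2)"
    using q0 by (intro powr_mono2) auto
  then show "a powr q \<le> (\<epsilon>\<^sup>2 + a\<^sup>2) powr (q / 2)" by (simp add: a)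
qed

lemma G_reg_le: assumes "\<epsilon> > 0" shows "G_reg lp lm q \<epsilon> t \<le> G_sing lp lm q t"
  unfolding G_reg_def G_sing_def using lp lm q0 reg_bounds(1)[OF assms] pos_nonneg
  by (intro add_mono mult_left_mono) auto

lemma G_sing_le: assumes "\<epsilon> > 0" shows "G_sing lp lm q t \<le> G_reg lp lm q \<epsilon> t + A * \<epsilon> powr q"
proof -
  have "G_sing lp lm q t \<le> lp / q * (\<epsilon>\<^sup>2 + (pos t)\<^sup>2) powr (q / 2) + lm / q * (\<epsilon>\<^sup>2 + (neg t)\<^sup>2) powr (q / 2)"
    unfolding G_sing_def using lp lm q0 reg_bounds(2)[OF assms] pos_nonneg
    by (intro add_mono mult_left_mono) auto
  also have "\<dots> = G_reg lp lm q \<epsilon> t + A * \<epsilon> powr q"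
    unfolding G_reg_def by (simp add: right_diff_distrib add_divide_distrib distrib_right)
  finally show ?thesis .
qed

text \<open>Hoelder continuity of order \<open>q\<close>, in a form that is affine in the distance and hence integrates to
  an estimate in terms of the $L^1$-distance; \<open>\<sigma>\<close> is free.\<close>

lemma G_sing_modulus:
  assumes "\<sigma> > 0"
  shows "\<bar>G_sing lp lm q s - G_sing lp lm q t\<bar> \<le> A * (\<sigma> powr q + \<sigma> powr (q - 1) * \<bar>s - t\<bar>)"
proof -
  define m where "m = \<sigma> powr q + \<sigma> powr (q - 1) * \<bar>s - t\<bar>"
  have *: "\<bar>a powr q - b powr q\<bar> \<le> m" if "0 \<le> a" "0 \<le> b" "\<bar>a - b\<bar> \<le> \<bar>s - t\<bar>" for a b
  proof -
    have "\<bar>a powr q - b powr q\<bar> \<le> \<bar>a - b\<bar> powr q" using that q0 q1 by (intro powr_diff_le) auto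
    also have "\<dots> \<le> \<bar>s - t\<bar> powr q" using that q0 by (intro powr_mono2) auto
    also have "\<dots> \<le> m" unfolding m_def using assms q0 q1 by (intro powr_le_affine) auto
    finally show ?thesis .
  qed
  have "G_sing lp lm q s - G_sing lp lm q t
      = lp / q * (pos s powr q - pos t powr q) + lm / q * (neg s powr q - neg t powr q)"
    by (simp add: G_sing_def right_diff_distrib)
  also have "\<bar>\<dots>\<bar> \<le> lp / q * \<bar>pos s powr q - pos t powr q\<bar> + lm / q * \<bar>neg s powr q - neg t powr q\<bar>"
    using lp lm q0 by (intro order_trans[OF abs_triangle_ineq]) (simp add: abs_mult)
  also have "\<dots> \<le> lp / q * m + lm / q * m"
    using lp lm q0 by (intro add_mono mult_left_mono * pos_nonneg pos_lip) auto
  also have "\<dots> = A * m" by (simp add: add_divide_distrib distrib_right)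
  finally show ?thesis by (simp add: m_def)
qed

lemma DERIV_pos_sq: "((\<lambda>t. (pos t)\<^sup>2) has_real_derivative 2 * pos t) (at t)"
proof -
  consider "t > 0" | "t < 0" | "t = 0" by linarith
  then show ?thesis
  proof cases
    case 1
    have "((\<lambda>t. t\<^sup>2) has_real_derivative 2 * pos t) (at t)"
      using 1 by (auto intro!: derivative_eq_intros simp: pos_def)
    then show ?thesis
      by (rule has_field_derivative_transform_within_open[of _ _ _ "{0<..}"]) (use 1 in \<open>auto simp: pos_def\<close>)
  next
    case 2
    have "((\<lambda>t. 0) has_real_derivative 2 * pos t) (at t)" using 2 by (auto simp: pos_def)
    then show ?thesis
      by (rule has_field_derivative_transform_within_open[of _ _ _ "{..<0}"]) (use 2 in \<open>auto simp: pos_def\<close>)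
  next
    case 3
    have "((\<lambda>h. ((pos h)\<^sup>2 - (pos 0)\<^sup>2) / (h - 0)) \<longlongrightarrow> 0) (at 0)"
    proof (rule Lim_null_comparison)
      show "((\<lambda>h::real. \<bar>h\<bar>) \<longlongrightarrow> 0) (at 0)" by (auto intro!: tendsto_eq_intros)
      show "\<forall>\<^sub>F h in at 0. norm (((pos h)\<^sup>2 - (pos 0)\<^sup>2) / (h - 0)) \<le> \<bar>h\<bar>"
        by (intro always_eventually allI) (auto simp: pos_def max_def power2_eq_square)
    qed
    then show ?thesis using 3 by (simp add: has_field_derivative_iff pos_def)
  qed
qed

lemma DERIV_neg_sq: "((\<lambda>t. (neg t)\<^sup>2) has_real_derivative - (2 * neg t)) (at t)"
proof -
  have "((\<lambda>t. (pos (- t))\<^sup>2) has_real_derivative 2 * pos (- t) * - 1) (at t)"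
    by (rule DERIV_chain2[where f="\<lambda>t. (pos t)\<^sup>2" and g="\<lambda>t. - t", OF DERIV_pos_sq])
      (auto intro!: derivative_eq_intros)
  then show ?thesis by (simp add: neg_pos)
qed

lemma powr_rewrite:
  assumes "\<epsilon> > 0" "a = 0 \<or> a\<^sup>2 = t\<^sup>2"
  shows "q / 2 * (\<epsilon>\<^sup>2 + a\<^sup>2) powr (q / 2 - 1) * (2 * a) = q * (a / (\<epsilon>\<^sup>2 + t\<^sup>2) powr ((2 - q) / 2))"
proof (cases "a = 0")
  case False
  then have a: "a\<^sup>2 = t\<^sup>2" using assms by simp
  have "(2 - q) / 2 = - (q / 2 - 1)" by (simp add: field_simps)
  then show ?thesis by (simp only: a powr_minus_divide) simp
qed simp

lemma DERIV_G_reg: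
  assumes \<epsilon>: "\<epsilon> > 0"
  shows "(G_reg lp lm q \<epsilon> has_real_derivative g_reg lp lm q \<epsilon> t) (at t)"
proof -
  have p: "\<epsilon>\<^sup>2 + a\<^sup>2 > 0" for a using \<epsilon> by (simp add: add_pos_nonneg)
  have P: "((\<lambda>t. (\<epsilon>\<^sup>2 + (pos t)\<^sup>2) powr (q / 2)) has_real_derivative
      q / 2 * (\<epsilon>\<^sup>2 + (pos t)\<^sup>2) powr (q / 2 - 1) * (2 * pos t)) (at t)"
    using DERIV_fun_powr[OF DERIV_add[OF DERIV_const DERIV_pos_sq] p, of "q / 2"] by simp
  have N: "((\<lambda>t. (\<epsilon>\<^sup>2 + (neg t)\<^sup>2) powr (q / 2)) has_real_derivative
      - (q / 2 * (\<epsilon>\<^sup>2 + (neg t)\<^sup>2) powr (q / 2 - 1) * (2 * neg t))) (at t)"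
    using DERIV_fun_powr[OF DERIV_add[OF DERIV_const DERIV_neg_sq] p, of "q / 2"] by simp
  have 1: "pos t = 0 \<or> (pos t)\<^sup>2 = t\<^sup>2" "neg t = 0 \<or> (neg t)\<^sup>2 = t\<^sup>2"
    by (auto simp: pos_def neg_def max_def)
  have "(G_reg lp lm q \<epsilon> has_real_derivative
      lp / q * (q * (pos t / (\<epsilon>\<^sup>2 + t\<^sup>2) powr ((2 - q) / 2)) - 0)
      + lm / q * (- (q * (neg t / (\<epsilon>\<^sup>2 + t\<^sup>2) powr ((2 - q) / 2))) - 0)) (at t)"
    unfolding G_reg_def[abs_def] powr_rewrite[OF \<epsilon> 1(1), symmetric] powr_rewrite[OF \<epsilon> 1(2), symmetric]
    by (intro DERIV_add DERIV_cmult DERIV_diff P N DERIV_const)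
  moreover have "lp / q * (q * (pos t / (\<epsilon>\<^sup>2 + t\<^sup>2) powr ((2 - q) / 2)) - 0)
      + lm / q * (- (q * (neg t / (\<epsilon>\<^sup>2 + t\<^sup>2) powr ((2 - q) / 2))) - 0) = g_reg lp lm q \<epsilon> t"
    using q0 by (simp add: g_reg_def)
  ultimately show ?thesis by simp
qed

text \<open>The bound degenerates as \<open>\<epsilon>\<close> tends to 0.  It is used only for fixed \<open>\<epsilon>\<close>: as a Lipschitz constant of
  \<open>G_reg\<close> and to bound the Laplacian of a solution.\<close>

lemma g_reg_bound:
  assumes \<epsilon>: "\<epsilon> > 0"
  shows "\<bar>g_reg lp lm q \<epsilon> t\<bar> \<le> (lp + lm) * \<epsilon> powr (q - 1)"
proof -
  define S where "S = \<epsilon>\<^sup>2 + t\<^sup>2"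
  have S: "S > 0" "S \<ge> \<epsilon>\<^sup>2" "S \<ge> t\<^sup>2" using \<epsilon> by (auto simp: S_def add_pos_nonneg)
  have e: "(\<epsilon>\<^sup>2) powr ((1 - q) / 2) = \<epsilon> powr (1 - q)"
  proof -
    have "(\<epsilon>\<^sup>2) powr ((1 - q) / 2) = (\<epsilon> powr 2) powr ((1 - q) / 2)" using \<epsilon> by (simp add: powr_numeral)
    also have "\<dots> = \<epsilon> powr (2 * ((1 - q) / 2))" by (rule powr_powr)
    also have "2 * ((1 - q) / 2) = 1 - q" by simp
    finally show ?thesis .
  qed
  have "\<bar>t\<bar> * \<epsilon> powr (1 - q) \<le> sqrt S * S powr ((1 - q) / 2)"
  proof (rule mult_mono)
    show "\<bar>t\<bar> \<le> sqrt S" using S by (intro real_le_rsqrt) auto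
    show "\<epsilon> powr (1 - q) \<le> S powr ((1 - q) / 2)"
      unfolding e[symmetric] using q1 S by (intro powr_mono2) auto
  qed (use S in auto)
  also have "\<dots> = S powr ((2 - q) / 2)"
    using S by (simp add: powr_half_sqrt[symmetric] powr_add[symmetric] field_simps)
  finally have "\<bar>t\<bar> / S powr ((2 - q) / 2) \<le> 1 / \<epsilon> powr (1 - q)"
    using S \<epsilon> by (simp add: field_simps)
  also have "\<dots> = \<epsilon> powr (q - 1)" using powr_minus_divide[of \<epsilon> "1 - q"] by simp
  finally have b: "\<bar>t\<bar> / S powr ((2 - q) / 2) \<le> \<epsilon> powr (q - 1)" .
  define T where "T = \<bar>t\<bar> / S powr ((2 - q) / 2)"
  have T: "T \<ge> 0" by (simp add: T_def)
  have "\<bar>g_reg lp lm q \<epsilon> t\<bar> \<le> (lp + lm) * T"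
  proof (cases "t \<ge> 0")
    case True
    then have "g_reg lp lm q \<epsilon> t = lp * T" by (simp add: g_reg_def pos_def neg_def S_def T_def)
    then show ?thesis using lp lm T by (simp add: abs_mult mult_right_mono)
  next
    case False
    then have "g_reg lp lm q \<epsilon> t = - (lm * T)" by (simp add: g_reg_def pos_def neg_def S_def T_def)
    then show ?thesis using lp lm T by (simp add: abs_mult mult_right_mono)
  qed
  also have "\<dots> \<le> (lp + lm) * \<epsilon> powr (q - 1)" using b lp lm by (intro mult_left_mono) (auto simp: T_def)
  finally show ?thesis .
qed

lemma G_measurable [measurable]:
  "G_sing lp lm q \<in> borel_measurable borel" "G_reg lp lm q \<epsilon> \<in> borel_measurable borel"
  "g_reg lp lm q \<epsilon> \<in> borel_measurable borel"
  unfolding G_sing_def[abs_def] G_reg_def[abs_def] g_reg_def[abs_def] by measurable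

end

section \<open>Approximation of a minimizer\<close>

locale variational = bounded_open Om + exponents lp lm q
  for Om :: "'a::euclidean_space set" and lp lm q
begin

lemma G_sing_integrable:
  assumes "integrable M w" shows "integrable M (\<lambda>x. G_sing lp lm q (w x))"
proof (rule Bochner_Integration.integrable_bound[where f="\<lambda>x. A * (1 + \<bar>w x\<bar>)"])
  show "integrable M (\<lambda>x. A * (1 + \<bar>w x\<bar>))" using assms by auto
  show "(\<lambda>x. G_sing lp lm q (w x)) \<in> borel_measurable M" using assms by measurable
  have 1: "\<bar>G_sing lp lm q (w x)\<bar> \<le> A * (1 + \<bar>w x\<bar>)" for x
    using G_sing_modulus[of 1 "w x" 0] by (simp add: G_sing_def pos_def neg_def)
  show "AE x in M. norm (G_sing lp lm q (w x)) \<le> norm (A * (1 + \<bar>w x\<bar>))"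
    unfolding real_norm_def by (intro AE_I2 order_trans[OF 1 abs_ge_self])
qed

lemma G_reg_integrable:
  assumes "integrable M w" "\<epsilon> > 0" shows "integrable M (\<lambda>x. G_reg lp lm q \<epsilon> (w x))"
proof (rule Bochner_Integration.integrable_bound[where f="\<lambda>x. \<bar>G_sing lp lm q (w x)\<bar> + A * \<epsilon> powr q"])
  show "integrable M (\<lambda>x. \<bar>G_sing lp lm q (w x)\<bar> + A * \<epsilon> powr q)" using G_sing_integrable[OF assms(1)] by auto
  show "(\<lambda>x. G_reg lp lm q \<epsilon> (w x)) \<in> borel_measurable M" using assms by measurable
  have "0 \<le> A * \<epsilon> powr q" using A_pos by (intro mult_nonneg_nonneg) auto
  then have 1: "\<bar>G_reg lp lm q \<epsilon> t\<bar> \<le> \<bar>G_sing lp lm q t\<bar> + A * \<epsilon> powr q" for t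
    using G_reg_le[OF assms(2), of t] G_sing_le[OF assms(2), of t] by linarith
  show "AE x in M. norm (G_reg lp lm q \<epsilon> (w x)) \<le> norm (\<bar>G_sing lp lm q (w x)\<bar> + A * \<epsilon> powr q)"
    unfolding real_norm_def by (intro AE_I2 order_trans[OF 1 abs_ge_self])
qed

lemma J_eq:
  assumes "w \<in> H1 Om"
  shows "J Om lp lm q w = dirichlet Om w / 2 - (LINT x|M. G_sing lp lm q (w x))"
proof -
  have 1: "integrable M (\<lambda>x. (norm (wgrad Om w x))\<^sup>2 / 2)"
    using H1D(3)[OF assms] by (simp add: sqint_def)
  have 2: "integrable M (\<lambda>x. G_sing lp lm q (w x))"
    by (intro G_sing_integrable sqint_integrable H1D assms)
  have "J Om lp lm q w = (LINT x|M. (norm (wgrad Om w x))\<^sup>2 / 2 - G_sing lp lm q (w x))"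
    unfolding J_def G_sing_def by (intro Bochner_Integration.integral_cong) auto
  also have "\<dots> = (LINT x|M. (norm (wgrad Om w x))\<^sup>2 / 2) - (LINT x|M. G_sing lp lm q (w x))"
    using 1 2 by (rule Bochner_Integration.integral_diff)
  finally show ?thesis by (simp add: dirichlet_def sqn_def)
qed

lemma J_le_E:
  assumes "w \<in> H1 Om" "\<epsilon> > 0"
  defines "Ew \<equiv> dirichlet Om w / 2 - (LINT x|M. G_reg lp lm q \<epsilon> (w x))"
  shows "J Om lp lm q w \<le> Ew" "Ew \<le> J Om lp lm q w + A * measure M Om * \<epsilon> powr q"
proof -
  have w: "integrable M w" by (intro sqint_integrable H1D assms)
  note i = G_sing_integrable[OF w] G_reg_integrable[OF w assms(2)]
  have "(LINT x|M. G_reg lp lm q \<epsilon> (w x)) \<le> (LINT x|M. G_sing lp lm q (w x))"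
    using i G_reg_le[OF assms(2)] by (intro integral_mono) auto
  then show "J Om lp lm q w \<le> Ew" by (simp add: J_eq[OF assms(1)] Ew_def)
  have "(LINT x|M. G_sing lp lm q (w x)) \<le> (LINT x|M. G_reg lp lm q \<epsilon> (w x) + A * \<epsilon> powr q)"
    using i G_sing_le[OF assms(2)] by (intro integral_mono) auto
  also have "\<dots> = (LINT x|M. G_reg lp lm q \<epsilon> (w x)) + A * \<epsilon> powr q * measure M Om"
    using i by (simp add: mult.commute)
  finally show "Ew \<le> J Om lp lm q w + A * measure M Om * \<epsilon> powr q"
    by (simp add: J_eq[OF assms(1)] Ew_def mult_ac)
qed

lemma G_sing_integral_modulus:
  assumes "integrable M v" "integrable M w" "\<sigma> > 0"
  shows "\<bar>(LINT x|M. G_sing lp lm q (v x)) - (LINT x|M. G_sing lp lm q (w x))\<bar>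
     \<le> A * (\<sigma> powr q * measure M Om + \<sigma> powr (q - 1) * (LINT x|M. \<bar>v x - w x\<bar>))"
proof -
  have d: "integrable M (\<lambda>x. \<bar>v x - w x\<bar>)" using assms by auto
  have "\<bar>(LINT x|M. G_sing lp lm q (v x)) - (LINT x|M. G_sing lp lm q (w x))\<bar>
      = \<bar>LINT x|M. G_sing lp lm q (v x) - G_sing lp lm q (w x)\<bar>"
    using assms by (simp add: G_sing_integrable)
  also have "\<dots> \<le> (LINT x|M. \<bar>G_sing lp lm q (v x) - G_sing lp lm q (w x)\<bar>)" by (rule integral_abs_bound)
  also have "\<dots> \<le> (LINT x|M. A * (\<sigma> powr q + \<sigma> powr (q - 1) * \<bar>v x - w x\<bar>))"
    using assms d G_sing_integrable G_sing_modulus[OF assms(3)]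
    by (intro integral_mono integrable_abs Bochner_Integration.integrable_diff integrable_mult_right
        Bochner_Integration.integrable_add integrable_const) auto
  also have "\<dots> = A * (\<sigma> powr q * measure M Om + \<sigma> powr (q - 1) * (LINT x|M. \<bar>v x - w x\<bar>))"
    using d by (simp add: mult.commute)
  finally show ?thesis .
qed

text \<open>The regularized energies are uniformly close to \<open>J\<close>, so a minimizer of \<open>J\<close> almost
  minimizes them.  The nearby exact solutions converge strongly because the midpoint of \<open>u\<close> and
  \<open>ubar\<close> cannot have energy below the minimum.\<close>

lemma minimizer_approximation:
  assumes min: "minimizer (J Om lp lm q) (admissible Om u0) ubar" and \<delta>: "\<delta> > 0"
  obtains \<epsilon> u f where "0 < \<epsilon>" "\<epsilon> < \<delta>" "u \<in> H1 Om" "f \<in> borel_measurable M" "\<And>x. \<bar>f x\<bar> \<le> \<delta>"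
    "sqn M (\<lambda>x. u x - ubar x) \<le> \<delta>" "dirichlet Om (\<lambda>x. u x - ubar x) \<le> \<delta>"
    "weak_solution Om f (\<lambda>x. g_reg lp lm q \<epsilon> (u x)) u"
proof -
  have ub: "ubar \<in> admissible Om u0" and mn: "\<And>w. w \<in> admissible Om u0 \<Longrightarrow> J Om lp lm q ubar \<le> J Om lp lm q w"
    using min by (auto simp: minimizer_def)
  define V where "V = measure M Om"
  have V0: "V \<ge> 0" by (simp add: V_def)
  obtain R where R: "\<And>x. x \<in> Om \<Longrightarrow> norm x \<le> R" using norm_bound_Om by blast
  \<comment> \<open>The estimate of the Dirichlet energy of the difference, with \<open>\<sigma> = sqrt \<tau>\<close> in \<open>G_sing_modulus\<close>: both \<open>\<sigma> powr q\<close> and \<open>\<sigma> powr (q - 1) * \<tau>\<close> then tend to 0.\<close>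
  define B where "B = (\<lambda>\<tau>. 4 * (\<tau> ^ 3 + 2 * \<tau> * (2 * \<tau> * (V + 3)))
      + 8 * (A * (sqrt \<tau> powr q * V + sqrt \<tau> powr (q - 1) * (2 * \<tau> * (V + 3)))))"
  have B0: "(B \<longlongrightarrow> 0) (at_right 0)"
  proof -
    have sqrt0: "((\<lambda>\<tau>. sqrt \<tau> powr q) \<longlongrightarrow> 0) (at_right 0)"
    proof (rule tendsto_zero_powrI)
      show "((\<lambda>\<tau>. sqrt \<tau>) \<longlongrightarrow> 0) (at_right 0)"
        using tendsto_real_sqrt[OF tendsto_ident_at[of 0 "{0<..}"]] by simp
    qed (use q0 in \<open>auto simp: eventually_at_right_field intro!: exI[of _ 1]\<close>)
    have s: "((\<lambda>\<tau>. sqrt \<tau>) \<longlongrightarrow> 0) (at_right 0)"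
      using tendsto_real_sqrt[OF tendsto_ident_at[of 0 "{0<..}"]] by simp
    have "((\<lambda>\<tau>. 4 * (\<tau> ^ 3 + 2 * \<tau> * (2 * \<tau> * (V + 3)))
      + 8 * (A * (sqrt \<tau> powr q * V + sqrt \<tau> powr q * sqrt \<tau> * (2 * (V + 3))))) \<longlongrightarrow>
      4 * (0 ^ 3 + 2 * 0 * (2 * 0 * (V + 3))) + 8 * (A * (0 * V + 0 * 0 * (2 * (V + 3))))) (at_right 0)"
      by (intro tendsto_intros sqrt0 s)
    then have "((\<lambda>\<tau>. 4 * (\<tau> ^ 3 + 2 * \<tau> * (2 * \<tau> * (V + 3)))
      + 8 * (A * (sqrt \<tau> powr q * V + sqrt \<tau> powr q * sqrt \<tau> * (2 * (V + 3))))) \<longlongrightarrow> 0) (at_right 0)"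
      by simp
    moreover have "\<forall>\<^sub>F \<tau> in at_right 0. 4 * (\<tau> ^ 3 + 2 * \<tau> * (2 * \<tau> * (V + 3)))
      + 8 * (A * (sqrt \<tau> powr q * V + sqrt \<tau> powr q * sqrt \<tau> * (2 * (V + 3)))) = B \<tau>"
    proof (rule eventually_at_rightI[of 0 1])
      fix \<tau> :: real assume t: "\<tau> \<in> {0<..<1}"
      have "sqrt \<tau> powr (q - 1) = sqrt \<tau> powr q / sqrt \<tau>" using t by (simp add: powr_diff)
      then have "sqrt \<tau> powr (q - 1) * \<tau> = sqrt \<tau> powr q * (\<tau> / sqrt \<tau>)" by simp
      also have "\<tau> / sqrt \<tau> = sqrt \<tau>" using t by (intro real_div_sqrt) auto
      finally have e: "sqrt \<tau> powr (q - 1) * \<tau> = sqrt \<tau> powr q * sqrt \<tau>" .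
      have "sqrt \<tau> powr (q - 1) * (2 * \<tau> * (V + 3)) = (sqrt \<tau> powr (q - 1) * \<tau>) * (2 * (V + 3))"
        by (simp add: mult_ac)
      then show "4 * (\<tau> ^ 3 + 2 * \<tau> * (2 * \<tau> * (V + 3)))
        + 8 * (A * (sqrt \<tau> powr q * V + sqrt \<tau> powr q * sqrt \<tau> * (2 * (V + 3)))) = B \<tau>"
        unfolding B_def e by simp
    qed simp
    ultimately show ?thesis by (rule Lim_transform_eventually)
  qed
  define \<eta> where "\<eta> = \<delta> / (1 + 16 * R\<^sup>2)"
  have p: "1 + 16 * R\<^sup>2 \<ge> 1" by simp
  have \<eta>: "\<eta> > 0" unfolding \<eta>_def using \<delta> p by (intro divide_pos_pos) linarith+
  have "\<forall>\<^sub>F \<tau> in at_right 0. B \<tau> < \<eta> \<and> 0 < \<tau> \<and> \<tau> < min 1 (\<delta> / 2)"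
  proof (rule eventually_conj[OF order_tendstoD(2)[OF B0 \<eta>]])
    show "\<forall>\<^sub>F \<tau> in at_right 0. 0 < \<tau> \<and> \<tau> < min 1 (\<delta> / 2)"
      by (rule eventually_at_rightI[of 0 "min 1 (\<delta> / 2)"]) (use \<delta> in auto)
  qed
  then obtain \<tau> where \<tau>: "B \<tau> < \<eta>" "0 < \<tau>" "\<tau> < 1" "\<tau> < \<delta> / 2"
    using eventually_happens[of _ "at_right (0::real)"] by auto
  \<comment> \<open>The second entry makes the error of the regularization at most \<open>\<tau> ^ 3\<close>.\<close>
  define \<epsilon> where "\<epsilon> = min \<tau> ((\<tau> ^ 3 / (A * V + 1)) powr (1 / q))"
  have AV: "A * V + 1 \<ge> 1" using mult_nonneg_nonneg[OF less_imp_le[OF A_pos] V0] by linarith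
  have \<epsilon>0: "\<epsilon> > 0" unfolding \<epsilon>_def using \<tau> AV by (simp add: powr_gt_zero)
  have "\<epsilon> powr q \<le> ((\<tau> ^ 3 / (A * V + 1)) powr (1 / q)) powr q"
    using \<epsilon>0 q0 by (intro powr_mono2) (auto simp: \<epsilon>_def)
  also have "\<dots> = \<tau> ^ 3 / (A * V + 1)" using \<tau> AV q0 by (simp add: powr_powr)
  finally have "(A * V + 1) * \<epsilon> powr q \<le> \<tau> ^ 3" using AV by (simp add: field_simps)
  then have \<epsilon>1: "A * V * \<epsilon> powr q \<le> \<tau> ^ 3"
    using distrib_right[of "A * V" 1 "\<epsilon> powr q"] powr_ge_zero[of \<epsilon> q] by linarith
  define E where "E = (\<lambda>w. dirichlet Om w / 2 - (LINT x|M. G_reg lp lm q \<epsilon> (w x)))"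
  have JE: "J Om lp lm q w \<le> E w" "E w \<le> J Om lp lm q w + \<tau> ^ 3" if "w \<in> admissible Om u0" for w
    using J_le_E[OF admissible_H1[OF that] \<epsilon>0] \<epsilon>1 by (auto simp: E_def V_def)
  have Emin: "E ubar \<le> E w + \<tau> ^ 3" if "w \<in> admissible Om u0" for w
    using JE(2)[OF ub] mn[OF that] JE(1)[OF that] by linarith
  obtain u f where u: "u \<in> admissible Om u0" and f: "f \<in> borel_measurable M" "\<And>x. \<bar>f x\<bar> \<le> 2 * \<tau>"
    and d': "(LINT x|M. \<bar>u x - ubar x\<bar>) \<le> 2 * \<tau> * (measure M Om + 3)"
    and Eu': "dirichlet Om u / 2 - (LINT x|M. G_reg lp lm q \<epsilon> (u x))
      \<le> dirichlet Om ubar / 2 - (LINT x|M. G_reg lp lm q \<epsilon> (ubar x)) + 2 * \<tau> * (LINT x|M. \<bar>u x - ubar x\<bar>)"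
    and EL: "\<And>\<phi>. \<phi> \<in> test_functions Om \<Longrightarrow>
       (LINT x|M. wgrad Om u x \<bullet> grad \<phi> x) + (LINT x|M. f x * \<phi> x) = (LINT x|M. g_reg lp lm q \<epsilon> (u x) * \<phi> x)"
    by (rule almost_minimizer_near_solution[OF DERIV_G_reg[OF \<epsilon>0] g_reg_bound[OF \<epsilon>0] ub \<tau>(2) less_imp_le[OF \<tau>(3)]
        Emin[unfolded E_def]]) (assumption, rule that)
  have d: "(LINT x|M. \<bar>u x - ubar x\<bar>) \<le> 2 * \<tau> * (V + 3)" using d' by (simp only: V_def)
  have Eu: "E u \<le> E ubar + 2 * \<tau> * (LINT x|M. \<bar>u x - ubar x\<bar>)" using Eu' by (simp only: E_def)
  define D where "D = (LINT x|M. \<bar>u x - ubar x\<bar>)"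
  define m where "m = (\<lambda>x. (u x + ubar x) / 2)"
  have ma: "m \<in> admissible Om u0" unfolding m_def by (rule admissible_mid[OF u ub])
  have H: "u \<in> H1 Om" "ubar \<in> H1 Om" "m \<in> H1 Om" using u ub ma by (auto intro: admissible_H1)
  have I: "integrable M u" "integrable M ubar" "integrable M m" using H by (auto intro: sqint_integrable H1D)
  define s where "s = A * (sqrt \<tau> powr q * V + sqrt \<tau> powr (q - 1) * (2 * \<tau> * (V + 3)))"
  have mod: "(LINT x|M. G_sing lp lm q (v x)) - (LINT x|M. G_sing lp lm q (m x)) \<le> s"
    if v: "integrable M v" and vm: "\<And>x. \<bar>v x - m x\<bar> \<le> \<bar>u x - ubar x\<bar>" for v
  proof -
    have "(LINT x|M. \<bar>v x - m x\<bar>) \<le> (LINT x|M. \<bar>u x - ubar x\<bar>)"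
      using v I vm by (intro integral_mono) auto
    then have "(LINT x|M. \<bar>v x - m x\<bar>) \<le> 2 * \<tau> * (V + 3)" using d by linarith
    then have "A * (sqrt \<tau> powr q * V + sqrt \<tau> powr (q - 1) * (LINT x|M. \<bar>v x - m x\<bar>)) \<le> s"
      unfolding s_def using A_pos by (intro mult_left_mono add_left_mono) auto
    then show ?thesis
      using G_sing_integral_modulus[OF v I(3), of "sqrt \<tau>"] \<tau> by (simp add: V_def)
  qed
  have "(LINT x|M. G_sing lp lm q (u x)) - (LINT x|M. G_sing lp lm q (m x)) \<le> s"
    by (rule mod[OF I(1)]) (simp add: m_def abs_if field_simps)
  moreover have "(LINT x|M. G_sing lp lm q (ubar x)) - (LINT x|M. G_sing lp lm q (m x)) \<le> s"
    by (rule mod[OF I(2)]) (simp add: m_def abs_if field_simps)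
  moreover have "J Om lp lm q u \<le> J Om lp lm q ubar + \<tau> ^ 3 + 2 * \<tau> * D"
    using JE(1)[OF u] Eu JE(2)[OF ub] by (simp add: D_def)
  moreover have "2 * \<tau> * D \<le> 2 * \<tau> * (2 * \<tau> * (V + 3))"
    unfolding D_def using d \<tau> by (intro mult_left_mono) auto
  moreover note mn[OF ma]
  ultimately have "dirichlet Om (\<lambda>x. u x - ubar x) \<le> B \<tau>"
    unfolding dirichlet_parallelogram[OF H(1,2), folded m_def] J_eq[OF H(1)] J_eq[OF H(2)] J_eq[OF H(3)]
      B_def s_def[symmetric] by (simp add: field_simps)
  then have D1: "dirichlet Om (\<lambda>x. u x - ubar x) \<le> \<eta>" using \<tau> by linarith
  have "\<eta> * 1 \<le> \<eta> * (1 + 16 * R\<^sup>2)" using \<eta> p by (intro mult_left_mono) auto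
  then have \<eta>\<delta>: "\<eta> \<le> \<delta>" "16 * R\<^sup>2 * \<eta> \<le> \<delta>"
    using \<eta> by (auto simp: \<eta>_def field_simps add_pos_nonneg intro: order_trans)
  have D2: "dirichlet Om (\<lambda>x. u x - ubar x) \<le> \<delta>" using D1 \<eta>\<delta> by linarith
  have "sqn M (\<lambda>x. u x - ubar x) \<le> 16 * R\<^sup>2 * dirichlet Om (\<lambda>x. u x - ubar x)"
    by (rule poincare[OF R admissible_diff[OF u ub]])
  also have "\<dots> \<le> 16 * R\<^sup>2 * \<eta>" using D1 by (intro mult_left_mono) auto
  finally have D3: "sqn M (\<lambda>x. u x - ubar x) \<le> \<delta>" using \<eta>\<delta> by linarith
  have \<epsilon>\<delta>: "\<epsilon> < \<delta>" using \<tau> by (auto simp: \<epsilon>_def min_less_iff_disj)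
  have fb: "\<bar>f x\<bar> \<le> \<delta>" for x using f(2)[of x] \<tau> by linarith
  show thesis
    using that[OF \<epsilon>0 \<epsilon>\<delta> H(1) f(1) fb D3 D2] EL by (simp add: weak_solution_def)
qed

end

section \<open>Affine changes of variables and density of continuous functions\<close>

lemma lebesgue_affine:
  fixes t :: "'a::euclidean_space"
  assumes "c \<noteq> 0"
  shows "lebesgue = density (distr lebesgue lebesgue (\<lambda>x. t + c *\<^sub>R x)) (\<lambda>_. ennreal (\<bar>c\<bar> ^ DIM('a)))"
    and "(\<lambda>x. t + c *\<^sub>R x) \<in> lebesgue \<rightarrow>\<^sub>M lebesgue"
  using lebesgue_affine_euclidean[where c="\<lambda>_::'a. c" and t=t] lebesgue_affine_measurable[where c="\<lambda>_::'a. c" and t=t] assms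
  unfolding scaleR_scaleR[symmetric] scaleR_sum_right[symmetric] euclidean_representation prod_constant by simp_all

lemma lebesgue_integral_affine:
  fixes f :: "'a::euclidean_space \<Rightarrow> 'b::euclidean_space"
  assumes c: "c \<noteq> 0" and f: "f \<in> borel_measurable lebesgue"
  shows "integrable lebesgue (\<lambda>x. f (t + c *\<^sub>R x)) \<longleftrightarrow> integrable lebesgue f"
    and "(LINT x|lebesgue. f (t + c *\<^sub>R x)) = (1 / \<bar>c\<bar> ^ DIM('a)) *\<^sub>R (LINT x|lebesgue. f x)"
proof -
  let ?T = "\<lambda>x. t + c *\<^sub>R x" and ?d = "\<bar>c\<bar> ^ DIM('a)"
  have d: "?d > 0" using c by simp
  note T = lebesgue_affine(2)[OF c, of t]
  have "integrable lebesgue f \<longleftrightarrow> integrable (density (distr lebesgue lebesgue ?T) (\<lambda>_. ennreal ?d)) f"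
    using lebesgue_affine(1)[OF c, of t] by simp
  also have "\<dots> \<longleftrightarrow> integrable (distr lebesgue lebesgue ?T) (\<lambda>x. ?d *\<^sub>R f x)"
    using f by (intro integrable_density) auto
  also have "\<dots> \<longleftrightarrow> integrable lebesgue (\<lambda>x. ?d *\<^sub>R f (?T x))"
    using f by (intro integrable_distr_eq[OF T]) auto
  also have "\<dots> \<longleftrightarrow> integrable lebesgue (\<lambda>x. f (?T x))"
  proof
    assume "integrable lebesgue (\<lambda>x. ?d *\<^sub>R f (?T x))"
    then have "integrable lebesgue (\<lambda>x. (1 / ?d) *\<^sub>R (?d *\<^sub>R f (?T x)))" by (rule integrable_scaleR_right)
    then show "integrable lebesgue (\<lambda>x. f (?T x))" using d by simp
  qed (rule integrable_scaleR_right)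
  finally show 1: "integrable lebesgue (\<lambda>x. f (?T x)) \<longleftrightarrow> integrable lebesgue f" by simp
  have "(LINT x|lebesgue. f x) = (LINT x|density (distr lebesgue lebesgue ?T) (\<lambda>_. ennreal ?d). f x)"
    using lebesgue_affine(1)[OF c, of t] by simp
  also have "\<dots> = (LINT x|distr lebesgue lebesgue ?T. ?d *\<^sub>R f x)"
    using f by (intro integral_density) auto
  also have "\<dots> = (LINT x|lebesgue. ?d *\<^sub>R f (?T x))"
    using f by (intro integral_distr[OF T]) auto
  also have "\<dots> = ?d *\<^sub>R (LINT x|lebesgue. f (?T x))" by simp
  finally show "(LINT x|lebesgue. f (?T x)) = (1 / ?d) *\<^sub>R (LINT x|lebesgue. f x)" using d by simp
qed

definition clamp_at :: "real \<Rightarrow> real \<Rightarrow> real" where "clamp_at R t = max (- R) (min R t)"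

lemma power_add_le: "(a + b) ^ p \<le> 2 ^ p * (a ^ p + b ^ p)" if "0 \<le> a" "0 \<le> (b::real)"
proof -
  have "(a + b) ^ p \<le> (2 * max a b) ^ p" using that by (intro power_mono) auto
  also have "\<dots> = 2 ^ p * (max a b) ^ p" by (rule power_mult_distrib)
  also have "(max a b) ^ p \<le> a ^ p + b ^ p" using that by (cases "a \<le> b") (auto simp: max_def)
  finally show ?thesis by simp
qed

text \<open>Continuous functions with compact support are dense in $L^p$: truncate in range and domain,
  then use that a measurable function is an almost everywhere limit of continuous ones.\<close>

lemma continuous_dense_Lp:
  fixes f :: "'a::euclidean_space \<Rightarrow> real"
  assumes f: "f \<in> borel_measurable lebesgue" and fi: "integrable lebesgue (\<lambda>x. \<bar>f x\<bar> ^ p)" and p: "p > 0"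
    and e: "e > 0"
  obtains g r where "continuous_on UNIV g" "\<And>x. norm x > r \<Longrightarrow> g x = 0"
    "integrable lebesgue (\<lambda>x. \<bar>f x - g x\<bar> ^ p)" "(LINT x|lebesgue. \<bar>f x - g x\<bar> ^ p) \<le> e"
proof -
  define \<psi> where "\<psi> = (\<lambda>R (x::'a). max 0 (min 1 (R + 1 - norm x)) :: real)"
  define W where "W = (\<lambda>R x. clamp_at R (f x) * \<psi> R x)"
  have \<psi>: "0 \<le> \<psi> R x" "\<psi> R x \<le> 1" "norm x > R + 1 \<Longrightarrow> \<psi> R x = 0" "norm x \<le> R \<Longrightarrow> \<psi> R x = 1" for R x
    by (auto simp: \<psi>_def)
  have \<psi>c: "continuous_on UNIV (\<psi> R)" for R unfolding \<psi>_def by (intro continuous_intros)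
  have cl: "\<bar>clamp_at R t\<bar> \<le> \<bar>t\<bar>" "\<bar>clamp_at R t\<bar> \<le> R" if "R \<ge> 0" for R t
    using that by (auto simp: clamp_at_def)
  have clc: "continuous_on UNIV (clamp_at R)" for R unfolding clamp_at_def by (intro continuous_intros)
  have clm [measurable]: "clamp_at R \<in> borel_measurable borel" for R
    by (intro borel_measurable_continuous_onI clc)
  have \<psi>m [measurable]: "\<psi> R \<in> borel_measurable lebesgue" for R
    by (intro measurable_completion) (simp add: borel_measurable_continuous_onI \<psi>c)
  have W_meas [measurable]: "W R \<in> borel_measurable lebesgue" for R
    unfolding W_def using f by measurable
  have fW: "\<bar>f x - W R x\<bar> \<le> 2 * \<bar>f x\<bar>" if "R \<ge> 0" for R x
  proof -
    have "\<bar>W R x\<bar> \<le> \<bar>f x\<bar> * 1" unfolding W_def abs_mult using cl[OF that] \<psi> by (intro mult_mono) auto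
    then show ?thesis by linarith
  qed
  have dom: "\<bar>f x - W R x\<bar> ^ p \<le> 2 ^ p * \<bar>f x\<bar> ^ p" if "R \<ge> 0" for R x
    unfolding power_mult_distrib[symmetric] using fW[OF that] by (intro power_mono) auto
  have "(\<lambda>n. LINT x|lebesgue. \<bar>f x - W (real n) x\<bar> ^ p) \<longlonglongrightarrow> (LINT x::'a|lebesgue. 0)"
  proof (rule integral_dominated_convergence[where w="\<lambda>x. 2 ^ p * \<bar>f x\<bar> ^ p"])
    show "AE x in lebesgue. (\<lambda>n. \<bar>f x - W (real n) x\<bar> ^ p) \<longlonglongrightarrow> 0"
    proof (rule AE_I2)
      fix x :: 'a
      obtain N :: nat where N: "real N \<ge> max \<bar>f x\<bar> (norm x)" using real_arch_simple by blast
      have "\<bar>f x - W (real n) x\<bar> ^ p = 0" if "n \<ge> N" for n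
      proof -
        have "real n \<ge> max \<bar>f x\<bar> (norm x)" using N that by (meson of_nat_le_iff order_trans)
        then have "W (real n) x = f x" using \<psi>(4)[of x "real n"] by (auto simp: W_def clamp_at_def)
        then show ?thesis using p by simp
      qed
      then show "(\<lambda>n. \<bar>f x - W (real n) x\<bar> ^ p) \<longlonglongrightarrow> 0"
        by (intro tendsto_eventually) (auto simp: eventually_sequentially)
    qed
    show "AE x in lebesgue. norm (\<bar>f x - W (real n) x\<bar> ^ p) \<le> 2 ^ p * \<bar>f x\<bar> ^ p" for n
      using dom[of "real n"] by (intro AE_I2) simp
    show "(\<lambda>x. \<bar>f x - W (real n) x\<bar> ^ p) \<in> borel_measurable lebesgue" for n using f by measurable
  qed (use fi in auto)
  moreover define e1 where "e1 = e / (2 * 2 ^ p)"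
  have e1: "e1 > 0" using e by (simp add: e1_def)
  ultimately obtain n where n: "(LINT x|lebesgue. \<bar>f x - W (real n) x\<bar> ^ p) < e1"
    using order_tendstoD(2)[of _ 0 sequentially e1] by (auto simp: eventually_sequentially)
  define R where "R = real n"
  have R0: "R \<ge> 0" by (simp add: R_def)
  have Wi: "integrable lebesgue (\<lambda>x. \<bar>f x - W R x\<bar> ^ p)"
    by (rule Bochner_Integration.integrable_bound[where f="\<lambda>x. 2 ^ p * \<bar>f x\<bar> ^ p"])
      (use fi f dom[OF R0] in \<open>auto intro!: AE_I2\<close>)
  have "f measurable_on UNIV" by (rule lebesgue_measurable_imp_measurable_on[OF f]) simp
  then obtain N h where N: "negligible N" and hc: "\<And>k. continuous_on UNIV (h k)"
    and h: "\<And>x. x \<notin> N \<Longrightarrow> (\<lambda>k. h k x) \<longlonglongrightarrow> f x"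
    unfolding measurable_on_def by auto
  define g where "g = (\<lambda>k x. clamp_at R (h k x) * \<psi> R x)"
  have gc: "continuous_on UNIV (g k)" for k
    unfolding g_def by (intro continuous_on_mult \<psi>c continuous_on_compose2[OF clc hc]) auto
  have gz: "g k x = 0" "W R x = 0" if "norm x > R + 1" for k x using \<psi>(3)[OF that] by (auto simp: g_def W_def)
  have gm [measurable]: "g k \<in> borel_measurable lebesgue" for k
    by (intro measurable_completion) (simp add: borel_measurable_continuous_onI gc)
  have gb: "\<bar>W R x - g k x\<bar> ^ p \<le> (2 * R) ^ p * indicator (cball 0 (R + 1)) x" for k x
  proof (cases "norm x > R + 1")
    case False
    have "\<bar>clamp_at R (f x) * \<psi> R x\<bar> \<le> R * 1" "\<bar>clamp_at R (h k x) * \<psi> R x\<bar> \<le> R * 1"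
      unfolding abs_mult using cl[OF R0] \<psi> R0 by (intro mult_mono; auto)+
    then have "\<bar>W R x - g k x\<bar> \<le> 2 * R" unfolding W_def g_def by linarith
    then have "\<bar>W R x - g k x\<bar> ^ p \<le> (2 * R) ^ p" by (intro power_mono) auto
    then show ?thesis using False by simp
  next
    case True
    then show ?thesis using R0 p by (simp add: gz power_0_left)
  qed
  have bi: "integrable lebesgue (\<lambda>x::'a. (2 * R) ^ p * indicator (cball 0 (R + 1)) x)"
    by (intro integrable_mult_right integrable_real_indicator) (use emeasure_lborel_cball_finite in auto)
  have "(\<lambda>k. LINT x|lebesgue. \<bar>W R x - g k x\<bar> ^ p) \<longlonglongrightarrow> (LINT x::'a|lebesgue. 0)"
  proof (rule integral_dominated_convergence[OF _ _ bi])
    have "AE x in lebesgue. x \<notin> N" using N by (intro AE_not_in) (simp add: negligible_iff_null_sets)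
    then show "AE x in lebesgue. (\<lambda>k. \<bar>W R x - g k x\<bar> ^ p) \<longlonglongrightarrow> 0"
    proof (rule eventually_mono)
      fix x assume x: "x \<notin> N"
      have "isCont (clamp_at R) (f x)" using clc[of R] by (simp add: continuous_on_eq_continuous_at)
      from isCont_tendsto_compose[OF this h[OF x]]
      have "(\<lambda>k. \<bar>W R x - g k x\<bar> ^ p) \<longlonglongrightarrow> \<bar>W R x - clamp_at R (f x) * \<psi> R x\<bar> ^ p"
        unfolding g_def by (intro tendsto_intros)
      moreover have "\<bar>W R x - clamp_at R (f x) * \<psi> R x\<bar> ^ p = 0" using p by (simp add: W_def)
      ultimately show "(\<lambda>k. \<bar>W R x - g k x\<bar> ^ p) \<longlonglongrightarrow> 0" by (simp only:)
    qed
    show "AE x in lebesgue. norm (\<bar>W R x - g k x\<bar> ^ p) \<le> (2 * R) ^ p * indicator (cball 0 (R + 1)) x" for k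
      using gb by (intro AE_I2) simp
  qed auto
  then obtain k where k: "(LINT x|lebesgue. \<bar>W R x - g k x\<bar> ^ p) < e1"
    using order_tendstoD(2)[of _ 0 sequentially e1] e1 by (auto simp: eventually_sequentially)
  have gi: "integrable lebesgue (\<lambda>x. \<bar>W R x - g k x\<bar> ^ p)"
  proof (rule Bochner_Integration.integrable_bound[OF bi])
    show "AE x in lebesgue. norm (\<bar>W R x - g k x\<bar> ^ p) \<le> norm ((2 * R) ^ p * indicator (cball 0 (R + 1)) x :: real)"
    proof (rule AE_I2)
      fix x
      show "norm (\<bar>W R x - g k x\<bar> ^ p) \<le> norm ((2 * R) ^ p * indicator (cball 0 (R + 1)) x :: real)"
        using order_trans[OF gb[of x k] abs_ge_self]
        by (simp only: real_norm_def abs_of_nonneg[OF zero_le_power[OF abs_ge_zero]])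
    qed
  qed auto
  have le: "\<bar>f x - g k x\<bar> ^ p \<le> 2 ^ p * (\<bar>f x - W R x\<bar> ^ p + \<bar>W R x - g k x\<bar> ^ p)" for x
    by (rule order_trans[OF power_mono power_add_le]) auto
  have ri: "integrable lebesgue (\<lambda>x. 2 ^ p * (\<bar>f x - W R x\<bar> ^ p + \<bar>W R x - g k x\<bar> ^ p))"
    using Wi gi by auto
  have fgi: "integrable lebesgue (\<lambda>x. \<bar>f x - g k x\<bar> ^ p)"
    by (rule Bochner_Integration.integrable_bound[OF ri]) (use f le in \<open>auto intro!: AE_I2\<close>)
  have "(LINT x|lebesgue. \<bar>f x - g k x\<bar> ^ p) \<le> (LINT x|lebesgue. 2 ^ p * (\<bar>f x - W R x\<bar> ^ p + \<bar>W R x - g k x\<bar> ^ p))"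
    using fgi ri le by (rule integral_mono)
  also have "\<dots> = 2 ^ p * ((LINT x|lebesgue. \<bar>f x - W R x\<bar> ^ p) + (LINT x|lebesgue. \<bar>W R x - g k x\<bar> ^ p))"
    using Wi gi by simp
  also have "\<dots> \<le> 2 ^ p * (e1 + e1)" using n k by (intro mult_left_mono add_mono) (auto simp: R_def)
  also have "\<dots> = e" by (simp add: e1_def)
  finally have "(LINT x|lebesgue. \<bar>f x - g k x\<bar> ^ p) \<le> e" .
  from that[OF gc gz(1) fgi this] show thesis .
qed

text \<open>By uniform continuity for continuous functions with compact support, and by density in general.\<close>

lemma translation_continuous_L1:
  fixes f :: "'a::euclidean_space \<Rightarrow> real"
  assumes f: "f \<in> borel_measurable borel" "integrable lborel f" and e: "e > 0"
  obtains d where "d > 0" "\<And>z. norm z \<le> d \<Longrightarrow> (\<integral>\<^sup>+x. ennreal \<bar>f (x + z) - f x\<bar> \<partial>lborel) \<le> ennreal e"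
proof -
  have fl: "f \<in> borel_measurable lebesgue" "integrable lebesgue f"
    using f by (auto intro: measurable_completion simp: integrable_completion)
  obtain g r where g: "continuous_on UNIV g" "\<And>x. norm x > r \<Longrightarrow> g x = 0"
    "integrable lebesgue (\<lambda>x. \<bar>f x - g x\<bar> ^ 1)" "(LINT x|lebesgue. \<bar>f x - g x\<bar> ^ 1) \<le> e / 3"
    using continuous_dense_Lp[of f 1 "e / 3"] fl e by auto
  have gm [measurable]: "g \<in> borel_measurable borel" by (rule borel_measurable_continuous_onI[OF g(1)])
  have fm [measurable]: "f \<in> borel_measurable borel" by (rule f)
  define r' where "r' = \<bar>r\<bar> + 1"
  define V where "V = measure lborel (cball (0::'a) r')"
  have eV: "emeasure lborel (cball (0::'a) r') = ennreal V"
    unfolding V_def by (rule emeasure_eq_ennreal_measure) (use emeasure_lborel_cball_finite[of "0::'a" r'] in auto)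
  have V: "V \<ge> 0" by (simp add: V_def)
  define e2 where "e2 = e / (3 * (V + 1))"
  have e2: "e2 > 0" using e V by (simp add: e2_def)
  have "uniformly_continuous_on (cball 0 (r' + 1)) g"
    by (rule compact_uniformly_continuous[OF continuous_on_subset[OF g(1)]]) auto
  then obtain d0 where d0: "d0 > 0" "\<And>x y. x \<in> cball 0 (r' + 1) \<Longrightarrow> y \<in> cball 0 (r' + 1) \<Longrightarrow> dist y x < d0 \<Longrightarrow> dist (g y) (g x) < e2"
    unfolding uniformly_continuous_on_def using e2 by metis
  define d where "d = min 1 (d0 / 2)"
  have close: "\<bar>g (x + z) - g x\<bar> \<le> e2 * indicator (cball 0 r') x" if z: "norm z \<le> d" for x z
  proof (cases "norm x \<le> r'")
    case True
    have "norm (x + z) \<le> r' + 1" using True z norm_triangle_ineq[of x z] by (simp add: d_def)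
    then have "dist (g (x + z)) (g x) < e2"
      using d0(1) True z by (intro d0(2)) (simp_all only: mem_cball_0, auto simp: d_def dist_norm)
    then show ?thesis using True by (simp add: dist_norm)
  next
    case False
    have "norm z \<le> 1" using z by (simp add: d_def)
    moreover have "norm x \<le> norm (x + z) + norm z" using norm_triangle_ineq4[of "x + z" z] by simp
    ultimately have "norm (x + z) > r" using False abs_ge_self[of r] unfolding r'_def by linarith
    moreover have "norm x > r" using False by (simp add: r'_def)
    ultimately show ?thesis using g(2) e2 by (simp add: indicator_def)
  qed
  have fg: "(\<integral>\<^sup>+x. ennreal \<bar>f x - g x\<bar> \<partial>lborel) \<le> ennreal (e / 3)"
  proof -
    have i: "integrable lborel (\<lambda>x. \<bar>f x - g x\<bar>)" using g(3) by (subst (asm) integrable_completion) auto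
    have "(\<integral>\<^sup>+x. ennreal \<bar>f x - g x\<bar> \<partial>lborel) = ennreal (LINT x|lborel. \<bar>f x - g x\<bar>)"
      by (rule nn_integral_eq_integral[OF i]) simp
    also have "(LINT x|lborel. \<bar>f x - g x\<bar>) = (LINT x|lebesgue. \<bar>f x - g x\<bar> ^ 1)"
      by (subst integral_completion) auto
    finally show ?thesis using g(4) by (simp add: ennreal_leI)
  qed
  show thesis
  proof
    show "d > 0" using d0 by (simp add: d_def)
    fix z :: 'a assume z: "norm z \<le> d"
    have tr: "(\<integral>\<^sup>+x. ennreal \<bar>f (x + z) - g (x + z)\<bar> \<partial>lborel) = (\<integral>\<^sup>+x. ennreal \<bar>f x - g x\<bar> \<partial>lborel)"
    proof -
      have "(\<integral>\<^sup>+x. ennreal \<bar>f x - g x\<bar> \<partial>lborel) = (\<integral>\<^sup>+x. ennreal \<bar>f x - g x\<bar> \<partial>distr lborel borel ((+) z))"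
        by (simp add: lborel_distr_plus)
      also have "\<dots> = (\<integral>\<^sup>+x. ennreal \<bar>f (z + x) - g (z + x)\<bar> \<partial>lborel)" by (subst nn_integral_distr) auto
      finally show ?thesis by (simp add: add.commute)
    qed
    have "(\<integral>\<^sup>+x. ennreal \<bar>f (x + z) - f x\<bar> \<partial>lborel) \<le>
        (\<integral>\<^sup>+x. ennreal \<bar>f (x + z) - g (x + z)\<bar> + ennreal (e2 * indicator (cball 0 r') x) + ennreal \<bar>f x - g x\<bar> \<partial>lborel)"
    proof (rule nn_integral_mono)
      fix x
      have "\<bar>f (x + z) - f x\<bar> \<le> \<bar>f (x + z) - g (x + z)\<bar> + e2 * indicator (cball 0 r') x + \<bar>f x - g x\<bar>"
        using close[OF z, of x] by linarith
      then have "ennreal \<bar>f (x + z) - f x\<bar> \<le> ennreal (\<bar>f (x + z) - g (x + z)\<bar> + e2 * indicator (cball 0 r') x + \<bar>f x - g x\<bar>)"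
        by (rule ennreal_leI)
      then show "ennreal \<bar>f (x + z) - f x\<bar> \<le> ennreal \<bar>f (x + z) - g (x + z)\<bar> + ennreal (e2 * indicator (cball 0 r') x) + ennreal \<bar>f x - g x\<bar>"
        using e2 by (simp add: ennreal_plus)
    qed
    also have "\<dots> = (\<integral>\<^sup>+x. ennreal \<bar>f x - g x\<bar> \<partial>lborel) + (\<integral>\<^sup>+x. ennreal (e2 * indicator (cball (0::'a) r') x) \<partial>lborel)
        + (\<integral>\<^sup>+x. ennreal \<bar>f x - g x\<bar> \<partial>lborel)"
    proof -
      have m1: "(\<lambda>x. ennreal \<bar>f (x + z) - g (x + z)\<bar>) \<in> borel_measurable lborel"
        by (intro measurable_compose[OF _ measurable_ennreal] borel_measurable_abs borel_measurable_diff
            measurable_compose[OF _ fm] measurable_compose[OF _ gm]) auto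
      have m2: "(\<lambda>x. ennreal (e2 * indicator (cball (0::'a) r') x)) \<in> borel_measurable lborel"
        by (intro measurable_compose[OF _ measurable_ennreal] borel_measurable_times borel_measurable_const
            borel_measurable_indicator) auto
      have m3: "(\<lambda>x. ennreal \<bar>f x - g x\<bar>) \<in> borel_measurable lborel" by measurable
      show ?thesis
        unfolding nn_integral_add[OF borel_measurable_add[OF m1 m2] m3] nn_integral_add[OF m1 m2] tr ..
    qed
    also have "(\<integral>\<^sup>+x. ennreal (e2 * indicator (cball (0::'a) r') x) \<partial>lborel) = ennreal e2 * ennreal V"
      using e2 by (simp add: ennreal_mult ennreal_indicator nn_integral_cmult_indicator eV)
    also have "\<dots> = ennreal (e2 * V)" using e2 V by (simp add: ennreal_mult)
    also have "(\<integral>\<^sup>+x. ennreal \<bar>f x - g x\<bar> \<partial>lborel) + ennreal (e2 * V) + (\<integral>\<^sup>+x. ennreal \<bar>f x - g x\<bar> \<partial>lborel)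
       \<le> ennreal (e / 3) + ennreal (e / 3) + ennreal (e / 3)"
    proof (intro add_mono fg)
      show "ennreal (e2 * V) \<le> ennreal (e / 3)"
        using e V by (intro ennreal_leI) (simp add: e2_def field_simps)
    qed
    also have "\<dots> = ennreal e" using e by (simp add: ennreal_plus[symmetric] del: ennreal_plus)
    finally show "(\<integral>\<^sup>+x. ennreal \<bar>f (x + z) - f x\<bar> \<partial>lborel) \<le> ennreal e" .
  qed
qed

section \<open>Interior continuity\<close>

text \<open>The two cases \<open>m = 0\<close> and \<open>m = 2\<close> are linked by \<open>grad_bump_0\<close>: the kernel \<open>bump 2 z\<close> times \<open>z\<close> is a
  gradient field.\<close>

definition bump :: "nat \<Rightarrow> 'a::euclidean_space \<Rightarrow> real" where
  "bump m z = flat m (1 - z \<bullet> z)"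

lemma smooth_one_minus_sq: "smooth (\<lambda>z::'a::euclidean_space. 1 - z \<bullet> z)"
proof -
  have "smooth (\<lambda>z::'a. 1 - (\<Sum>i\<in>Basis. (z \<bullet> i) * (z \<bullet> i)))"
    by (intro smooth_diff smooth_const smooth_sum smooth_mult smooth_inner)
  moreover have "(\<lambda>z::'a. 1 - (\<Sum>i\<in>Basis. (z \<bullet> i) * (z \<bullet> i))) = (\<lambda>z. 1 - z \<bullet> z)"
    by (intro ext) (simp add: euclidean_inner[symmetric])
  ultimately show ?thesis by simp
qed

lemma smooth_bump: "smooth (bump m)"
  unfolding bump_def[abs_def] by (rule smooth_flat_compose[OF smooth_one_minus_sq])

lemma grad_bump_0: "grad (bump 0) z = (- 2 * bump 2 z) *\<^sub>R z"
proof -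
  have "GDERIV (\<lambda>z::'a. 1 - z \<bullet> z) z :> (- 2) *\<^sub>R z"
    unfolding gderiv_def by (auto intro!: derivative_eq_intros simp: inner_commute)
  then have "grad (\<lambda>z::'a. 1 - z \<bullet> z) z = (- 2) *\<^sub>R z" by (rule grad_eq)
  moreover have "grad (bump 0) z = (flat 2 (1 - z \<bullet> z)) *\<^sub>R grad (\<lambda>z::'a. 1 - z \<bullet> z) z"
    unfolding bump_def[abs_def] using grad_flat_compose[OF smooth_one_minus_sq, of 0 z]
    by (simp add: numeral_2_eq_2)
  ultimately show ?thesis by (simp add: bump_def)
qed

lemma bump_nonneg: "0 \<le> bump m z" by (simp add: bump_def flat_nonneg)

lemma bump_outside: "z \<notin> cball 0 1 \<Longrightarrow> bump m z = 0"
proof -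
  assume "z \<notin> cball 0 1"
  then have "1 < norm z" by simp
  then have "1 * 1 \<le> norm z * norm z" by (intro mult_mono) auto
  then have "1 \<le> (norm z)\<^sup>2" by (simp add: power2_eq_square)
  then show ?thesis unfolding bump_def by (intro flat_nonpos) (simp add: power2_norm_eq_inner)
qed

lemma bump_pos: "norm z < 1 \<Longrightarrow> 0 < bump m z"
  unfolding bump_def
  by (intro flat_pos) (simp add: power2_norm_eq_inner[symmetric] power_less_one_iff)

lemma bump_test: "bump m \<in> test_functions (cball 0 1 :: 'a::euclidean_space set)"
  by (rule test_functionsI[OF smooth_bump, of "cball 0 1"]) (auto intro: bump_outside simp del: mem_cball_0)

lemma bump_integrable: "integrable lborel (bump m :: 'a::euclidean_space \<Rightarrow> real)"
  by (rule integrable_compact_support[OF smooth_continuous_on[OF smooth_bump], of "cball 0 1"])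
    (auto intro: bump_outside simp del: mem_cball_0)

lemma bump_measurable [measurable]: "bump m \<in> borel_measurable borel"
  by (intro borel_measurable_continuous_onI smooth_continuous_on smooth_bump)

lemma integral_bump_pos: "0 < (LINT z|lborel. bump m (z::'a::euclidean_space))"
proof -
  have "(LINT z|lborel. bump m (z::'a)) \<noteq> 0"
  proof
    assume "(LINT z|lborel. bump m (z::'a)) = 0"
    then have "AE z in lborel. bump m (z::'a) = 0"
      using integral_nonneg_eq_0_iff_AE[OF bump_integrable] bump_nonneg by auto
    then have "AE z in lborel. (z::'a) \<notin> ball 0 1"
      by (rule eventually_mono) (use bump_pos[of _ m] in force)
    then have "AE z in lebesgue. (z::'a) \<notin> ball 0 1" by (rule AE_completion)
    then have "negligible (ball (0::'a) 1)"
      by (subst negligible_iff_null_sets, subst completion.null_sets_iff_AE) auto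
    then show False using open_not_negligible[of "ball (0::'a) 1"] by simp
  qed
  moreover have "0 \<le> (LINT z|lborel. bump m (z::'a))" by (intro integral_nonneg_AE) (simp add: bump_nonneg)
  ultimately show ?thesis by simp
qed

lemma test_bounded:
  assumes "\<phi> \<in> test_functions Om"
  obtains C where "C > 0" "\<And>x. \<bar>\<phi> x\<bar> \<le> C" "\<And>x. norm (grad \<phi> x) \<le> C"
proof -
  obtain K where K: "compact K" "smooth \<phi>" "\<And>x. x \<notin> K \<Longrightarrow> \<phi> x = 0" "\<And>x. x \<notin> K \<Longrightarrow> grad \<phi> x = 0"
    using assms by (rule test_functionsE) blast
  obtain C1 where C1: "C1 > 0" "\<And>x. norm (\<phi> x) \<le> C1"
    using compact_support_bounded[OF smooth_continuous_on[OF K(2)] K(1,3)] by blast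
  obtain C2 where C2: "C2 > 0" "\<And>x. norm (grad \<phi> x) \<le> C2"
    using compact_support_bounded[OF smooth_continuous_grad[OF K(2)] K(1,4)] by blast
  have "\<bar>\<phi> x\<bar> \<le> C1 + C2" "norm (grad \<phi> x) \<le> C1 + C2" for x
    using C1(2)[of x] C2(2)[of x] C1(1) C2(1) by auto
  then show thesis using that[of "C1 + C2"] C1(1) C2(1) by auto
qed

text \<open>The averages are not normalized: the mass of the kernel is the integral of \<open>bump 2\<close> for every \<open>\<rho>\<close>.\<close>

definition avg :: "('a::euclidean_space \<Rightarrow> real) \<Rightarrow> real \<Rightarrow> 'a \<Rightarrow> real" where
  "avg W \<rho> x = (LINT y|lborel. W y * (\<rho> ^ DIM('a) * bump 2 (\<rho> *\<^sub>R (y - x))))"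

context
  fixes W :: "'a::euclidean_space \<Rightarrow> real"
  assumes Wm [measurable]: "W \<in> borel_measurable borel" and Wi: "integrable lborel W"
begin

lemma W_bounded_integrable:
  assumes [measurable]: "T \<in> borel_measurable borel" and "\<And>y. \<bar>T y\<bar> \<le> C"
  shows "integrable lborel (\<lambda>y. W y * T y)"
proof (rule Bochner_Integration.integrable_bound[where f="\<lambda>y. C * W y"])
  show "integrable lborel (\<lambda>y. C * W y)" using Wi by simp
  show "(\<lambda>y. W y * T y) \<in> borel_measurable lborel" by measurable
  have "\<bar>W y\<bar> * \<bar>T y\<bar> \<le> \<bar>W y\<bar> * \<bar>C\<bar>" for y
    using assms(2)[of y] by (intro mult_left_mono) auto
  then show "AE y in lborel. norm (W y * T y) \<le> norm (C * W y)"
    by (intro AE_I2) (simp add: abs_mult mult.commute)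
qed

lemma avg_integrable: "integrable lborel (\<lambda>y. W y * (\<rho> ^ DIM('a) * bump 2 (\<rho> *\<^sub>R (y - x))))"
proof -
  obtain C where C: "\<And>z::'a. \<bar>bump 2 z\<bar> \<le> C" using test_bounded[OF bump_test] by blast
  show ?thesis
  proof (rule W_bounded_integrable)
    show "\<bar>\<rho> ^ DIM('a) * bump 2 (\<rho> *\<^sub>R (y - x))\<bar> \<le> \<bar>\<rho> ^ DIM('a)\<bar> * C" for y
      unfolding abs_mult using C by (intro mult_left_mono) auto
  qed measurable
qed

lemma avg_continuous: "continuous_on UNIV (avg W \<rho>)"
proof -
  obtain C where C: "\<And>z::'a. \<bar>bump 2 z\<bar> \<le> C" using test_bounded[OF bump_test] by blast
  have "isCont (avg W \<rho>) x" for x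
  proof (rule continuous_at_sequentiallyI)
    fix X :: "nat \<Rightarrow> 'a" assume X: "X \<longlonglongrightarrow> x"
    show "(\<lambda>n. avg W \<rho> (X n)) \<longlonglongrightarrow> avg W \<rho> x"
      unfolding avg_def
    proof (rule integral_dominated_convergence[where w="\<lambda>y. \<bar>\<rho> ^ DIM('a)\<bar> * C * \<bar>W y\<bar>"])
      show "integrable lborel (\<lambda>y. \<bar>\<rho> ^ DIM('a)\<bar> * C * \<bar>W y\<bar>)" using Wi by auto
      have "continuous_on UNIV (bump 2 :: 'a \<Rightarrow> real)" by (rule smooth_continuous_on[OF smooth_bump])
      then have "isCont (bump 2) z" for z :: 'a by (simp add: continuous_on_eq_continuous_at)
      then show "AE y in lborel. (\<lambda>n. W y * (\<rho> ^ DIM('a) * bump 2 (\<rho> *\<^sub>R (y - X n))))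
          \<longlonglongrightarrow> W y * (\<rho> ^ DIM('a) * bump 2 (\<rho> *\<^sub>R (y - x)))"
        by (intro AE_I2 tendsto_intros X isCont_tendsto_compose[of _ "bump 2"])
      have "\<bar>W y * (\<rho> ^ DIM('a) * bump 2 z)\<bar> \<le> \<bar>\<rho> ^ DIM('a)\<bar> * C * \<bar>W y\<bar>" for y z :: 'a
      proof -
        have "\<bar>\<rho> ^ DIM('a)\<bar> * \<bar>W y\<bar> * \<bar>bump 2 z\<bar> \<le> \<bar>\<rho> ^ DIM('a)\<bar> * \<bar>W y\<bar> * C"
          using C by (intro mult_left_mono) auto
        then show ?thesis by (simp add: abs_mult mult_ac)
      qed
      then show "AE y in lborel. norm (W y * (\<rho> ^ DIM('a) * bump 2 (\<rho> *\<^sub>R (y - X n)))) \<le> \<bar>\<rho> ^ DIM('a)\<bar> * C * \<bar>W y\<bar>" for n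
        by simp
    qed measurable
  qed
  then show ?thesis by (simp add: continuous_on_eq_continuous_at)
qed

text \<open>The scale enters as \<open>\<rho>\<close> and not as the radius because the kernel is then a power of \<open>\<rho>\<close> times
  a function of \<open>\<rho> *\<^sub>R (y - x)\<close>.\<close>

lemma avg_DERIV:
  assumes \<rho>: "\<rho> > 0"
  shows "((\<lambda>\<rho>. avg W \<rho> x) has_real_derivative
     (LINT y|lborel. W y * (\<rho> ^ (DIM('a) - 1) *
       (real DIM('a) * bump 2 (\<rho> *\<^sub>R (y - x)) + \<rho> * (grad (bump 2) (\<rho> *\<^sub>R (y - x)) \<bullet> (y - x)))))) (at \<rho>)"
proof -
  obtain C where C: "C > 0" "\<And>z::'a. \<bar>bump 2 z\<bar> \<le> C" "\<And>z::'a. norm (grad (bump 2) z) \<le> C"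
    using test_bounded[OF bump_test] by blast
  define N where "N = DIM('a)"
  have N: "N > 0" by (simp add: N_def)
  define C' where "C' = (2 * \<rho>) ^ (N - 1) * (real N * C + C)"
  show ?thesis
    unfolding avg_def
  proof (rule DERIV_under_integral[of "\<rho> / 2" \<rho> "2 * \<rho>"])
    show "integrable lborel (\<lambda>y. C' * \<bar>W y\<bar>)" using Wi by auto
    fix t :: real assume t: "\<rho> / 2 < t" "t < 2 * \<rho>"
    then have t0: "t > 0" using \<rho> by linarith
    show "integrable lborel (\<lambda>y. W y * (t ^ DIM('a) * bump 2 (t *\<^sub>R (y - x))))" by (rule avg_integrable)
    fix y
    have "((\<lambda>t. t *\<^sub>R (y - x)) has_derivative (\<lambda>h. h *\<^sub>R (y - x))) (at t)"
      by (auto intro!: derivative_eq_intros)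
    from diff_chain_at[OF this smooth_GDERIV[OF smooth_bump, unfolded gderiv_def]]
    have D: "((\<lambda>t. bump 2 (t *\<^sub>R (y - x))) has_real_derivative grad (bump 2) (t *\<^sub>R (y - x)) \<bullet> (y - x)) (at t)"
      unfolding has_field_derivative_def o_def
      by (rule has_derivative_eq_rhs) (auto simp: inner_commute mult.commute)
    have pw: "t ^ DIM('a) = t ^ (DIM('a) - 1) * t"
      using N by (metis N_def One_nat_def Suc_pred power_Suc2)
    show "((\<lambda>t. W y * (t ^ DIM('a) * bump 2 (t *\<^sub>R (y - x)))) has_real_derivative
        W y * (t ^ (DIM('a) - 1) * (real DIM('a) * bump 2 (t *\<^sub>R (y - x)) + t * (grad (bump 2) (t *\<^sub>R (y - x)) \<bullet> (y - x))))) (at t)"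
    proof -
      have "((\<lambda>t. t ^ DIM('a) * bump 2 (t *\<^sub>R (y - x))) has_real_derivative
          real DIM('a) * t ^ (DIM('a) - 1) * bump 2 (t *\<^sub>R (y - x)) + (grad (bump 2) (t *\<^sub>R (y - x)) \<bullet> (y - x)) * t ^ DIM('a)) (at t)"
        using DERIV_mult[OF DERIV_pow[of "DIM('a)" t] D] by simp
      then have "((\<lambda>t. W y * (t ^ DIM('a) * bump 2 (t *\<^sub>R (y - x)))) has_real_derivative
          W y * (real DIM('a) * t ^ (DIM('a) - 1) * bump 2 (t *\<^sub>R (y - x)) + (grad (bump 2) (t *\<^sub>R (y - x)) \<bullet> (y - x)) * t ^ DIM('a))) (at t)"
        by (rule DERIV_cmult)
      then show ?thesis unfolding pw by (simp add: algebra_simps)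
    qed
    show "\<bar>W y * (t ^ (DIM('a) - 1) * (real DIM('a) * bump 2 (t *\<^sub>R (y - x)) + t * (grad (bump 2) (t *\<^sub>R (y - x)) \<bullet> (y - x))))\<bar> \<le> C' * \<bar>W y\<bar>"
    proof -
      define w where "w = t *\<^sub>R (y - x)"
      have "t * (grad (bump 2) w \<bullet> (y - x)) = grad (bump 2) w \<bullet> w" by (simp add: w_def)
      moreover have "\<bar>grad (bump 2) w \<bullet> w\<bar> \<le> C"
      proof (cases "w \<in> cball 0 1")
        case True
        have "\<bar>grad (bump 2) w \<bullet> w\<bar> \<le> norm (grad (bump 2) w) * norm w" by (rule Cauchy_Schwarz_ineq2)
        also have "\<dots> \<le> C * 1" using C True by (intro mult_mono) auto
        finally show ?thesis by simp
      next
        case False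
        have "grad (bump 2) w = 0" by (rule test_outside(2)[OF bump_test False])
        then show ?thesis using C by simp
      qed
      moreover have "\<bar>real N * bump 2 w\<bar> \<le> real N * C" unfolding abs_mult using C by (intro mult_mono) auto
      ultimately have "\<bar>real N * bump 2 w + t * (grad (bump 2) w \<bullet> (y - x))\<bar> \<le> real N * C + C" by linarith
      moreover have "t ^ (N - 1) \<le> (2 * \<rho>) ^ (N - 1)" using t t0 by (intro power_mono) auto
      ultimately have "t ^ (N - 1) * \<bar>real N * bump 2 w + t * (grad (bump 2) w \<bullet> (y - x))\<bar> \<le> C'"
        unfolding C'_def using t0 \<rho> by (intro mult_mono) auto
      then have "\<bar>W y\<bar> * (t ^ (N - 1) * \<bar>real N * bump 2 w + t * (grad (bump 2) w \<bullet> (y - x))\<bar>) \<le> \<bar>W y\<bar> * C'"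
        by (intro mult_left_mono) auto
      then show ?thesis unfolding w_def[symmetric] N_def[symmetric] using t0 by (simp add: abs_mult mult_ac)
    qed
  qed (use \<rho> in auto)
qed

lemma avg_rescaled:
  assumes r: "r > 0"
  shows "avg W (1 / r) x = (LINT z|lborel. W (x + r *\<^sub>R z) * bump 2 z)"
    "integrable lborel (\<lambda>z. W (x + r *\<^sub>R z) * bump 2 z)"
proof -
  define F where "F = (\<lambda>y. W y * ((1 / r) ^ DIM('a) * bump 2 ((1 / r) *\<^sub>R (y - x))))"
  have Fm [measurable]: "F \<in> borel_measurable borel" unfolding F_def by measurable
  have Fl: "F \<in> borel_measurable lebesgue" by (intro measurable_completion) simp
  have Fi: "integrable lebesgue F"
    using avg_integrable[of "1 / r" x] by (subst integrable_completion) (auto simp: F_def)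
  have FT: "F (x + r *\<^sub>R z) = (1 / r) ^ DIM('a) * (W (x + r *\<^sub>R z) * bump 2 z)" for z
    using r by (simp add: F_def)
  have m: "(\<lambda>z. F (x + r *\<^sub>R z)) \<in> borel_measurable borel" by measurable
  have i: "integrable lborel (\<lambda>z. F (x + r *\<^sub>R z))"
  proof (rule integrable_completion[THEN iffD1])
    show "integrable lebesgue (\<lambda>z. F (x + r *\<^sub>R z))"
      using lebesgue_integral_affine(1)[OF _ Fl, of r x] Fi r by simp
  qed (use m in simp)
  have e: "(LINT z|lborel. F (x + r *\<^sub>R z)) = (1 / r ^ DIM('a)) * (LINT y|lborel. F y)"
    using lebesgue_integral_affine(2)[OF _ Fl, of r x] r m by (simp add: integral_completion)
  have "integrable lborel (\<lambda>z. r ^ DIM('a) * F (x + r *\<^sub>R z))" using i by simp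
  then show "integrable lborel (\<lambda>z. W (x + r *\<^sub>R z) * bump 2 z)"
    using r by (simp add: FT power_divide)
  have "avg W (1 / r) x = (LINT y|lborel. F y)" by (simp add: avg_def F_def)
  also have "\<dots> = r ^ DIM('a) * (LINT z|lborel. F (x + r *\<^sub>R z))" using e r by simp
  also have "\<dots> = (LINT z|lborel. W (x + r *\<^sub>R z) * bump 2 z)"
    using r by (simp add: FT power_divide)
  finally show "avg W (1 / r) x = (LINT z|lborel. W (x + r *\<^sub>R z) * bump 2 z)" .
qed

text \<open>Averaging converges in $L^1$ (up to the mass of the kernel): by Tonelli's theorem the error is an average
  of translation errors.\<close>

lemma avg_L1_limit:
  assumes e: "e > 0"
  obtains d where "d > 0" "\<And>r. 0 < r \<Longrightarrow> r \<le> d \<Longrightarrow>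
    (\<integral>\<^sup>+x. ennreal \<bar>avg W (1 / r) x - (LINT z|lborel. bump 2 (z::'a)) * W x\<bar> \<partial>lborel) \<le> ennreal e"
proof -
  define c where "c = (LINT z|lborel. bump 2 (z::'a))"
  have c: "c > 0" unfolding c_def by (rule integral_bump_pos)
  obtain d where d: "d > 0" "\<And>z. norm z \<le> d \<Longrightarrow> (\<integral>\<^sup>+x. ennreal \<bar>W (x + z) - W x\<bar> \<partial>lborel) \<le> ennreal (e / c)"
    using translation_continuous_L1[OF Wm Wi, of "e / c"] e c by auto
  have cn: "(\<integral>\<^sup>+z. ennreal (bump 2 (z::'a)) \<partial>lborel) = ennreal c"
    unfolding c_def by (rule nn_integral_eq_integral[OF bump_integrable]) (simp add: bump_nonneg)
  show thesis
  proof (rule that[OF d(1)])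
    fix r :: real assume r: "0 < r" "r \<le> d"
    have "(\<integral>\<^sup>+x. ennreal \<bar>avg W (1 / r) x - c * W x\<bar> \<partial>lborel)
      \<le> (\<integral>\<^sup>+x. \<integral>\<^sup>+z. ennreal (\<bar>W (x + r *\<^sub>R z) - W x\<bar> * bump 2 z) \<partial>lborel \<partial>lborel)"
    proof (rule nn_integral_mono)
      fix x
      have i: "integrable lborel (\<lambda>z. (W (x + r *\<^sub>R z) - W x) * bump 2 z)"
        using avg_rescaled(2)[OF r(1), of x] bump_integrable[of 2, where 'a='a] by (simp add: left_diff_distrib)
      have "avg W (1 / r) x - c * W x = (LINT z|lborel. (W (x + r *\<^sub>R z) - W x) * bump 2 z)"
      proof -
        have "(LINT z|lborel. (W (x + r *\<^sub>R z) - W x) * bump 2 z)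
            = (LINT z|lborel. W (x + r *\<^sub>R z) * bump 2 z - W x * bump 2 z)"
          by (simp only: left_diff_distrib)
        also have "\<dots> = (LINT z|lborel. W (x + r *\<^sub>R z) * bump 2 z) - (LINT z|lborel. W x * bump 2 (z::'a))"
          by (intro Bochner_Integration.integral_diff avg_rescaled(2) r integrable_mult_right bump_integrable)
        finally show ?thesis by (simp add: avg_rescaled(1)[OF r(1)] c_def mult.commute)
      qed
      then have "ennreal \<bar>avg W (1 / r) x - c * W x\<bar> \<le> (\<integral>\<^sup>+z. ennreal (norm ((W (x + r *\<^sub>R z) - W x) * bump 2 z)) \<partial>lborel)"
        using integral_norm_bound_ennreal[OF i] by simp
      then show "ennreal \<bar>avg W (1 / r) x - c * W x\<bar> \<le> (\<integral>\<^sup>+z. ennreal (\<bar>W (x + r *\<^sub>R z) - W x\<bar> * bump 2 z) \<partial>lborel)"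
        by (simp add: abs_mult bump_nonneg)
    qed
    also have "\<dots> = (\<integral>\<^sup>+z. \<integral>\<^sup>+x. ennreal (\<bar>W (x + r *\<^sub>R z) - W x\<bar> * bump 2 z) \<partial>lborel \<partial>lborel)"
      by (rule lborel_pair.Fubini'[symmetric]) measurable
    also have "\<dots> \<le> (\<integral>\<^sup>+z. ennreal (e / c) * ennreal (bump 2 (z::'a)) \<partial>lborel)"
    proof (rule nn_integral_mono)
      fix z :: 'a
      show "(\<integral>\<^sup>+x. ennreal (\<bar>W (x + r *\<^sub>R z) - W x\<bar> * bump 2 z) \<partial>lborel) \<le> ennreal (e / c) * ennreal (bump 2 z)"
      proof (cases "z \<in> cball 0 1")
        case True
        then have "norm (r *\<^sub>R z) \<le> d * 1" using r unfolding norm_scaleR by (intro mult_mono) auto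
        then have le: "(\<integral>\<^sup>+x. ennreal \<bar>W (x + r *\<^sub>R z) - W x\<bar> \<partial>lborel) \<le> ennreal (e / c)" using d(2) by simp
        have "(\<integral>\<^sup>+x. ennreal (\<bar>W (x + r *\<^sub>R z) - W x\<bar> * bump 2 z) \<partial>lborel)
            = (\<integral>\<^sup>+x. ennreal \<bar>W (x + r *\<^sub>R z) - W x\<bar> * ennreal (bump 2 z) \<partial>lborel)"
          by (simp add: ennreal_mult bump_nonneg)
        also have "\<dots> = (\<integral>\<^sup>+x. ennreal \<bar>W (x + r *\<^sub>R z) - W x\<bar> \<partial>lborel) * ennreal (bump 2 z)"
          by (rule nn_integral_multc) measurable
        also have "\<dots> \<le> ennreal (e / c) * ennreal (bump 2 z)" using le by (rule mult_right_mono) simp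
        finally show ?thesis .
      qed (simp add: bump_outside del: mem_cball_0)
    qed
    also have "\<dots> = ennreal (e / c) * ennreal c" by (simp add: nn_integral_cmult cn)
    also have "\<dots> = ennreal e" using c e by (simp add: ennreal_mult[symmetric])
    finally show "(\<integral>\<^sup>+x. ennreal \<bar>avg W (1 / r) x - (LINT z|lborel. bump 2 (z::'a)) * W x\<bar> \<partial>lborel) \<le> ennreal e"
      by (simp add: c_def)
  qed
qed

end

context bounded_open begin

text \<open>Up to a factor the derivative of the averaging kernel with respect to the scale is the Laplacian of
  the rescaled test function \<open>\<zeta>\<close>, by \<open>grad_bump_0\<close>.  The weak equation replaces the Laplacian of \<open>u\<close> by the
  bounded function \<open>h\<close>; after scaling, the derivative with respect to the radius is at most a multiple of
  the radius.\<close>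

lemma avg_lipschitz:
  fixes u h W :: "'a \<Rightarrow> real"
  defines "Z \<equiv> (LINT z|lborel. bump 0 (z::'a))"
  assumes u: "u \<in> H1 Om" and h: "h \<in> borel_measurable M" "\<And>x. \<bar>h x\<bar> \<le> C"
    and eq: "\<And>\<phi>. \<phi> \<in> test_functions Om \<Longrightarrow> (LINT x|M. wgrad Om u x \<bullet> grad \<phi> x) = (LINT x|M. h x * \<phi> x)"
    and W: "W \<in> borel_measurable borel" "integrable lborel W" "AE x in lebesgue. x \<in> Om \<longrightarrow> W x = u x"
    and r0: "r0 \<le> 1" "cball x r0 \<subseteq> Om" and rs: "0 < r" "r < r0" "0 < s" "s < r0"
  shows "\<bar>avg W (1 / r) x - avg W (1 / s) x\<bar> \<le> C * Z / 2 * \<bar>r - s\<bar>"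
proof -
  have Z: "Z > 0" unfolding Z_def by (rule integral_bump_pos)
  have C0: "C \<ge> 0" using h(2)[of undefined] by linarith
  have main: "\<exists>D. ((\<lambda>r. avg W (1 / r) x) has_real_derivative D) (at r) \<and> \<bar>D\<bar> \<le> C * Z / 2"
    if r: "0 < r" "r < r0" for r
  proof -
    define \<rho> where "\<rho> = 1 / r"
    have \<rho>: "\<rho> > 0" "\<rho> \<ge> 1" using r r0(1) by (auto simp: \<rho>_def)
    define a where "a = - (\<rho> *\<^sub>R x)"
    have w: "\<rho> *\<^sub>R y + a = \<rho> *\<^sub>R (y - x)" for y by (simp add: a_def scaleR_diff_right)
    define \<zeta> where "\<zeta> = (\<lambda>y. bump 0 (\<rho> *\<^sub>R y + a))"
    define P where "P = (\<lambda>y. bump 2 (\<rho> *\<^sub>R y + a))"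
    define T where "T = (\<lambda>y. real DIM('a) * P y + \<rho> * (grad (bump 2) (\<rho> *\<^sub>R y + a) \<bullet> (y - x)))"
    have sm: "smooth \<zeta>" "smooth P" unfolding \<zeta>_def P_def by (intro smooth_affine smooth_bump)+
    have \<zeta>t: "\<zeta> \<in> test_functions Om"
    proof (rule test_functionsI[OF sm(1), of "cball x r"])
      show "cball x r \<subseteq> Om" using r0(2) r(2) by (meson less_imp_le order_trans subset_cball)
      show "\<zeta> y = 0" if "y \<notin> cball x r" for y
      proof -
        have "r < norm (y - x)" using that by (simp add: dist_norm norm_minus_commute)
        then have "1 < \<rho> * norm (y - x)" using r by (simp add: \<rho>_def field_simps)
        then have "1 < norm (\<rho> *\<^sub>R (y - x))" using \<rho> by (simp only: norm_scaleR abs_of_pos)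
        then have "\<rho> *\<^sub>R (y - x) \<notin> cball 0 1" by (simp only: mem_cball_0 not_le)
        then show ?thesis unfolding \<zeta>_def w by (rule bump_outside)
      qed
    qed simp
    have g\<zeta>: "grad \<zeta> y = (- 2 * \<rho>\<^sup>2 * P y) *\<^sub>R (y - x)" for y
      unfolding \<zeta>_def using grad_affine[OF smooth_bump[of 0], of \<rho> a y]
      by (simp add: grad_bump_0 P_def w power2_eq_square)
    define Q where "Q = (\<lambda>i y. y \<bullet> i - x \<bullet> i)"
    have Qs: "smooth (Q i)" for i unfolding Q_def by (intro smooth_diff smooth_inner smooth_const)
    have gQ: "grad (Q i) y = i" for i y
      unfolding Q_def by (rule grad_eq) (auto simp: gderiv_def intro!: derivative_eq_intros)
    have \<psi>: "(\<lambda>y. grad \<zeta> y \<bullet> i) = (\<lambda>y. (- 2 * \<rho>\<^sup>2) * (P y * Q i y))" for i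
      by (rule ext) (simp add: g\<zeta> Q_def inner_diff_left)
    have gP: "grad P y = \<rho> *\<^sub>R grad (bump 2) (\<rho> *\<^sub>R y + a)" for y
      unfolding P_def by (rule grad_affine[OF smooth_bump])
    \<comment> \<open>\<open>T\<close> is the factor in \<open>avg_DERIV\<close>.\<close>
    have lap: "(\<Sum>i\<in>Basis. grad (\<lambda>y. grad \<zeta> y \<bullet> i) y \<bullet> i) = - 2 * \<rho>\<^sup>2 * T y" for y
    proof -
      have "grad (\<lambda>y. grad \<zeta> y \<bullet> i) y \<bullet> i = - 2 * \<rho>\<^sup>2 * (P y + (grad P y \<bullet> i) * ((y - x) \<bullet> i))" if "i \<in> Basis" for i
        unfolding \<psi> grad_cmult[OF smooth_mult[OF sm(2) Qs]] grad_mult[OF sm(2) Qs] gQ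
        using that by (simp add: inner_add_left Q_def inner_diff_left algebra_simps)
      then have "(\<Sum>i\<in>Basis. grad (\<lambda>y. grad \<zeta> y \<bullet> i) y \<bullet> i)
          = (\<Sum>i\<in>Basis. - 2 * \<rho>\<^sup>2 * (P y + (grad P y \<bullet> i) * ((y - x) \<bullet> i)))" by simp
      also have "\<dots> = - 2 * \<rho>\<^sup>2 * (real DIM('a) * P y + (\<Sum>i\<in>Basis. (grad P y \<bullet> i) * ((y - x) \<bullet> i)))"
        by (simp only: sum_distrib_left[symmetric] sum.distrib sum_constant)
      also have "(\<Sum>i\<in>Basis. (grad P y \<bullet> i) * ((y - x) \<bullet> i)) = \<rho> * (grad (bump 2) (\<rho> *\<^sub>R y + a) \<bullet> (y - x))"
      proof -
        have "(\<Sum>i\<in>Basis. (grad P y \<bullet> i) * ((y - x) \<bullet> i)) = grad P y \<bullet> (y - x)"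
          by (rule euclidean_inner[symmetric])
        also have "\<dots> = \<rho> * (grad (bump 2) (\<rho> *\<^sub>R y + a) \<bullet> (y - x))" unfolding gP by simp
        finally show ?thesis .
      qed
      finally show ?thesis by (simp add: T_def)
    qed
    have Tc: "continuous_on UNIV T"
    proof -
      have "continuous_on UNIV (\<lambda>y. (-1 / (2 * \<rho>\<^sup>2)) * (\<Sum>i\<in>Basis. grad (\<lambda>y. grad \<zeta> y \<bullet> i) y \<bullet> i))"
        by (intro continuous_intros smooth_continuous_grad smooth_grad sm) auto
      moreover have "(-1 / (2 * \<rho>\<^sup>2)) * (\<Sum>i\<in>Basis. grad (\<lambda>y. grad \<zeta> y \<bullet> i) y \<bullet> i) = T y" for y
        unfolding lap using \<rho> by simp
      ultimately show ?thesis by simp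
    qed
    have Tz: "T y = 0" if "y \<notin> Om" for y
    proof -
      have "grad (\<lambda>y. grad \<zeta> y \<bullet> i) y \<bullet> i = 0" if "i \<in> Basis" for i
        using test_outside(2)[OF test_grad[OF \<zeta>t that] \<open>y \<notin> Om\<close>] by simp
      then have "- 2 * \<rho>\<^sup>2 * T y = 0" using lap[of y] by simp
      then show ?thesis using \<rho> by simp
    qed
    have "(LINT y|M. u y * T y) * (- 2 * \<rho>\<^sup>2) = (LINT y|M. (\<Sum>i\<in>Basis. u y * (grad (\<lambda>y. grad \<zeta> y \<bullet> i) y \<bullet> i)))"
      unfolding sum_distrib_left[symmetric] lap integral_mult_left_zero[symmetric]
      by (intro Bochner_Integration.integral_cong) auto
    also have "\<dots> = (\<Sum>i\<in>Basis. LINT y|M. u y * (grad (\<lambda>y. grad \<zeta> y \<bullet> i) y \<bullet> i))"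
      by (intro Bochner_Integration.integral_sum L1_loc_test_integrable sqint_L1_loc H1D u op test_grad \<zeta>t) auto
    also have "\<dots> = (\<Sum>i\<in>Basis. - (LINT y|M. (wgrad Om u y \<bullet> i) * (grad \<zeta> y \<bullet> i)))"
      using H1D(2)[OF u] test_grad[OF \<zeta>t] by (intro sum.cong) (auto simp: weak_gradient_def)
    also have "\<dots> = - (LINT y|M. (\<Sum>i\<in>Basis. (wgrad Om u y \<bullet> i) * (grad \<zeta> y \<bullet> i)))"
      unfolding sum_negf
      by (subst Bochner_Integration.integral_sum)
        (rule L1_loc_test_integrable[OF L1_loc_inner[OF sqint_L1_loc[OF H1D(3)[OF u]]] op test_grad[OF \<zeta>t]], auto)
    also have "\<dots> = - (LINT y|M. h y * \<zeta> y)"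
      unfolding euclidean_inner[symmetric] eq[OF \<zeta>t] ..
    finally have uT: "(LINT y|M. u y * T y) = (LINT y|M. h y * \<zeta> y) / (2 * \<rho>\<^sup>2)"
      using \<rho> by (simp add: field_simps)
    have WT: "(LINT y|lborel. W y * T y) = (LINT y|M. u y * T y)"
    proof -
      have Tm: "T \<in> borel_measurable borel" by (rule borel_measurable_continuous_onI[OF Tc])
      have m: "(\<lambda>y. W y * T y) \<in> borel_measurable lborel" using W(1) Tm by measurable
      have "(LINT y|lborel. W y * T y) = (LINT y|lebesgue. W y * T y)"
        by (rule integral_completion[OF m, symmetric])
      also have "\<dots> = (LINT y|M. W y * T y)"
        using Tz by (intro lebesgue_on_extend(1)[symmetric]) auto
      also have "\<dots> = (LINT y|M. u y * T y)"
      proof (rule integral_cong_AE)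
        show "(\<lambda>y. W y * T y) \<in> borel_measurable M" using m by (intro borel_measurable_lebesgue_onI) simp
        show "(\<lambda>y. u y * T y) \<in> borel_measurable M"
          by (intro borel_measurable_times sqintD(1)[OF H1D(1)[OF u]] borel_measurable_lebesgue_onI[OF Tm])
        show "AE y in M. W y * T y = u y * T y"
          using W(3) by (auto simp: AE_restrict_space_iff elim!: eventually_mono)
      qed
      finally show ?thesis .
    qed
    have \<zeta>i: "(LINT y|M. \<zeta> y) = Z / \<rho> ^ DIM('a)"
    proof -
      have bl: "bump 0 \<in> borel_measurable (lebesgue :: 'a measure)" by (intro measurable_completion) simp
      have "(LINT y|M. \<zeta> y) = (LINT y|lebesgue. \<zeta> y)"
        using test_outside(1)[OF \<zeta>t] by (intro lebesgue_on_extend(1)) auto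
      also have "\<dots> = (LINT y|lebesgue. bump 0 (a + \<rho> *\<^sub>R y))" by (simp add: \<zeta>_def add.commute)
      also have "\<dots> = (1 / \<rho> ^ DIM('a)) * (LINT y|lebesgue. bump 0 (y::'a))"
        using lebesgue_integral_affine(2)[OF _ bl, of \<rho> a] \<rho> by simp
      also have "(LINT y|lebesgue. bump 0 (y::'a)) = Z" unfolding Z_def by (rule integral_completion) simp
      finally show ?thesis by simp
    qed
    have h\<zeta>: "\<bar>LINT y|M. h y * \<zeta> y\<bar> \<le> C * (Z / \<rho> ^ DIM('a))"
    proof -
      have zi: "integrable M \<zeta>" by (rule sqint_integrable[OF test_sqint(1)[OF \<zeta>t]])
      have z0: "\<zeta> y \<ge> 0" for y by (simp add: \<zeta>_def bump_nonneg)
      have bd: "\<bar>h y * \<zeta> y\<bar> \<le> C * \<zeta> y" for y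
        using h(2)[of y] z0[of y] by (simp add: abs_mult mult_right_mono)
      have hi: "integrable M (\<lambda>y. h y * \<zeta> y)"
      proof (rule Bochner_Integration.integrable_bound[OF integrable_mult_right[OF zi, of C]])
        show "(\<lambda>y. h y * \<zeta> y) \<in> borel_measurable M" using h(1) zi by measurable
        show "AE y in M. norm (h y * \<zeta> y) \<le> norm (C * \<zeta> y)"
          unfolding real_norm_def by (intro AE_I2 order_trans[OF bd abs_ge_self])
      qed
      have "\<bar>LINT y|M. h y * \<zeta> y\<bar> \<le> (LINT y|M. \<bar>h y * \<zeta> y\<bar>)" by (rule integral_abs_bound)
      also have "\<dots> \<le> (LINT y|M. C * \<zeta> y)" using hi zi bd by (intro integral_mono) auto
      finally show ?thesis by (simp add: \<zeta>i)
    qed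
    define D where "D = (LINT y|lborel. W y * (\<rho> ^ (DIM('a) - 1) * T y))"
    have De: "D = \<rho> ^ (DIM('a) - 1) * ((LINT y|M. h y * \<zeta> y) / (2 * \<rho>\<^sup>2))"
      unfolding D_def uT[symmetric] WT[symmetric] integral_mult_right_zero[symmetric]
      by (intro Bochner_Integration.integral_cong) auto
    have pw: "\<rho> ^ DIM('a) = \<rho> ^ (DIM('a) - 1) * \<rho>"
      by (metis DIM_positive One_nat_def Suc_pred power_Suc2)
    have "\<bar>D\<bar> = \<rho> ^ (DIM('a) - 1) / (2 * \<rho>\<^sup>2) * \<bar>LINT y|M. h y * \<zeta> y\<bar>"
      using \<rho> by (simp add: De abs_mult)
    also have "\<dots> \<le> \<rho> ^ (DIM('a) - 1) / (2 * \<rho>\<^sup>2) * (C * (Z / \<rho> ^ DIM('a)))"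
      using h\<zeta> \<rho> by (intro mult_left_mono) auto
    also have "\<dots> = C * Z / (2 * \<rho>\<^sup>2 * \<rho>)" using \<rho> by (simp add: pw)
    finally have D: "\<bar>D\<bar> \<le> C * Z / (2 * \<rho>\<^sup>2 * \<rho>)" .
    have "((\<lambda>\<rho>. avg W \<rho> x) has_real_derivative D) (at (1 / r))"
      using avg_DERIV[OF W(1,2) \<rho>(1), of x] unfolding D_def T_def P_def w \<rho>_def[symmetric] .
    moreover have "((\<lambda>r. 1 / r) has_real_derivative - \<rho>\<^sup>2) (at r)"
      using r by (auto intro!: derivative_eq_intros simp: \<rho>_def power2_eq_square)
    ultimately have "((\<lambda>r. avg W (1 / r) x) has_real_derivative D * (- \<rho>\<^sup>2)) (at r)"
      by (rule DERIV_chain2)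
    moreover have "\<bar>D * (- \<rho>\<^sup>2)\<bar> \<le> C * Z / 2"
    proof -
      have "\<bar>D * (- \<rho>\<^sup>2)\<bar> = \<bar>D\<bar> * \<rho>\<^sup>2" by (simp add: abs_mult)
      also have "\<dots> \<le> C * Z / (2 * \<rho>\<^sup>2 * \<rho>) * \<rho>\<^sup>2" using D by (intro mult_right_mono) auto
      also have "\<dots> = C * Z / 2 / \<rho>" using \<rho> by simp
      also have "\<dots> \<le> C * Z / 2 / 1" using \<rho> C0 Z by (intro divide_left_mono) auto
      finally show ?thesis by simp
    qed
    ultimately show ?thesis by blast
  qed
  then obtain D where D: "\<And>r. 0 < r \<Longrightarrow> r < r0 \<Longrightarrow> ((\<lambda>r. avg W (1 / r) x) has_real_derivative D r) (at r)"
    "\<And>r. 0 < r \<Longrightarrow> r < r0 \<Longrightarrow> \<bar>D r\<bar> \<le> C * Z / 2" by metis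
  have "norm (avg W (1 / r) x - avg W (1 / s) x) \<le> C * Z / 2 * norm (r - s)"
  proof (rule field_differentiable_bound[of "{0<..<r0}" "\<lambda>r. avg W (1 / r) x" D])
    show "((\<lambda>r. avg W (1 / r) x) has_field_derivative D z) (at z within {0<..<r0})" if "z \<in> {0<..<r0}" for z
      using that by (intro has_field_derivative_at_within[OF D(1)]) auto
  qed (use D(2) rs in auto)
  then show ?thesis by simp
qed

text \<open>A weak solution with bounded Laplacian is continuous: its averages are continuous, they
  converge locally uniformly by \<open>avg_lipschitz\<close>, and they converge to the function itself in $L^1$.\<close>

theorem interior_continuity:
  fixes u h :: "'a \<Rightarrow> real"
  assumes u: "u \<in> H1 Om" and h: "h \<in> borel_measurable M" "\<And>x. \<bar>h x\<bar> \<le> C"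
    and eq: "\<And>\<phi>. \<phi> \<in> test_functions Om \<Longrightarrow> (LINT x|M. wgrad Om u x \<bullet> grad \<phi> x) = (LINT x|M. h x * \<phi> x)"
  obtains v where "continuous_on Om v" "AE x in M. u x = v x"
proof -
  define U where "U = (\<lambda>x. if x \<in> Om then u x else 0)"
  have ui: "integrable M u" by (rule sqint_integrable[OF H1D(1)[OF u]])
  have Ui: "integrable lebesgue U"
  proof -
    have "integrable M U"
      using ui by (rule Bochner_Integration.integrable_cong[THEN iffD1, rotated 2]) (auto simp: U_def)
    then show ?thesis by (subst (asm) lebesgue_on_extend(2)) (auto simp: U_def)
  qed
  obtain W where W: "W \<in> borel_measurable lborel" "AE x in lborel. U x = W x"
    using completion_ex_borel_measurable_real[of U lborel] Ui by auto
  have Wm: "W \<in> borel_measurable borel" using W(1) by simp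
  have UW: "AE x in lebesgue. U x = W x" by (rule AE_completion[OF W(2)])
  have Wi: "integrable lborel W"
  proof -
    have "W \<in> borel_measurable lebesgue" by (rule measurable_completion[OF W(1)])
    then have "integrable lebesgue W" by (rule integrable_cong_AE_imp[OF Ui _ UW])
    then show ?thesis using integrable_completion[OF W(1)] by simp
  qed
  have Wu: "AE x in lebesgue. x \<in> Om \<longrightarrow> W x = u x"
    using UW by (rule eventually_mono) (auto simp: U_def)
  define c where "c = (LINT z|lborel. bump 2 (z::'a))"
  have c: "c > 0" unfolding c_def by (rule integral_bump_pos)
  define L where "L = C * (LINT z|lborel. bump 0 (z::'a)) / 2"
  have L0: "L \<ge> 0"
    unfolding L_def using h(2)[of undefined] integral_bump_pos[of 0, where 'a='a]
    by (intro divide_nonneg_nonneg mult_nonneg_nonneg) auto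
  define a where "a = (\<lambda>n. avg W (1 / (1 / real (Suc n))))"
  have ac: "continuous_on S (a n)" for n S
    unfolding a_def using avg_continuous[OF Wm Wi] continuous_on_subset by blast
  define v where "v = (\<lambda>x. lim (\<lambda>n. a n x))"
  have unif: "uniform_limit (ball x r) a v sequentially" if r: "0 < r" "r \<le> 1" "ball x (2 * r) \<subseteq> Om" for x r
  proof -
    have "uniformly_Cauchy_on (ball x r) a"
      unfolding uniformly_Cauchy_on_def
    proof safe
      fix e :: real assume e: "e > 0"
      have "(\<lambda>n. 1 / real (Suc n)) \<longlonglongrightarrow> 0" by (rule LIMSEQ_Suc[OF lim_const_over_n])
      from order_tendstoD(2)[OF this, of "min (r / 2) (e / (L + 1))"]
      obtain N where N: "\<And>n. n \<ge> N \<Longrightarrow> 1 / real (Suc n) < min (r / 2) (e / (L + 1))"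
        using e r L0 by (auto simp: eventually_sequentially)
      show "\<exists>N. \<forall>y\<in>ball x r. \<forall>m\<ge>N. \<forall>n\<ge>N. dist (a m y) (a n y) < e"
      proof (intro exI[of _ N] ballI allI impI)
        fix y m n assume y: "y \<in> ball x r" and mn: "N \<le> m" "N \<le> n"
        have "cball y (r / 2) \<subseteq> ball x (2 * r)"
        proof
          fix z assume "z \<in> cball y (r / 2)"
          then have "dist x z < r + r" using y r dist_triangle[of x z y] by simp
          then show "z \<in> ball x (2 * r)" by simp
        qed
        then have sub: "cball y (r / 2) \<subseteq> Om" using r(3) by blast
        have "\<bar>a m y - a n y\<bar> \<le> L * \<bar>1 / real (Suc m) - 1 / real (Suc n)\<bar>"
          unfolding a_def L_def
          by (rule avg_lipschitz[OF u h eq Wm Wi Wu _ sub]) (use r N[OF mn(1)] N[OF mn(2)] in auto)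
        also have "\<dots> \<le> L * (e / (L + 1))"
        proof (rule mult_left_mono[OF _ L0])
          have "0 < 1 / real (Suc m)" "0 < 1 / real (Suc n)" by auto
          then show "\<bar>1 / real (Suc m) - 1 / real (Suc n)\<bar> \<le> e / (L + 1)"
            using N[OF mn(1)] N[OF mn(2)] by linarith
        qed
        also have "\<dots> < e" using L0 e by (simp add: field_simps)
        finally show "dist (a m y) (a n y) < e" by (simp add: dist_real_def)
      qed
    qed
    then have "uniformly_convergent_on (ball x r) a" by (rule Cauchy_uniformly_convergent)
    then show ?thesis unfolding uniformly_convergent_uniform_limit_iff v_def .
  qed
  have near: "\<exists>r. 0 < r \<and> r \<le> 1 \<and> ball x (2 * r) \<subseteq> Om" if x: "x \<in> Om" for x
  proof -
    obtain r where "r > 0" "ball x r \<subseteq> Om" by (rule openE[OF op x])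
    then show ?thesis by (intro exI[of _ "min 1 (r / 2)"]) (auto simp: subset_iff)
  qed
  have vc: "continuous_on Om v"
  proof (rule continuous_at_imp_continuous_on, rule ballI)
    fix x assume "x \<in> Om"
    then obtain r where r: "0 < r" "r \<le> 1" "ball x (2 * r) \<subseteq> Om" using near by blast
    have "continuous_on (ball x r) v"
      by (rule uniform_limit_theorem[OF _ unif[OF r]]) (use ac in auto)
    then show "isCont v x" using r(1) by (auto simp: continuous_on_eq_continuous_at)
  qed
  have vl: "(\<lambda>n. a n x) \<longlonglongrightarrow> v x" if x: "x \<in> Om" for x
  proof -
    obtain r where r: "0 < r" "r \<le> 1" "ball x (2 * r) \<subseteq> Om" using near[OF x] by blast
    show ?thesis by (rule tendsto_uniform_limitI[OF unif[OF r]]) (use r in auto)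
  qed
  have zero: "(\<integral>\<^sup>+x. liminf (\<lambda>n. ennreal \<bar>a n x - c * W x\<bar>) \<partial>lborel) = 0"
  proof -
    have am: "a n \<in> borel_measurable lborel" for n using borel_measurable_continuous_onI[OF ac] by simp
    have "(\<integral>\<^sup>+x. liminf (\<lambda>n. ennreal \<bar>a n x - c * W x\<bar>) \<partial>lborel) \<le> liminf (\<lambda>n. \<integral>\<^sup>+x. ennreal \<bar>a n x - c * W x\<bar> \<partial>lborel)"
      by (rule nn_integral_liminf) (use am W(1) in measurable)
    also have "\<dots> \<le> 0"
    proof (rule ennreal_le_epsilon)
      fix e :: real assume e: "e > 0"
      obtain d where d: "d > 0" "\<And>r. 0 < r \<Longrightarrow> r \<le> d \<Longrightarrow>
          (\<integral>\<^sup>+x. ennreal \<bar>avg W (1 / r) x - c * W x\<bar> \<partial>lborel) \<le> ennreal e"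
        using avg_L1_limit[OF Wm Wi e] unfolding c_def by blast
      have "(\<lambda>n. 1 / real (Suc n)) \<longlonglongrightarrow> 0" by (rule LIMSEQ_Suc[OF lim_const_over_n])
      from order_tendstoD(2)[OF this d(1)]
      have "\<forall>\<^sub>F n in sequentially. (\<integral>\<^sup>+x. ennreal \<bar>a n x - c * W x\<bar> \<partial>lborel) \<le> ennreal e"
        unfolding a_def by (rule eventually_mono) (intro d(2), auto)
      then have "liminf (\<lambda>n. \<integral>\<^sup>+x. ennreal \<bar>a n x - c * W x\<bar> \<partial>lborel) \<le> ennreal e"
        by (intro Liminf_le) simp_all
      then show "liminf (\<lambda>n. \<integral>\<^sup>+x. ennreal \<bar>a n x - c * W x\<bar> \<partial>lborel) \<le> 0 + ennreal e" by simp
    qed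
    finally show ?thesis by simp
  qed
  have am: "a n \<in> borel_measurable lborel" for n using borel_measurable_continuous_onI[OF ac] by simp
  have "AE x in lborel. liminf (\<lambda>n. ennreal \<bar>a n x - c * W x\<bar>) = 0"
    using zero by (subst (asm) nn_integral_0_iff_AE) (use am W(1) in measurable)
  then have "AE x in lebesgue. liminf (\<lambda>n. ennreal \<bar>a n x - c * W x\<bar>) = 0" by (rule AE_completion)
  then have "AE x in lebesgue. x \<in> Om \<longrightarrow> u x = v x / c"
    using Wu
  proof eventually_elim
    case (elim x)
    show ?case
    proof
      assume x: "x \<in> Om"
      have "(\<lambda>n. ennreal \<bar>a n x - c * W x\<bar>) \<longlonglongrightarrow> ennreal \<bar>v x - c * W x\<bar>"
        by (intro tendsto_intros vl x)
      then have "liminf (\<lambda>n. ennreal \<bar>a n x - c * W x\<bar>) = ennreal \<bar>v x - c * W x\<bar>"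
        by (rule lim_imp_Liminf[OF trivial_limit_sequentially])
      then have "v x = c * W x" using elim(1) by simp
      then show "u x = v x / c" using elim(2) x c by simp
    qed
  qed
  then have "AE x in M. u x = v x / c" by (simp add: AE_restrict_space_iff)
  moreover have "continuous_on Om (\<lambda>x. v x / c)" using vc c by (intro continuous_intros) auto
  ultimately show thesis using that by blast
qed

end

section \<open>Dilations\<close>

locale star_shaped = bounded_open Om for Om :: "'a::euclidean_space set" +
  assumes star: "x \<in> Om \<Longrightarrow> 0 < r \<Longrightarrow> r < 1 \<Longrightarrow> r *\<^sub>R x \<in> Om"
begin

lemma dilation_integral:
  fixes F :: "'a \<Rightarrow> 'b::euclidean_space"
  assumes r: "0 < r" "r < 1" and F: "F \<in> borel_measurable M"
  defines "S \<equiv> (\<lambda>x. r *\<^sub>R x) ` Om"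
  shows "S \<in> sets lebesgue" "S \<subseteq> Om" "(\<lambda>x. F (r *\<^sub>R x)) \<in> borel_measurable M"
    "integrable M (\<lambda>x. F (r *\<^sub>R x)) \<longleftrightarrow> integrable (lebesgue_on S) F"
    "(LINT x|M. F (r *\<^sub>R x)) = (1 / r ^ DIM('a)) *\<^sub>R (LINT y|lebesgue_on S. F y)"
proof -
  have "open S" unfolding S_def using op r by (intro open_scaling) auto
  then show S: "S \<in> sets lebesgue" by simp
  show SO: "S \<subseteq> Om" using star r by (auto simp: S_def)
  have mem: "r *\<^sub>R x \<in> S \<longleftrightarrow> x \<in> Om" for x using r by (auto simp: S_def)
  define F0 where "F0 = (\<lambda>y. if y \<in> S then F y else 0)"
  have "F \<in> borel_measurable (lebesgue_on S)" by (rule measurable_restrict_mono[OF F SO])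
  then have m: "F0 \<in> borel_measurable lebesgue"
    using borel_measurable_if_lebesgue_on[of S UNIV F] S by (simp add: lebesgue_on_UNIV_eq F0_def)
  have "(\<lambda>x. F0 (r *\<^sub>R x)) \<in> borel_measurable lebesgue"
    by (rule measurable_compose[OF lebesgue_measurable_scaling m])
  moreover have e: "F0 (r *\<^sub>R x) = (if x \<in> Om then F (r *\<^sub>R x) else 0)" for x by (simp add: F0_def mem)
  ultimately show "(\<lambda>x. F (r *\<^sub>R x)) \<in> borel_measurable M"
    using borel_measurable_if_lebesgue_on[of Om UNIV "\<lambda>x. F (r *\<^sub>R x)"] by (simp add: lebesgue_on_UNIV_eq)
  have 1: "integrable M (\<lambda>x. F (r *\<^sub>R x)) \<longleftrightarrow> integrable lebesgue (\<lambda>x. F0 (0 + r *\<^sub>R x))"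
    "(LINT x|M. F (r *\<^sub>R x)) = (LINT x|lebesgue. F0 (0 + r *\<^sub>R x))"
  proof -
    have "integrable M (\<lambda>x. F (r *\<^sub>R x)) \<longleftrightarrow> integrable M (\<lambda>x. F0 (r *\<^sub>R x))"
      "(LINT x|M. F (r *\<^sub>R x)) = (LINT x|M. F0 (r *\<^sub>R x))"
      by (auto intro!: Bochner_Integration.integrable_cong Bochner_Integration.integral_cong simp: e)
    then show "integrable M (\<lambda>x. F (r *\<^sub>R x)) \<longleftrightarrow> integrable lebesgue (\<lambda>x. F0 (0 + r *\<^sub>R x))"
      "(LINT x|M. F (r *\<^sub>R x)) = (LINT x|lebesgue. F0 (0 + r *\<^sub>R x))"
      using lebesgue_on_extend[of Om "\<lambda>x. F0 (r *\<^sub>R x)"] e by auto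
  qed
  have 2: "integrable (lebesgue_on S) F \<longleftrightarrow> integrable lebesgue F0" "(LINT y|lebesgue_on S. F y) = (LINT y|lebesgue. F0 y)"
  proof -
    have "integrable (lebesgue_on S) F \<longleftrightarrow> integrable (lebesgue_on S) F0"
      "(LINT y|lebesgue_on S. F y) = (LINT y|lebesgue_on S. F0 y)"
      using S by (auto intro!: Bochner_Integration.integrable_cong Bochner_Integration.integral_cong simp: F0_def)
    then show "integrable (lebesgue_on S) F \<longleftrightarrow> integrable lebesgue F0" "(LINT y|lebesgue_on S. F y) = (LINT y|lebesgue. F0 y)"
      using lebesgue_on_extend[OF S, of F0] by (auto simp: F0_def)
  qed
  show "integrable M (\<lambda>x. F (r *\<^sub>R x)) \<longleftrightarrow> integrable (lebesgue_on S) F"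
    "(LINT x|M. F (r *\<^sub>R x)) = (1 / r ^ DIM('a)) *\<^sub>R (LINT y|lebesgue_on S. F y)"
    unfolding 1 2 using lebesgue_integral_affine[OF _ m, of r 0] r by simp_all
qed

lemma dilation_integral_supported:
  fixes F :: "'a \<Rightarrow> real"
  assumes r: "0 < r" "r < 1" and F: "F \<in> borel_measurable M" and z: "\<And>y. (1 / r) *\<^sub>R y \<notin> Om \<Longrightarrow> F y = 0"
  shows "(LINT x|M. F (r *\<^sub>R x)) = (1 / r ^ DIM('a)) * (LINT y|M. F y)"
proof -
  let ?S = "(\<lambda>x. r *\<^sub>R x) ` Om"
  have "F y = 0" if "y \<notin> ?S" for y
  proof (rule z, rule notI)
    assume "(1 / r) *\<^sub>R y \<in> Om"
    moreover have "y = r *\<^sub>R ((1 / r) *\<^sub>R y)" using r by simp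
    ultimately show False using that by blast
  qed
  then have "(LINT y|M. F y) = (LINT y|lebesgue_on ?S. F y)"
    using dilation_integral(1,2)[OF r F] by (intro lebesgue_on_shrink(1)) auto
  then show ?thesis using dilation_integral(5)[OF r F] by simp
qed

lemma sqint_dilation:
  fixes f :: "'a \<Rightarrow> 'b::euclidean_space"
  assumes r: "0 < r" "r < 1" and f: "sqint M f"
  shows "sqint M (\<lambda>x. f (r *\<^sub>R x))" "sqn M (\<lambda>x. f (r *\<^sub>R x)) \<le> (1 / r ^ DIM('a)) * sqn M f"
proof -
  define F where "F = (\<lambda>y. (norm (f y))\<^sup>2)"
  have Fi: "integrable M F" using sqintD(2)[OF f] by (simp add: F_def)
  have Fm: "F \<in> borel_measurable M" using Fi by auto
  note d = dilation_integral[OF r Fm]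
  let ?S = "(\<lambda>x. r *\<^sub>R x) ` Om"
  have i: "integrable (lebesgue_on ?S) F" by (rule integrable_lebesgue_on_subset[OF Fi _ d(1,2)]) simp
  show "sqint M (\<lambda>x. f (r *\<^sub>R x))"
    using d(4) i dilation_integral(3)[OF r sqintD(1)[OF f]] by (simp add: sqint_def F_def)
  have "(LINT y|lebesgue_on ?S. F y) \<le> (LINT y|M. F y)"
    using sqn_subset[OF f d(1,2)] by (simp add: sqn_def F_def)
  then show "sqn M (\<lambda>x. f (r *\<^sub>R x)) \<le> (1 / r ^ DIM('a)) * sqn M f"
    using d(5) r by (simp add: sqn_def F_def divide_right_mono)
qed

text \<open>Test functions of \<open>x\<close> become test functions of \<open>r *\<^sub>R x\<close>, supported in the dilated set.\<close>

lemma dilated_test_function: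
  assumes r: "0 < r" "r < 1" and \<phi>: "\<phi> \<in> test_functions Om"
    and \<psi>_def: "\<psi> = (\<lambda>y. \<phi> ((1 / r) *\<^sub>R y))"
  shows "\<psi> \<in> test_functions Om" "\<phi> x = \<psi> (r *\<^sub>R x)" "grad \<phi> x = r *\<^sub>R grad \<psi> (r *\<^sub>R x)"
    "(1 / r) *\<^sub>R y \<notin> Om \<Longrightarrow> \<psi> y = 0" "(1 / r) *\<^sub>R y \<notin> Om \<Longrightarrow> grad \<psi> y = 0"
proof -
  have sm: "smooth \<phi>" using \<phi> by (rule test_smooth)
  obtain K where K: "compact K" "K \<subseteq> Om" "\<And>x. x \<notin> K \<Longrightarrow> \<phi> x = 0" "\<And>x. x \<notin> K \<Longrightarrow> grad \<phi> x = 0"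
    using \<phi> by (rule test_functionsE) blast
  have \<psi>s: "smooth \<psi>" using smooth_affine[OF sm, of "1 / r" 0] by (simp add: \<psi>_def)
  have g: "grad \<psi> y = (1 / r) *\<^sub>R grad \<phi> ((1 / r) *\<^sub>R y)" for y
    using grad_affine[OF sm, of "1 / r" 0 y] by (simp add: \<psi>_def)
  show "\<psi> \<in> test_functions Om"
  proof (rule test_functionsI[OF \<psi>s, of "(\<lambda>x. r *\<^sub>R x) ` K"])
    show "compact ((\<lambda>x. r *\<^sub>R x) ` K)" by (intro compact_continuous_image K continuous_intros)
    show "(\<lambda>x. r *\<^sub>R x) ` K \<subseteq> Om" using star r K(2) by auto
    show "\<psi> y = 0" if "y \<notin> (\<lambda>x. r *\<^sub>R x) ` K" for y
      unfolding \<psi>_def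
    proof (rule K(3), rule notI)
      assume "(1 / r) *\<^sub>R y \<in> K"
      moreover have "y = r *\<^sub>R ((1 / r) *\<^sub>R y)" using r by simp
      ultimately show False using that by blast
    qed
  qed
  show "\<phi> x = \<psi> (r *\<^sub>R x)" using r by (simp add: \<psi>_def)
  show "grad \<phi> x = r *\<^sub>R grad \<psi> (r *\<^sub>R x)" using r by (simp add: g)
  show "(1 / r) *\<^sub>R y \<notin> Om \<Longrightarrow> \<psi> y = 0" using test_outside(1)[OF \<phi>] by (simp add: \<psi>_def)
  show "(1 / r) *\<^sub>R y \<notin> Om \<Longrightarrow> grad \<psi> y = 0" using test_outside(2)[OF \<phi>] by (simp add: g)
qed

lemma weak_gradient_dilation:
  assumes r: "0 < r" "r < 1" and u: "sqint M u" "weak_gradient Om u g" "sqint M g"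
  shows "weak_gradient Om (\<lambda>x. u (r *\<^sub>R x)) (\<lambda>x. r *\<^sub>R g (r *\<^sub>R x))"
  unfolding weak_gradient_def
proof (intro conjI ballI)
  show "(\<lambda>x. u (r *\<^sub>R x)) \<in> L1_loc Om" by (intro sqint_L1_loc sqint_dilation r u)
  show "(\<lambda>x. r *\<^sub>R g (r *\<^sub>R x)) \<in> L1_loc Om" by (intro sqint_L1_loc sqint_scaleR sqint_dilation r u)
  fix \<phi> and i :: 'a assume \<phi>: "\<phi> \<in> test_functions Om" and i: "i \<in> Basis"
  define \<psi> where "\<psi> = (\<lambda>y. \<phi> ((1 / r) *\<^sub>R y))"
  note \<psi> = dilated_test_function[OF r \<phi> \<psi>_def]
  have m: "(\<lambda>y. u y * (grad \<psi> y \<bullet> i)) \<in> borel_measurable M" "(\<lambda>y. (g y \<bullet> i) * \<psi> y) \<in> borel_measurable M"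
    by (intro borel_measurable_integrable L1_loc_test_integrable L1_loc_inner[OF sqint_L1_loc[OF u(3)]]
        sqint_L1_loc[OF u(1)] op test_grad \<psi> i)+
  have "(LINT x|M. u (r *\<^sub>R x) * (grad \<phi> x \<bullet> i)) = r * (LINT x|M. u (r *\<^sub>R x) * (grad \<psi> (r *\<^sub>R x) \<bullet> i))"
    unfolding \<psi>(3) integral_mult_right_zero[symmetric] by (intro Bochner_Integration.integral_cong) auto
  also have "(LINT x|M. u (r *\<^sub>R x) * (grad \<psi> (r *\<^sub>R x) \<bullet> i)) = (1 / r ^ DIM('a)) * (LINT y|M. u y * (grad \<psi> y \<bullet> i))"
    by (rule dilation_integral_supported[OF r m(1)]) (simp add: \<psi>(5))
  also have "(LINT y|M. u y * (grad \<psi> y \<bullet> i)) = - (LINT y|M. (g y \<bullet> i) * \<psi> y)"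
    using u(2) \<psi>(1) i by (auto simp: weak_gradient_def)
  also have "r * ((1 / r ^ DIM('a)) * - (LINT y|M. (g y \<bullet> i) * \<psi> y)) = - (r * ((1 / r ^ DIM('a)) * (LINT y|M. (g y \<bullet> i) * \<psi> y)))"
    by simp
  also have "(1 / r ^ DIM('a)) * (LINT y|M. (g y \<bullet> i) * \<psi> y) = (LINT x|M. (g (r *\<^sub>R x) \<bullet> i) * \<psi> (r *\<^sub>R x))"
    by (rule dilation_integral_supported[OF r m(2), symmetric]) (simp add: \<psi>(4))
  also have "r * (LINT x|M. (g (r *\<^sub>R x) \<bullet> i) * \<psi> (r *\<^sub>R x)) = (LINT x|M. ((r *\<^sub>R g (r *\<^sub>R x)) \<bullet> i) * \<phi> x)"
    unfolding \<psi>(2) integral_mult_right_zero[symmetric] by (intro Bochner_Integration.integral_cong) auto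
  finally show "(LINT x|M. u (r *\<^sub>R x) * (grad \<phi> x \<bullet> i)) = - (LINT x|M. ((r *\<^sub>R g (r *\<^sub>R x)) \<bullet> i) * \<phi> x)" .
qed

lemma sqint_test_mult_measurable:
  "sqint M G \<Longrightarrow> \<psi> \<in> test_functions Om \<Longrightarrow> (\<lambda>y. G y \<bullet> grad \<psi> y) \<in> borel_measurable M"
  by (intro borel_measurable_inner sqintD(1) test_sqint)

lemma weak_equation_dilation:
  assumes r: "0 < r" "r < 1" and u: "sqint M u" "weak_gradient Om u g" "sqint M g"
    and f: "f \<in> borel_measurable M" and h: "h \<in> borel_measurable M"
    and eq: "\<And>\<phi>. \<phi> \<in> test_functions Om \<Longrightarrow> (LINT x|M. g x \<bullet> grad \<phi> x) + (LINT x|M. f x * \<phi> x) = (LINT x|M. h x * \<phi> x)"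
  shows "weak_solution Om (\<lambda>x. c * r\<^sup>2 * f (r *\<^sub>R x)) (\<lambda>x. c * r\<^sup>2 * h (r *\<^sub>R x)) (\<lambda>x. c * u (r *\<^sub>R x))"
  unfolding weak_solution_def
proof
  fix \<phi> assume \<phi>: "\<phi> \<in> test_functions Om"
  define \<psi> where "\<psi> = (\<lambda>y. \<phi> ((1 / r) *\<^sub>R y))"
  note \<psi> = dilated_test_function[OF r \<phi> \<psi>_def]
  define k where "k = c * r\<^sup>2 * (1 / r ^ DIM('a))"
  have wg: "weak_gradient Om (\<lambda>x. c * u (r *\<^sub>R x)) (\<lambda>x. c *\<^sub>R (r *\<^sub>R g (r *\<^sub>R x)))"
    by (rule weak_gradient_cmult[OF weak_gradient_dilation[OF r u]])
  have gs: "sqint M (\<lambda>x. c *\<^sub>R (r *\<^sub>R g (r *\<^sub>R x)))" by (intro sqint_scaleR sqint_dilation r u)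
  have "AE x in M. wgrad Om (\<lambda>x. c * u (r *\<^sub>R x)) x = c *\<^sub>R (r *\<^sub>R g (r *\<^sub>R x))" by (rule wgrad_AE[OF wg op])
  then have ae: "AE x in M. c *\<^sub>R (r *\<^sub>R g (r *\<^sub>R x)) = wgrad Om (\<lambda>x. c * u (r *\<^sub>R x)) x"
    by (rule eventually_mono) (rule sym)
  have "(LINT x|M. wgrad Om (\<lambda>x. c * u (r *\<^sub>R x)) x \<bullet> grad \<phi> x) = (LINT x|M. (c *\<^sub>R (r *\<^sub>R g (r *\<^sub>R x))) \<bullet> grad \<phi> x)"
  proof (rule integral_cong_AE)
    show "AE x in M. wgrad Om (\<lambda>x. c * u (r *\<^sub>R x)) x \<bullet> grad \<phi> x = (c *\<^sub>R (r *\<^sub>R g (r *\<^sub>R x))) \<bullet> grad \<phi> x"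
      using ae by (rule eventually_mono) (rule arg_cong[where f="\<lambda>z. z \<bullet> _"], rule sym)
  qed (intro sqint_test_mult_measurable gs \<phi> sqint_AE_cong(1)[OF gs ae])+
  also have "\<dots> = c * r\<^sup>2 * (LINT x|M. g (r *\<^sub>R x) \<bullet> grad \<psi> (r *\<^sub>R x))"
    unfolding \<psi>(3) integral_mult_right_zero[symmetric]
    by (intro Bochner_Integration.integral_cong) (auto simp: power2_eq_square)
  also have "(LINT x|M. g (r *\<^sub>R x) \<bullet> grad \<psi> (r *\<^sub>R x)) = (1 / r ^ DIM('a)) * (LINT y|M. g y \<bullet> grad \<psi> y)"
    by (rule dilation_integral_supported[OF r sqint_test_mult_measurable[OF u(3) \<psi>(1)]]) (simp add: \<psi>(5))
  finally have 1: "(LINT x|M. wgrad Om (\<lambda>x. c * u (r *\<^sub>R x)) x \<bullet> grad \<phi> x) = k * (LINT y|M. g y \<bullet> grad \<psi> y)"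
    by (simp add: k_def)
  have 2: "(LINT x|M. c * r\<^sup>2 * p (r *\<^sub>R x) * \<phi> x) = k * (LINT y|M. p y * \<psi> y)" if p: "p \<in> borel_measurable M" for p
  proof -
    have "(LINT x|M. c * r\<^sup>2 * p (r *\<^sub>R x) * \<phi> x) = c * r\<^sup>2 * (LINT x|M. p (r *\<^sub>R x) * \<psi> (r *\<^sub>R x))"
      unfolding \<psi>(2) integral_mult_right_zero[symmetric] by (intro Bochner_Integration.integral_cong) auto
    also have "(LINT x|M. p (r *\<^sub>R x) * \<psi> (r *\<^sub>R x)) = (1 / r ^ DIM('a)) * (LINT y|M. p y * \<psi> y)"
    proof (rule dilation_integral_supported[OF r])
      show "(\<lambda>y. p y * \<psi> y) \<in> borel_measurable M"
        by (intro borel_measurable_times p sqintD(1) test_sqint \<psi>)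
    qed (simp add: \<psi>(4))
    finally show ?thesis by (simp add: k_def)
  qed
  show "(LINT x|M. wgrad Om (\<lambda>x. c * u (r *\<^sub>R x)) x \<bullet> grad \<phi> x) + (LINT x|M. c * r\<^sup>2 * f (r *\<^sub>R x) * \<phi> x)
      = (LINT x|M. c * r\<^sup>2 * h (r *\<^sub>R x) * \<phi> x)"
  proof -
    have "k * (LINT y|M. g y \<bullet> grad \<psi> y) + k * (LINT y|M. f y * \<psi> y) = k * (LINT y|M. h y * \<psi> y)"
      using arg_cong[OF eq[OF \<psi>(1)], of "\<lambda>z. k * z"] by (simp only: distrib_left)
    then show ?thesis using 1 2[OF f] 2[OF h] by presburger
  qed
qed

text \<open>For a continuous function with compact support by dominated convergence, in general by density; the
  dilations are uniformly bounded on $L^2$ as \<open>r n\<close> tends to 1.\<close>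

lemma dilation_continuous_L2:
  fixes f :: "'a \<Rightarrow> real"
  assumes f: "sqint M f" and r: "\<And>n. 0 < r n" "\<And>n. r n < 1" "r \<longlonglongrightarrow> 1" and c: "c \<longlonglongrightarrow> 1"
  shows "(\<lambda>n. sqn M (\<lambda>x. c n * f (r n *\<^sub>R x) - f x)) \<longlonglongrightarrow> 0"
proof (rule LIMSEQ_I)
  fix e :: real assume "e > 0"
  then have e: "e / 16 > 0" by simp
  define F where "F = (\<lambda>x. if x \<in> Om then f x else 0)"
  have Fm: "F \<in> borel_measurable lebesgue"
    using borel_measurable_if_lebesgue_on[of Om UNIV f] sqintD(1)[OF f] by (simp add: lebesgue_on_UNIV_eq F_def)
  have Fi: "integrable lebesgue (\<lambda>x. \<bar>F x\<bar> ^ 2)"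
  proof -
    have "integrable M (\<lambda>x. \<bar>F x\<bar> ^ 2)"
      using sqintD(2)[OF f] by (rule Bochner_Integration.integrable_cong[THEN iffD1, rotated 2]) (auto simp: F_def)
    then show ?thesis by (subst (asm) lebesgue_on_extend(2)) (auto simp: F_def)
  qed
  obtain g R where g: "continuous_on UNIV g" "\<And>x. norm x > R \<Longrightarrow> g x = 0"
    "integrable lebesgue (\<lambda>x. \<bar>F x - g x\<bar> ^ 2)" "(LINT x|lebesgue. \<bar>F x - g x\<bar> ^ 2) \<le> e / 16"
    using continuous_dense_Lp[OF Fm Fi _ e] by auto
  obtain C where C: "C > 0" "\<And>x. norm (g x) \<le> C"
    using compact_support_bounded[OF g(1), of "cball 0 R"] g(2) by auto
  have gm: "g \<in> borel_measurable M" by (intro borel_measurable_lebesgue_onI borel_measurable_continuous_onI g)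
  have gs: "sqint M g"
    by (rule sqint_bound[OF gm, of "\<lambda>_. C\<^sup>2"]) (use C in \<open>auto intro!: power_mono simp: abs_le_square_iff[symmetric]\<close>)
  have fg: "sqint M (\<lambda>x. f x - g x)" by (rule sqint_diff[OF f gs])
  have fge: "sqn M (\<lambda>x. f x - g x) \<le> e / 16"
  proof -
    have "sqn M (\<lambda>x. f x - g x) = (LINT x|lebesgue. indicator Om x *\<^sub>R (\<bar>f x - g x\<bar> ^ 2))"
      unfolding sqn_def by (simp add: integral_restrict_space)
    also have "\<dots> \<le> (LINT x|lebesgue. \<bar>F x - g x\<bar> ^ 2)"
    proof (rule integral_mono)
      show "integrable lebesgue (\<lambda>x. indicator Om x *\<^sub>R (\<bar>f x - g x\<bar> ^ 2))"
        using sqintD(2)[OF fg] by (simp add: integrable_restrict_space)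
    qed (use g(3) in \<open>auto simp: F_def indicator_def\<close>)
    finally show ?thesis using g(4) by simp
  qed
  have "convergent c" using c by (auto simp: convergent_def)
  then have "Bseq c" by (rule convergent_imp_Bseq)
  then obtain B where B: "B > 0" "\<And>n. norm (c n) \<le> B" unfolding Bseq_def by auto
  have mid: "(\<lambda>n. sqn M (\<lambda>x. c n * g (r n *\<^sub>R x) - g x)) \<longlonglongrightarrow> (LINT x|M. 0)"
    unfolding sqn_def
  proof (rule integral_dominated_convergence[where w="\<lambda>_. (B * C + C)\<^sup>2"])
    have "(\<lambda>n. (norm (c n * g (r n *\<^sub>R x) - g x))\<^sup>2) \<longlonglongrightarrow> (norm (1 * g (1 *\<^sub>R x) - g x))\<^sup>2" for x
      by (intro tendsto_intros c isCont_tendsto_compose[of _ g] r)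
        (use g(1) in \<open>simp add: continuous_on_eq_continuous_at\<close>)
    then show "AE x in M. (\<lambda>n. (norm (c n * g (r n *\<^sub>R x) - g x))\<^sup>2) \<longlonglongrightarrow> 0" by simp
    show "(\<lambda>x. (norm (c n * g (r n *\<^sub>R x) - g x))\<^sup>2) \<in> borel_measurable M" for n
      by (intro borel_measurable_lebesgue_onI borel_measurable_continuous_onI continuous_intros
          continuous_on_compose2[OF g(1)]) auto
    have bd: "norm (c n * g (r n *\<^sub>R x) - g x) \<le> B * C + C" for n x
    proof -
      have "norm (c n * g (r n *\<^sub>R x)) \<le> B * C" unfolding norm_mult using B C by (intro mult_mono) auto
      then show ?thesis using C(2)[of x] norm_triangle_ineq4[of "c n * g (r n *\<^sub>R x)" "g x"] by linarith
    qed
    show "AE x in M. norm ((norm (c n * g (r n *\<^sub>R x) - g x))\<^sup>2) \<le> (B * C + C)\<^sup>2" for n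
    proof (rule AE_I2)
      show "norm ((norm (c n * g (r n *\<^sub>R x) - g x))\<^sup>2) \<le> (B * C + C)\<^sup>2" for x
        using power_mono[OF bd[of n x] norm_ge_zero, of 2] by simp
    qed
  qed auto
  have "(\<lambda>n. (c n)\<^sup>2 * (1 / r n ^ DIM('a))) \<longlonglongrightarrow> 1\<^sup>2 * (1 / 1 ^ DIM('a))"
    by (intro tendsto_intros c r) auto
  then have "\<forall>\<^sub>F n in sequentially. (c n)\<^sup>2 * (1 / r n ^ DIM('a)) < 2" by (rule order_tendstoD) simp
  moreover have "\<forall>\<^sub>F n in sequentially. sqn M (\<lambda>x. c n * g (r n *\<^sub>R x) - g x) < e / 16"
    using mid e by (intro order_tendstoD(2)[OF mid]) simp
  ultimately have "\<forall>\<^sub>F n in sequentially. norm (sqn M (\<lambda>x. c n * f (r n *\<^sub>R x) - f x) - 0) < e"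
  proof eventually_elim
    case (elim n)
    note rn = r(1)[of n] r(2)[of n]
    have s1: "sqint M (\<lambda>x. c n * (f (r n *\<^sub>R x) - g (r n *\<^sub>R x)))"
      by (rule sqint_cmult[OF sqint_dilation(1)[OF rn fg]])
    have s2: "sqint M (\<lambda>x. c n * g (r n *\<^sub>R x) - g x)"
      by (intro sqint_diff sqint_cmult sqint_dilation rn gs)
    have s3: "sqint M (\<lambda>x. g x - f x)" by (rule sqint_diff[OF gs f])
    have n1: "sqn M (\<lambda>x. c n * (f (r n *\<^sub>R x) - g (r n *\<^sub>R x))) \<le> 2 * (e / 16)"
    proof -
      have "sqn M (\<lambda>x. c n * (f (r n *\<^sub>R x) - g (r n *\<^sub>R x))) = (c n)\<^sup>2 * sqn M (\<lambda>x. f (r n *\<^sub>R x) - g (r n *\<^sub>R x))"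
        by (rule sqn_cmult)
      also have "\<dots> \<le> (c n)\<^sup>2 * ((1 / r n ^ DIM('a)) * sqn M (\<lambda>x. f x - g x))"
        by (rule mult_left_mono[OF sqint_dilation(2)[OF rn fg]]) simp
      also have "\<dots> = ((c n)\<^sup>2 * (1 / r n ^ DIM('a))) * sqn M (\<lambda>x. f x - g x)" by simp
      also have "\<dots> \<le> 2 * (e / 16)" using elim(1) fge sqn_nonneg by (intro mult_mono) auto
      finally show ?thesis .
    qed
    have n3: "sqn M (\<lambda>x. g x - f x) \<le> e / 16" using fge sqn_minus_commute[of M f g] by simp
    have "(\<lambda>x. c n * f (r n *\<^sub>R x) - f x)
        = (\<lambda>x. c n * (f (r n *\<^sub>R x) - g (r n *\<^sub>R x)) + ((c n * g (r n *\<^sub>R x) - g x) + (g x - f x)))"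
      by (simp add: algebra_simps)
    then have "sqn M (\<lambda>x. c n * f (r n *\<^sub>R x) - f x)
        \<le> 2 * (2 * (e / 16)) + 2 * (2 * (e / 16) + 2 * (e / 16))"
      using sqn_add_le2[OF s1 sqint_add[OF s2 s3]] sqn_add_le2[OF s2 s3] n1 n3 elim(2) by simp
    then show ?case using \<open>e > 0\<close> sqn_nonneg[of M "\<lambda>x. c n * f (r n *\<^sub>R x) - f x"] by simp
  qed
  then show "\<exists>N. \<forall>n\<ge>N. norm (sqn M (\<lambda>x. c n * f (r n *\<^sub>R x) - f x) - 0) < e"
    by (simp add: eventually_sequentially)
qed

lemma dilation_continuous_L2_vector:
  fixes f :: "'a \<Rightarrow> 'b::euclidean_space"
  assumes f: "sqint M f" and r: "\<And>n. 0 < r n" "\<And>n. r n < 1" "r \<longlonglongrightarrow> 1" and c: "c \<longlonglongrightarrow> 1"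
  shows "(\<lambda>n. sqn M (\<lambda>x. c n *\<^sub>R f (r n *\<^sub>R x) - f x)) \<longlonglongrightarrow> 0"
proof -
  have comp: "sqint M (\<lambda>x. h x \<bullet> i)" if h: "sqint M h" and i: "i \<in> Basis" for h :: "'a \<Rightarrow> 'b" and i
  proof (rule sqint_bound[OF _ sqintD(2)[OF h]])
    show "(\<lambda>x. h x \<bullet> i) \<in> borel_measurable M" by (intro borel_measurable_inner sqintD(1)[OF h] borel_measurable_const)
    show "(norm (h x \<bullet> i))\<^sup>2 \<le> (norm (h x))\<^sup>2" for x
      using power_mono[OF Basis_le_norm[OF i, of "h x"] abs_ge_zero, of 2] by simp
  qed
  have split: "sqn M h = (\<Sum>i\<in>Basis. sqn M (\<lambda>x. h x \<bullet> i))" if h: "sqint M h" for h :: "'a \<Rightarrow> 'b"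
  proof -
    have e: "(norm z)\<^sup>2 = (\<Sum>i\<in>Basis. (norm (z \<bullet> i))\<^sup>2)" for z :: 'b
      unfolding power2_norm_eq_inner by (subst euclidean_inner) (simp add: power2_eq_square)
    show ?thesis unfolding sqn_def e
      by (rule Bochner_Integration.integral_sum) (use comp[OF h] in \<open>auto simp: sqint_def\<close>)
  qed
  have "(\<lambda>n. \<Sum>i\<in>Basis. sqn M (\<lambda>x. c n * (f (r n *\<^sub>R x) \<bullet> i) - f x \<bullet> i)) \<longlonglongrightarrow> (\<Sum>i\<in>(Basis::'b set). 0)"
    by (intro tendsto_sum dilation_continuous_L2[OF comp[OF f]] r c)
  moreover have "sqn M (\<lambda>x. c n *\<^sub>R f (r n *\<^sub>R x) - f x) = (\<Sum>i\<in>Basis. sqn M (\<lambda>x. c n * (f (r n *\<^sub>R x) \<bullet> i) - f x \<bullet> i))" for n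
    by (subst split) (intro sqint_diff sqint_scaleR sqint_dilation r f, simp add: inner_diff_left)
  ultimately show ?thesis by simp
qed

end

section \<open>Weak convergence on compact subsets\<close>

context bounded_open begin

lemma H1_restrict:
  assumes u: "u \<in> H1 Om" and V: "open V" "V \<subseteq> Om"
  shows "u \<in> H1 V" "sqn (lebesgue_on V) u \<le> sqn M u" "dirichlet V u \<le> dirichlet Om u"
proof -
  interpret V: bounded_open V using V bd by unfold_locales (auto intro: bounded_subset)
  have wg: "weak_gradient V u (wgrad Om u)" by (rule weak_gradient_mono[OF H1D(2)[OF u] V(2) op V(1)])
  have s: "sqint (lebesgue_on V) u" "sqint (lebesgue_on V) (wgrad Om u)"
    by (rule sqint_sub[OF _ V(2) V.Om_sets], rule H1D[OF u])+
  show "u \<in> H1 V" by (rule V.H1_I[OF s(1) wg s(2)])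
  show "sqn (lebesgue_on V) u \<le> sqn M u" by (rule sqn_subset[OF H1D(1)[OF u] V.Om_sets V(2)])
  show "dirichlet V u \<le> dirichlet Om u"
    using sqn_subset[OF H1D(3)[OF u] V.Om_sets V(2)] V.sqn_wgrad[OF wg s(2)]
    by (simp only: dirichlet_def[of Om])
qed

lemma H1_H1_loc:
  assumes u: "u \<in> H1 Om" shows "u \<in> H1_loc Om"
proof -
  have loc: "sqint (lebesgue_on K) h" if "sqint M h" "compact K" "K \<subseteq> Om" for K and h :: "'a \<Rightarrow> 'b::euclidean_space"
  proof -
    have "K \<in> sets lebesgue" using that(2) by (simp add: lmeasurable_compact fmeasurableD)
    then show ?thesis using sqint_sub[OF that(1,3)] by blast
  qed
  show ?thesis
    unfolding H1_loc_def L2_loc_def L2_sqint mem_Collect_eq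
  proof (intro conjI exI[of _ "wgrad Om u"] allI impI)
    show "sqint (lebesgue_on K) u" if "compact K \<and> K \<subseteq> Om" for K
      using that by (intro loc[OF H1D(1)[OF u]]) auto
    show "sqint (lebesgue_on K) (wgrad Om u)" if "compact K \<and> K \<subseteq> Om" for K
      using that by (intro loc[OF H1D(3)[OF u]]) auto
  qed (rule H1D(2)[OF u])
qed

text \<open>A bounded functional on the smaller set sees only the restriction, whose norm does not exceed that on
  the whole set.\<close>

lemma strong_imp_weak_convergence:
  assumes w: "\<And>n. w n \<in> H1 Om" and u: "u \<in> H1 Om" and V: "open V" "V \<subseteq> Om"
    and l: "(\<lambda>n. sqn M (\<lambda>x. w n x - u x)) \<longlonglongrightarrow> 0" "(\<lambda>n. dirichlet Om (\<lambda>x. w n x - u x)) \<longlonglongrightarrow> 0"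
  shows "weakly_converges_H1 V w u"
  unfolding weakly_converges_H1_def
proof (intro conjI allI ballI)
  interpret V: bounded_open V using V bd by unfold_locales (auto intro: bounded_subset)
  show wV: "w n \<in> H1 V" for n by (rule H1_restrict(1)[OF w V])
  show uV: "u \<in> H1 V" by (rule H1_restrict(1)[OF u V])
  fix L assume L: "L \<in> H1_dual V"
  then have "\<exists>C. \<forall>v\<in>H1 V. \<bar>L v\<bar> \<le> C * H1_norm V v" by (simp add: H1_dual_def)
  then obtain C where C: "\<And>v. v \<in> H1 V \<Longrightarrow> \<bar>L v\<bar> \<le> C * H1_norm V v" by blast
  have d: "(\<lambda>x. w n x - u x) \<in> H1 Om" for n by (rule H1_diff[OF w u])
  have dV: "(\<lambda>x. w n x - u x) \<in> H1 V" for n by (rule H1_restrict(1)[OF d V])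
  have "(\<lambda>n. sqn (lebesgue_on V) (\<lambda>x. w n x - u x)) \<longlonglongrightarrow> 0"
    by (rule tendsto_sandwich[OF _ _ tendsto_const l(1)])
      (auto intro!: always_eventually sqn_nonneg H1_restrict(2)[OF d V])
  moreover have "(\<lambda>n. dirichlet V (\<lambda>x. w n x - u x)) \<longlonglongrightarrow> 0"
    by (rule tendsto_sandwich[OF _ _ tendsto_const l(2)])
      (auto intro!: always_eventually V.dirichlet_nonneg H1_restrict(3)[OF d V])
  ultimately have "(\<lambda>n. H1_norm V (\<lambda>x. w n x - u x)) \<longlonglongrightarrow> 0"
    by (simp add: V.H1_norm_tendsto)
  then have z: "(\<lambda>n. C * H1_norm V (\<lambda>x. w n x - u x)) \<longlonglongrightarrow> 0" using tendsto_mult_right_zero by blast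
  have "(\<lambda>n. L (\<lambda>x. w n x - u x)) \<longlonglongrightarrow> 0"
    by (rule Lim_null_comparison[OF _ z]) (use C[OF dV] in auto)
  then have "(\<lambda>n. L (\<lambda>x. w n x - u x) + L u) \<longlonglongrightarrow> 0 + L u" by (intro tendsto_intros)
  moreover have "L (w n) = L (\<lambda>x. w n x - u x) + L u" for n
  proof -
    have "\<forall>a\<in>H1 V. \<forall>b\<in>H1 V. L (\<lambda>x. a x + b x) = L a + L b"
      using L by (simp add: H1_dual_def)
    from this[rule_format, OF dV[of n] uV]
    have "L (\<lambda>x. (w n x - u x) + u x) = L (\<lambda>x. w n x - u x) + L u" .
    then show ?thesis by simp
  qed
  ultimately show "(\<lambda>n. L (w n)) \<longlonglongrightarrow> L u" by simp
qed

end

section \<open>The minimizer is a good solution\<close>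

context exponents begin

text \<open>The equation is invariant under $u(x) \mapsto c\, u(r x)$ with this value of \<open>c\<close>.\<close>

lemma g_reg_scaling:
  assumes r: "r > 0" and c: "c = r powr (- 2 / (2 - q))"
  shows "c * r\<^sup>2 * g_reg lp lm q \<epsilon> t = g_reg lp lm q (c * \<epsilon>) (c * t)"
proof -
  have c0: "c > 0" using r by (simp add: c)
  have "(c\<^sup>2) powr ((2 - q) / 2) = (c powr 2) powr ((2 - q) / 2)" using c0 by (simp add: powr_numeral)
  also have "\<dots> = c powr (2 * ((2 - q) / 2))" by (rule powr_powr)
  also have "2 * ((2 - q) / 2) = 2 - q" by simp
  also have "c powr (2 - q) = r powr (- 2 / (2 - q) * (2 - q))" unfolding c by (rule powr_powr)
  also have "- 2 / (2 - q) * (2 - q) = - 2"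
    unfolding times_divide_eq_left by (rule nonzero_mult_div_cancel_right) (use q1 in simp)
  also have "r powr (- 2) = 1 / r\<^sup>2" using r by (simp add: powr_minus_divide powr_numeral)
  finally have cp: "(c\<^sup>2) powr ((2 - q) / 2) = 1 / r\<^sup>2" .
  have "(c * \<epsilon>)\<^sup>2 + (c * t)\<^sup>2 = c\<^sup>2 * (\<epsilon>\<^sup>2 + t\<^sup>2)" by (simp add: power_mult_distrib distrib_left)
  then have S: "((c * \<epsilon>)\<^sup>2 + (c * t)\<^sup>2) powr ((2 - q) / 2) = (\<epsilon>\<^sup>2 + t\<^sup>2) powr ((2 - q) / 2) / r\<^sup>2"
    by (simp add: powr_mult cp)
  have p: "pos (c * t) = c * pos t" "neg (c * t) = c * neg t"
    using c0 by (auto simp: pos_def neg_def max_def mult_le_0_iff zero_le_mult_iff)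
  show ?thesis unfolding g_reg_def S p using r by (simp add: right_diff_distrib mult_ac)
qed

end

context variational begin

lemma bounded_test_integrable:
  assumes b: "b \<in> borel_measurable M" "\<And>x. \<bar>b x\<bar> \<le> C" and \<phi>: "\<phi> \<in> test_functions Om"
  shows "integrable M (\<lambda>x. b x * \<phi> x)"
proof -
  have \<phi>i: "integrable M \<phi>" by (rule sqint_integrable[OF test_sqint(1)[OF \<phi>]])
  show ?thesis
  proof (rule Bochner_Integration.integrable_bound[OF integrable_mult_right[OF \<phi>i, of C]])
    show "(\<lambda>x. b x * \<phi> x) \<in> borel_measurable M" using b(1) \<phi>i by measurable
    have "\<bar>b x\<bar> * \<bar>\<phi> x\<bar> \<le> \<bar>C\<bar> * \<bar>\<phi> x\<bar>" for x
      using b(2)[of x] by (intro mult_right_mono) auto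
    then show "AE x in M. norm (b x * \<phi> x) \<le> norm (C * \<phi> x)" by (intro AE_I2) (simp add: abs_mult)
  qed
qed

text \<open>The solutions of \<open>minimizer_approximation\<close>, replaced by their continuous representatives.  All
  properties survive a modification on a null set.\<close>

lemma continuous_approximation:
  assumes min: "minimizer (J Om lp lm q) (admissible Om u0) ubar" and \<delta>: "\<delta> > 0"
  obtains \<epsilon> v f G where "0 < \<epsilon>" "\<epsilon> < \<delta>" "sqint M v" "weak_gradient Om v G" "sqint M G" "continuous_on Om v"
    "f \<in> borel_measurable M" "\<And>x. \<bar>f x\<bar> \<le> \<delta>"
    "sqn M (\<lambda>x. v x - ubar x) \<le> \<delta>" "sqn M (\<lambda>x. G x - wgrad Om ubar x) \<le> \<delta>"
    "\<And>\<phi>. \<phi> \<in> test_functions Om \<Longrightarrow>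
       (LINT x|M. G x \<bullet> grad \<phi> x) + (LINT x|M. f x * \<phi> x) = (LINT x|M. g_reg lp lm q \<epsilon> (v x) * \<phi> x)"
proof -
  have ub: "ubar \<in> H1 Om" using min by (auto simp: minimizer_def intro: admissible_H1)
  obtain \<epsilon> u f where \<epsilon>: "0 < \<epsilon>" "\<epsilon> < \<delta>" and u: "u \<in> H1 Om" and f: "f \<in> borel_measurable M" "\<And>x. \<bar>f x\<bar> \<le> \<delta>"
    and d: "sqn M (\<lambda>x. u x - ubar x) \<le> \<delta>" "dirichlet Om (\<lambda>x. u x - ubar x) \<le> \<delta>"
    and ws: "weak_solution Om f (\<lambda>x. g_reg lp lm q \<epsilon> (u x)) u"
    using minimizer_approximation[OF min \<delta>] by blast
  have um: "u \<in> borel_measurable M" by (rule sqintD(1)[OF H1D(1)[OF u]])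
  have gm: "(\<lambda>x. g_reg lp lm q \<epsilon> (u x)) \<in> borel_measurable M" using um by measurable
  define h where "h = (\<lambda>x. g_reg lp lm q \<epsilon> (u x) - f x)"
  have hm: "h \<in> borel_measurable M" unfolding h_def using gm f(1) by (rule borel_measurable_diff)
  have hb: "\<bar>h x\<bar> \<le> (lp + lm) * \<epsilon> powr (q - 1) + \<delta>" for x
    unfolding h_def using g_reg_bound[OF \<epsilon>(1), of "u x"] f(2)[of x] by linarith
  have eq: "(LINT x|M. wgrad Om u x \<bullet> grad \<phi> x) = (LINT x|M. h x * \<phi> x)" if \<phi>: "\<phi> \<in> test_functions Om" for \<phi>
  proof -
    have "(LINT x|M. h x * \<phi> x) = (LINT x|M. g_reg lp lm q \<epsilon> (u x) * \<phi> x) - (LINT x|M. f x * \<phi> x)"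
      unfolding h_def left_diff_distrib
      by (intro Bochner_Integration.integral_diff bounded_test_integrable[OF gm g_reg_bound[OF \<epsilon>(1)] \<phi>]
          bounded_test_integrable[OF f \<phi>])
    then show ?thesis using ws \<phi> by (auto simp: weak_solution_def)
  qed
  obtain v where v: "continuous_on Om v" "AE x in M. u x = v x"
    using interior_continuity[OF u hm hb eq] by blast
  have vm: "v \<in> borel_measurable M" by (rule measurable_AE_cong[OF um v(2)])
  have wg: "weak_gradient Om v (wgrad Om u)" by (rule weak_gradient_cong_AE[OF v(2) op H1D(2)[OF u] vm])
  have vs: "sqint M v" by (rule sqint_AE_cong(1)[OF H1D(1)[OF u] v(2)])
  have ae: "AE x in M. u x - ubar x = v x - ubar x" using v(2) by (rule eventually_mono) simp
  have d1: "sqn M (\<lambda>x. v x - ubar x) \<le> \<delta>"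
    using sqint_AE_cong(2)[OF sqint_diff[OF H1D(1)[OF u] H1D(1)[OF ub]] ae] d(1) by simp
  have d2: "sqn M (\<lambda>x. wgrad Om u x - wgrad Om ubar x) \<le> \<delta>" using d(2) by (simp add: dirichlet_diff[OF u ub])
  have "(LINT x|M. wgrad Om u x \<bullet> grad \<phi> x) + (LINT x|M. f x * \<phi> x) = (LINT x|M. g_reg lp lm q \<epsilon> (v x) * \<phi> x)"
    if \<phi>: "\<phi> \<in> test_functions Om" for \<phi>
  proof -
    have "(LINT x|M. g_reg lp lm q \<epsilon> (u x) * \<phi> x) = (LINT x|M. g_reg lp lm q \<epsilon> (v x) * \<phi> x)"
    proof (rule integral_cong_AE)
      have pm: "\<phi> \<in> borel_measurable M" by (rule sqintD(1)[OF test_sqint(1)[OF \<phi>]])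
      show "(\<lambda>x. g_reg lp lm q \<epsilon> (u x) * \<phi> x) \<in> borel_measurable M" using um pm by measurable
      show "(\<lambda>x. g_reg lp lm q \<epsilon> (v x) * \<phi> x) \<in> borel_measurable M" using vm pm by measurable
      show "AE x in M. g_reg lp lm q \<epsilon> (u x) * \<phi> x = g_reg lp lm q \<epsilon> (v x) * \<phi> x"
        using v(2) by (rule eventually_mono) simp
    qed
    then show ?thesis using ws \<phi> by (auto simp: weak_solution_def)
  qed
  then show thesis by (rule that[OF \<epsilon> vs wg H1D(3)[OF u] v(1) f d1 d2])
qed

end

text \<open>The approximating solutions are dilated by factors \<open>r n < 1\<close> tending to 1.  This turns continuity
  in the open ball into continuity on the closed ball, rescales \<open>\<epsilon>\<close> and \<open>f\<close> by bounded factors, and keeps the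
  strong convergence in $H^1$ on the whole ball.\<close>

theorem minimizer_good_solution_unit_ball:
  fixes u0 ubar :: "'a::euclidean_space \<Rightarrow> real"
  assumes "lp > 0" "lm > 0" "0 < q" "q < 1"
    and min: "minimizer (J (ball 0 1) lp lm q) (admissible (ball 0 1) u0) ubar"
  shows "good_solution (ball 0 1) lp lm q ubar"
proof -
  define Om :: "'a set" where "Om = ball 0 1"
  interpret variational Om lp lm q
    using assms by unfold_locales (auto simp: Om_def)
  interpret star_shaped Om
  proof unfold_locales
    fix x :: 'a and r :: real assume "x \<in> Om" "0 < r" "r < 1"
    then show "r *\<^sub>R x \<in> Om" using mult_strict_mono[of r 1 "norm x" 1] by (simp add: Om_def)
  qed
  have ub: "ubar \<in> H1 Om" using min by (auto simp: minimizer_def Om_def[symmetric] intro: admissible_H1)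
  define \<delta> where "\<delta> = (\<lambda>n. 1 / real (Suc n))"
  have \<delta>0: "\<delta> \<longlonglongrightarrow> 0" unfolding \<delta>_def by (rule LIMSEQ_Suc[OF lim_const_over_n])
  have \<delta>: "0 < \<delta> n" "\<delta> n \<le> 1" for n by (auto simp: \<delta>_def)
  define good where "good = (\<lambda>n (\<epsilon> :: real, v, f, G). 0 < \<epsilon> \<and> \<epsilon> < \<delta> n \<and> sqint M v \<and> weak_gradient Om v G \<and> sqint M G
    \<and> continuous_on Om v \<and> f \<in> borel_measurable M \<and> (\<forall>x. \<bar>f x\<bar> \<le> \<delta> n)
    \<and> sqn M (\<lambda>x. v x - ubar x) \<le> \<delta> n \<and> sqn M (\<lambda>x. G x - wgrad Om ubar x) \<le> \<delta> n
    \<and> (\<forall>\<phi>\<in>test_functions Om.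
       (LINT x|M. G x \<bullet> grad \<phi> x) + (LINT x|M. f x * \<phi> x) = (LINT x|M. g_reg lp lm q \<epsilon> (v x) * \<phi> x)))"
  have "\<exists>p. good n p" for n
  proof -
    obtain \<epsilon> v f G where "0 < \<epsilon>" "\<epsilon> < \<delta> n" "sqint M v" "weak_gradient Om v G" "sqint M G" "continuous_on Om v"
      "f \<in> borel_measurable M" "\<And>x. \<bar>f x\<bar> \<le> \<delta> n"
      "sqn M (\<lambda>x. v x - ubar x) \<le> \<delta> n" "sqn M (\<lambda>x. G x - wgrad Om ubar x) \<le> \<delta> n"
      "\<And>\<phi>. \<phi> \<in> test_functions Om \<Longrightarrow>
       (LINT x|M. G x \<bullet> grad \<phi> x) + (LINT x|M. f x * \<phi> x) = (LINT x|M. g_reg lp lm q \<epsilon> (v x) * \<phi> x)"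
      by (rule continuous_approximation[OF min[folded Om_def] \<delta>(1)[of n]]) (rule that)
    then have "good n (\<epsilon>, v, f, G)" unfolding good_def by simp
    then show ?thesis by blast
  qed
  then obtain p where p: "\<And>n. good n (p n)" by metis
  define \<epsilon> where "\<epsilon> = (\<lambda>n. fst (p n))"
  define v where "v = (\<lambda>n. fst (snd (p n)))"
  define f where "f = (\<lambda>n. fst (snd (snd (p n))))"
  define G where "G = (\<lambda>n. snd (snd (snd (p n))))"
  have \<epsilon>: "0 < \<epsilon> n" "\<epsilon> n < \<delta> n" and vs: "sqint M (v n)" and vG: "weak_gradient Om (v n) (G n)"
    and Gs: "sqint M (G n)" and vc: "continuous_on Om (v n)" and fm: "f n \<in> borel_measurable M"
    and fb: "\<bar>f n x\<bar> \<le> \<delta> n" and dv: "sqn M (\<lambda>x. v n x - ubar x) \<le> \<delta> n"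
    and dG: "sqn M (\<lambda>x. G n x - wgrad Om ubar x) \<le> \<delta> n"
    and eq: "\<phi> \<in> test_functions Om \<Longrightarrow>
       (LINT x|M. G n x \<bullet> grad \<phi> x) + (LINT x|M. f n x * \<phi> x) = (LINT x|M. g_reg lp lm q (\<epsilon> n) (v n x) * \<phi> x)" for n x \<phi>
    using p[of n] unfolding good_def \<epsilon>_def v_def f_def G_def by (auto simp: split_beta)
  define r where "r = (\<lambda>n. 1 - 1 / real (Suc (Suc n)))"
  have r: "0 < r n" "r n < 1" for n by (auto simp: r_def)
  have r1: "r \<longlonglongrightarrow> 1"
  proof -
    have "(\<lambda>n. 1 - 1 / real (Suc (Suc n))) \<longlonglongrightarrow> 1 - 0"
      by (intro tendsto_intros LIMSEQ_Suc[OF LIMSEQ_Suc[OF lim_const_over_n]])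
    then show ?thesis by (simp add: r_def)
  qed
  define c where "c = (\<lambda>n. r n powr (- 2 / (2 - q)))"
  have c0: "c n > 0" for n using r(1)[of n] by (simp add: c_def)
  have c1: "c \<longlonglongrightarrow> 1"
  proof -
    have "(\<lambda>n. r n powr (- 2 / (2 - q))) \<longlonglongrightarrow> 1 powr (- 2 / (2 - q))"
      by (intro tendsto_powr r1 tendsto_const) simp
    then show ?thesis by (simp add: c_def)
  qed
  obtain K where K: "K > 0" "\<And>n. \<bar>c n\<bar> \<le> K"
    using convergent_imp_Bseq[of c] c1 by (auto simp: convergent_def Bseq_def)
  define w where "w = (\<lambda>n x. c n * v n (r n *\<^sub>R x))"
  define k where "k = (\<lambda>n x. c n * (r n)\<^sup>2 * f n (r n *\<^sub>R x))"
  have vd: "sqint M (\<lambda>x. v n (r n *\<^sub>R x))" for n by (rule sqint_dilation(1)[OF r vs])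
  have Gd: "sqint M (\<lambda>x. G n (r n *\<^sub>R x))" for n by (rule sqint_dilation(1)[OF r Gs])
  have ws: "sqint M (w n)" for n unfolding w_def by (rule sqint_cmult[OF vd])
  have wg: "weak_gradient Om (w n) (\<lambda>x. (c n * r n) *\<^sub>R G n (r n *\<^sub>R x))" for n
    using weak_gradient_cmult[OF weak_gradient_dilation[OF r vs vG Gs], of "c n"] by (simp add: w_def)
  have gs: "sqint M (\<lambda>x. (c n * r n) *\<^sub>R G n (r n *\<^sub>R x))" for n by (rule sqint_scaleR[OF Gd])
  have wH: "w n \<in> H1 Om" for n by (rule H1_I[OF ws wg gs])
  have factor: "(\<lambda>n. 2 * (a n)\<^sup>2 * (1 / r n ^ DIM('a)) * \<delta> n + 2 * b n) \<longlonglongrightarrow> 0"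
    if "a \<longlonglongrightarrow> 1" "b \<longlonglongrightarrow> 0" for a b
  proof -
    have "(\<lambda>n. 2 * (a n)\<^sup>2 * (1 / r n ^ DIM('a)) * \<delta> n + 2 * b n) \<longlonglongrightarrow> 2 * 1\<^sup>2 * (1 / 1 ^ DIM('a)) * 0 + 2 * 0"
      by (intro tendsto_intros r1 \<delta>0 that) auto
    then show ?thesis by simp
  qed
  have l1: "(\<lambda>n. sqn M (\<lambda>x. w n x - ubar x)) \<longlonglongrightarrow> 0"
  proof (rule tendsto_sandwich[OF _ _ tendsto_const])
    note us = H1D(1)[OF ub]
    let ?b = "\<lambda>n. sqn M (\<lambda>x. c n * ubar (r n *\<^sub>R x) - ubar x)"
    show "(\<lambda>n. 2 * (c n)\<^sup>2 * (1 / r n ^ DIM('a)) * \<delta> n + 2 * ?b n) \<longlonglongrightarrow> 0"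
      by (intro factor c1 dilation_continuous_L2 us r r1)
    have "sqn M (\<lambda>x. w n x - ubar x) \<le> 2 * (c n)\<^sup>2 * (1 / r n ^ DIM('a)) * \<delta> n + 2 * ?b n" for n
    proof -
      have s: "sqint M (\<lambda>x. v n x - ubar x)" by (rule sqint_diff[OF vs us])
      have "sqn M (\<lambda>x. w n x - ubar x)
          = sqn M (\<lambda>x. c n * (v n (r n *\<^sub>R x) - ubar (r n *\<^sub>R x)) + (c n * ubar (r n *\<^sub>R x) - ubar x))"
        by (simp add: w_def algebra_simps)
      also have "\<dots> \<le> 2 * sqn M (\<lambda>x. c n * (v n (r n *\<^sub>R x) - ubar (r n *\<^sub>R x))) + 2 * ?b n"
        by (intro sqn_add_le2 sqint_cmult sqint_diff us sqint_dilation[OF r] vs)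
      finally have 1: "sqn M (\<lambda>x. w n x - ubar x)
          \<le> 2 * ((c n)\<^sup>2 * sqn M (\<lambda>x. v n (r n *\<^sub>R x) - ubar (r n *\<^sub>R x))) + 2 * ?b n" by (simp only: sqn_cmult)
      have "sqn M (\<lambda>x. v n (r n *\<^sub>R x) - ubar (r n *\<^sub>R x)) \<le> (1 / r n ^ DIM('a)) * sqn M (\<lambda>x. v n x - ubar x)"
        by (rule sqint_dilation(2)[OF r s])
      also have "\<dots> \<le> (1 / r n ^ DIM('a)) * \<delta> n" using dv r(1)[of n] by (intro mult_left_mono) auto
      finally have "2 * (c n)\<^sup>2 * sqn M (\<lambda>x. v n (r n *\<^sub>R x) - ubar (r n *\<^sub>R x)) \<le> 2 * (c n)\<^sup>2 * ((1 / r n ^ DIM('a)) * \<delta> n)"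
        by (intro mult_left_mono) auto
      then show ?thesis using 1 by (simp only: mult.assoc)
    qed
    then show "\<forall>\<^sub>F n in sequentially. sqn M (\<lambda>x. w n x - ubar x) \<le> 2 * (c n)\<^sup>2 * (1 / r n ^ DIM('a)) * \<delta> n + 2 * ?b n"
      by simp
  qed (simp add: sqn_nonneg)
  have l2: "(\<lambda>n. dirichlet Om (\<lambda>x. w n x - ubar x)) \<longlonglongrightarrow> 0"
  proof (rule tendsto_sandwich[OF _ _ tendsto_const])
    note us = H1D(3)[OF ub]
    let ?U = "wgrad Om ubar"
    let ?a = "\<lambda>n. c n * r n"
    let ?b = "\<lambda>n. sqn M (\<lambda>x. ?a n *\<^sub>R ?U (r n *\<^sub>R x) - ?U x)"
    have a1: "?a \<longlonglongrightarrow> 1" using tendsto_mult[OF c1 r1] by simp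
    show "(\<lambda>n. 2 * (?a n)\<^sup>2 * (1 / r n ^ DIM('a)) * \<delta> n + 2 * ?b n) \<longlonglongrightarrow> 0"
      by (intro factor a1 dilation_continuous_L2_vector us r r1)
    have "dirichlet Om (\<lambda>x. w n x - ubar x) \<le> 2 * (?a n)\<^sup>2 * (1 / r n ^ DIM('a)) * \<delta> n + 2 * ?b n" for n
    proof -
      have s: "sqint M (\<lambda>x. G n x - ?U x)" by (rule sqint_diff[OF Gs us])
      have "dirichlet Om (\<lambda>x. w n x - ubar x) = sqn M (\<lambda>x. ?a n *\<^sub>R G n (r n *\<^sub>R x) - ?U x)"
        by (intro sqn_wgrad weak_gradient_diff wg H1D(2) ub op sqint_diff gs us)
      also have "\<dots> = sqn M (\<lambda>x. ?a n *\<^sub>R (G n (r n *\<^sub>R x) - ?U (r n *\<^sub>R x)) + (?a n *\<^sub>R ?U (r n *\<^sub>R x) - ?U x))"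
        by (simp add: algebra_simps)
      also have "\<dots> \<le> 2 * sqn M (\<lambda>x. ?a n *\<^sub>R (G n (r n *\<^sub>R x) - ?U (r n *\<^sub>R x))) + 2 * ?b n"
        by (intro sqn_add_le2 sqint_scaleR sqint_diff us sqint_dilation[OF r] Gs)
      finally have 1: "dirichlet Om (\<lambda>x. w n x - ubar x)
          \<le> 2 * ((?a n)\<^sup>2 * sqn M (\<lambda>x. G n (r n *\<^sub>R x) - ?U (r n *\<^sub>R x))) + 2 * ?b n" by (simp only: sqn_scaleR)
      have "sqn M (\<lambda>x. G n (r n *\<^sub>R x) - ?U (r n *\<^sub>R x)) \<le> (1 / r n ^ DIM('a)) * sqn M (\<lambda>x. G n x - ?U x)"
        by (rule sqint_dilation(2)[OF r s])
      also have "\<dots> \<le> (1 / r n ^ DIM('a)) * \<delta> n" using dG r(1)[of n] by (intro mult_left_mono) auto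
      finally have "2 * (?a n)\<^sup>2 * sqn M (\<lambda>x. G n (r n *\<^sub>R x) - ?U (r n *\<^sub>R x)) \<le> 2 * (?a n)\<^sup>2 * ((1 / r n ^ DIM('a)) * \<delta> n)"
        by (intro mult_left_mono) auto
      then show ?thesis using 1 by (simp only: mult.assoc)
    qed
    then show "\<forall>\<^sub>F n in sequentially. dirichlet Om (\<lambda>x. w n x - ubar x) \<le> 2 * (?a n)\<^sup>2 * (1 / r n ^ DIM('a)) * \<delta> n + 2 * ?b n"
      by simp
  qed (simp add: dirichlet_nonneg)
  have kb: "\<bar>k n x\<bar> \<le> K * \<delta> n" for n x
  proof -
    have "\<bar>k n x\<bar> = \<bar>c n\<bar> * (r n)\<^sup>2 * \<bar>f n (r n *\<^sub>R x)\<bar>" by (simp add: k_def abs_mult)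
    also have "\<dots> \<le> K * 1 * \<delta> n"
      using K(2)[of n] fb[of n "r n *\<^sub>R x"] r[of n] K(1) by (intro mult_mono) (auto intro: power_le_one less_imp_le)
    finally show ?thesis by simp
  qed
  have k0: "(\<lambda>n. k n x) \<longlonglongrightarrow> 0" for x
    by (rule Lim_null_comparison[of _ "\<lambda>n. K * \<delta> n"]) (use kb tendsto_mult_right_zero[OF \<delta>0] in auto)
  have km: "k n \<in> borel_measurable M" for n
    unfolding k_def by (intro borel_measurable_times borel_measurable_const dilation_integral(3)[OF r fm])
  have hm: "(\<lambda>x. g_reg lp lm q (\<epsilon> n) (v n x)) \<in> borel_measurable M" for n
    using sqintD(1)[OF vs[of n]] by measurable
  have sol: "weak_solution Om (k n)
     (\<lambda>x. lp * pos (w n x) / ((c n * \<epsilon> n)\<^sup>2 + (w n x)\<^sup>2) powr ((2 - q) / 2)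
        - lm * neg (w n x) / ((c n * \<epsilon> n)\<^sup>2 + (w n x)\<^sup>2) powr ((2 - q) / 2)) (w n)" for n
  proof -
    have cn: "c n = r n powr (- 2 / (2 - q))" by (simp add: c_def)
    have h: "c n * (r n)\<^sup>2 * g_reg lp lm q (\<epsilon> n) (v n (r n *\<^sub>R x)) = g_reg lp lm q (c n * \<epsilon> n) (w n x)" for x
      unfolding w_def by (rule g_reg_scaling[OF r(1) cn])
    have "weak_solution Om (\<lambda>x. c n * (r n)\<^sup>2 * f n (r n *\<^sub>R x))
        (\<lambda>x. c n * (r n)\<^sup>2 * g_reg lp lm q (\<epsilon> n) (v n (r n *\<^sub>R x))) (\<lambda>x. c n * v n (r n *\<^sub>R x))"
      by (rule weak_equation_dilation[OF r vs vG Gs fm hm eq])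
    then have "weak_solution Om (k n) (\<lambda>x. g_reg lp lm q (c n * \<epsilon> n) (w n x)) (w n)"
      unfolding h by (simp only: k_def w_def)
    then show ?thesis by (simp only: g_reg_def)
  qed
  have \<epsilon>l: "(\<lambda>n. c n * \<epsilon> n) \<longlonglongrightarrow> 0"
  proof -
    have "\<epsilon> \<longlonglongrightarrow> 0"
      by (rule tendsto_sandwich[OF _ _ tendsto_const \<delta>0]) (simp_all add: \<epsilon> less_imp_le)
    then show ?thesis using tendsto_mult[OF c1, of \<epsilon> 0] by simp
  qed
  have wc: "continuous_on (closure Om) (w n)" for n
    unfolding w_def
  proof (intro continuous_on_mult continuous_on_const continuous_on_compose2[OF vc])
    show "(\<lambda>x. r n *\<^sub>R x) ` closure Om \<subseteq> Om"
    proof safe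
      fix x assume "x \<in> closure Om"
      then have "norm x \<le> 1" by (simp add: Om_def)
      then have "r n * norm x \<le> r n * 1" using r(1)[of n] by (intro mult_left_mono) auto
      then have "r n * norm x < 1" using r(2)[of n] by linarith
      then show "r n *\<^sub>R x \<in> Om" using r(1)[of n] by (simp add: Om_def)
    qed
  qed (intro continuous_intros)
  show ?thesis
    unfolding good_solution_def Om_def[symmetric]
  proof (rule conjI[OF H1_H1_loc[OF ub]], rule exI[of _ "\<lambda>n. c n * \<epsilon> n"], rule exI[of _ w],
      rule exI[of _ k], intro conjI exI[of _ K] allI impI)
    show "0 < c n * \<epsilon> n" for n using c0 \<epsilon>(1) by simp
    show "w n \<in> H1_loc Om" for n by (rule H1_H1_loc[OF wH])
    show "k n \<in> Linf Om" for n unfolding Linf_def using km kb[of n] by (auto intro!: exI[of _ "K * \<delta> n"])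
    show "weakly_converges_H1 (interior C) w ubar" if "compact C \<and> C \<subseteq> Om" for C
      by (rule strong_imp_weak_convergence[OF wH ub _ _ l1 l2]) (use that interior_subset in auto)
    show "AE x in M. (\<lambda>n. k n x) \<longlonglongrightarrow> 0" using k0 by simp
    have "K * \<delta> n \<le> K" for n using K(1) \<delta>(2)[of n] mult_left_mono[of "\<delta> n" 1 K] by simp
    then have "\<bar>k n x\<bar> \<le> K" for n x using kb order_trans by blast
    then show "AE x in M. \<bar>k n x\<bar> \<le> K" for n by simp
  qed (rule \<epsilon>l wc sol)+
qed

theorem proposition5p2:
  fixes u0 ubar :: "real ^ 'n \<Rightarrow> real"
    and lp lm q :: real
  assumes "CARD('n) \<ge> 2"
    and "u0 \<in> H1 (ball 0 1)"
    and "continuous_on (closure (ball 0 1)) u0"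
    and "lp > 0" and "lm > 0"
    and "0 < q" and "q < 1"
    and "minimizer (J (ball 0 1) lp lm q) (admissible (ball 0 1) u0) ubar"
  shows "good_solution (ball 0 1) lp lm q ubar"
  using assms(4-8) by (rule minimizer_good_solution_unit_ball)

end
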